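(* Let $K\in C^{\infty}(E_{*})$ be a strictly positive function such that $K(\xi)=K(\|\xi\|)$ for all $\xi\in E_*$ (i.e. $K(\xi)$ depends only on $\|\xi\|$). (1) If there exists a real number $r>0$ such that $K(r\xi)=r^{1-m}$ for all $\xi\in\Sigma$, then there exists a radial graph $\mathcal{Y}$ on $\Sigma$ whose vertical Gaussian curvature is given by $K$. Such a graph may be chosen to be convex. (2) Conversely, if there exists a radial graph $\mathcal{Y}$ on $\Sigma$ with vertical Gaussian curvature given by $K$, then there exists a real number $r>0$ such that $K(r\xi)=r^{1-m}$ for all $\xi\in\Sigma$. (3) Furthermore, if $K(r\xi)=r^{1-m}$ for all $r>0$ and all $\xi\in\Sigma$, then there exist infinitely many pairwise non-homothetic radial graphs on $\Sigma$ with vertical Gaussian curvature given by $K$, but there is a unique, up to homothety, convex one.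
   Context: Setting: $(M,g)$ is a compact Riemannian manifold without boundary of dimension $n\ge 1$, with Levi-Civita connection $\nabla$; $(E,\tilde g)$ is a Riemannian vector bundle on $M$ of rank $m\ge 2$ with projection $\pi$ and a $\tilde g$-metric connection $\tilde\nabla$; $E_*$ is $E$ with the zero section removed; $\|\xi\|$ is the $\tilde g$-norm; $\Sigma=\{\xi\in E:\|\xi\|=1\}$ is the unit sphere bundle. Metric and connection on $E$: over a chart of $M$ with coordinates $(x^i)_{1\le i\le n}$ and a local frame $(s_\alpha)_{n+1\le\alpha\le n+m}$ of $E$ with fibre coordinates $(y^\alpha)$, write $\nabla_{\partial_i}\partial_j=\Gamma^k_{ij}\partial_k$ and $\tilde\nabla_{\partial_i}s_\alpha=\Gamma^\beta_{i\alpha}s_\beta$. Let $e_i=\partial/\partial x^i-y^\alpha\Gamma^\beta_{i\alpha}\,\partial/\partial y^\beta$ (horizontal lift) and $e_\alpha=\partial/\partial y^\alpha$ (vertical). The metric $G$ on $E$ is given by $G(e_i,e_j)=g(\partial_i,\partial_j)$, $G(e_\alpha,e_\beta)=\tilde g(s_\alpha,s_\beta)$, $G(e_i,e_\alpha)=0$. The Sasaki connection $D$ on $E$ (which is $G$-metric, in general with torsion) is given by $D_{e_i}e_j=\Gamma^k_{ij}e_k$, $D_{e_i}e_\alpha=\Gamma^\beta_{i\alpha}e_\beta$, $D_{e_\alpha}e_i=D_{e_\alpha}e_\beta=0$. Radial graph: a radial graph on $\Sigma$ is a hypersurface $\mathcal{Y}$ of $E_*$ that is the image of a map $\xi\in\Sigma\mapsto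 e^{u(\xi)}\xi$ with $u\in C^\infty(\Sigma)$. Two radial graphs are homothetic if one is the image of the other under $\xi\mapsto c\,\xi$ for some constant $c>0$. Vertical Gaussian curvature: for a hypersurface $\mathcal{Y}$ of $E$ such that each $\mathcal{Y}_x=\mathcal{Y}\cap E_x$ is a hypersurface of the Euclidean space $(E_x,\tilde g_x)$, the vertical Gaussian curvature at $\xi\in\mathcal{Y}\cap E_x$ is the Gaussian curvature (product of principal curvatures) of $\mathcal{Y}_x$ at $\xi$ as a hypersurface of $E_x$, with the sign convention making the sphere of radius $r$ have curvature $r^{-(m-1)}$. It is "given by $K$" if it equals $K(\xi)$ at every $\xi\in\mathcal{Y}$. Convexity: a radial graph $\mathcal{Y}$ is convex if its second fundamental form in $(E,G,D)$, namely $II(X,Y)=-G(D_XY,\tilde\nu)$ for $X,Y$ tangent to $\mathcal{Y}$ and $\tilde\nu$ the outward $G$-unit normal, is positive in the sense $II(X,X)\ge 0$ for all tangent $X$.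
   Formalization: The manifold M is assumed connected: on a disconnected M uniqueness up to homothety in (3) fails (sphere bundles with different constant radii over different components); (1), (2) and the infinitude in (3) extend component by component. *)

theory Defs
  imports "HOL-Analysis.Analysis"
begin

section \<open>Smooth maps and subsets of normed spaces\<close>

text \<open>The definitions are meant for open sets \<open>S\<close>.\<close>

primrec higher_differentiable_on ::
  "nat \<Rightarrow> 'v::real_normed_vector set \<Rightarrow> ('v \<Rightarrow> 'w::real_normed_vector) \<Rightarrow> bool" where
  "higher_differentiable_on 0 S f \<longleftrightarrow> continuous_on S f"
| "higher_differentiable_on (Suc k) S f \<longleftrightarrow>
     (\<forall>x\<in>S. f differentiable (at x)) \<and>
     (\<forall>v. higher_differentiable_on k S (\<lambda>x. frechet_derivative f (at x) v))"

definition smooth_on :: "'v::real_normed_vector set \<Rightarrow> ('v \<Rightarrow> 'w::real_normed_vector) \<Rightarrow> bool" where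
  "smooth_on S f \<longleftrightarrow> (\<forall>k. higher_differentiable_on k S f)"

text \<open>Velocities at \<open>z\<close> of smooth curves running in \<open>S\<close>. For an embedded submanifold \<open>S\<close> and
  \<open>z \<in> S\<close> this is the tangent space of \<open>S\<close> at \<open>z\<close>.\<close>

definition tangent_vectors :: "'v::real_normed_vector set \<Rightarrow> 'v \<Rightarrow> 'v set" where
  "tangent_vectors S z = {v. \<exists>\<gamma> \<epsilon>. \<epsilon> > 0 \<and> smooth_on {-\<epsilon><..<\<epsilon>} \<gamma> \<and> \<gamma> 0 = z \<and>
     (\<forall>s\<in>{-\<epsilon><..<\<epsilon>}. \<gamma> s \<in> S) \<and> (\<gamma> has_vector_derivative v) (at (0::real))}"

section \<open>Gaussian curvature of hypersurfaces of a Euclidean space\<close>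

text \<open>\<open>N\<close> is a smooth map on the open set \<open>W\<close> which restricts on \<open>S \<inter> W\<close> to the unit normal field
  of \<open>S\<close> that points away from the origin; this is the outward normal of a hypersurface which is a
  radial graph over a sphere centred at \<open>0\<close>.\<close>

definition outward_normal_field ::
  "'b::euclidean_space set \<Rightarrow> 'b set \<Rightarrow> ('b \<Rightarrow> 'b) \<Rightarrow> bool" where
  "outward_normal_field S W N \<longleftrightarrow> open W \<and> smooth_on W N \<and>
     (\<forall>z\<in>S \<inter> W. norm (N z) = 1 \<and> (\<forall>v\<in>tangent_vectors S z. N z \<bullet> v = 0) \<and> N z \<bullet> z > 0)"

text \<open>The differential \<open>N'\<close> of the outward unit normal restricts on the tangent space to the shape
  operator; \<open>P\<close> is an orthonormal basis of principal directions and \<open>\<kappa>\<close> gives the principal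
  curvatures. Differentiating the outward normal yields principal curvatures \<open>1 / r\<close> for the sphere
  of radius \<open>r\<close>.\<close>

definition has_gauss_curvature :: "'b::euclidean_space set \<Rightarrow> 'b \<Rightarrow> real \<Rightarrow> bool" where
  "has_gauss_curvature S z k \<longleftrightarrow> z \<in> S \<and>
     (\<exists>W N N' P \<kappa>. z \<in> W \<and> outward_normal_field S W N \<and> (N has_derivative N') (at z) \<and>
        pairwise orthogonal P \<and> (\<forall>p\<in>P. norm p = 1) \<and> span P = tangent_vectors S z \<and>
        (\<forall>p\<in>P. N' p = \<kappa> p *\<^sub>R p) \<and> k = (\<Prod>p\<in>P. \<kappa> p))"

section \<open>Riemannian vector bundles with connections\<close>

text \<open>The base manifold is the whole type \<open>'p\<close>, modelled on \<open>'a\<close> (so its dimension is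
  \<open>DIM('a)\<close>); the total space is the whole type \<open>'e\<close>, with typical fibre \<open>'b\<close> (so the rank is
  \<open>DIM('b)\<close>).

  A chart \<open>(U, \<phi>)\<close> has domain \<open>U\<close>; a local trivialization \<open>(V, \<psi>)\<close> of the bundle over \<open>V\<close> gives
  the fibre coordinates \<open>\<psi> \<xi>\<close> of \<open>\<xi>\<close> with respect to the corresponding local frame.
  Tensors and connection coefficients are written in coordinates, as multilinear maps of coordinate
  vectors, where \<open>x\<close> is the coordinate of the base point:
  \<open>base_metric B c x v w\<close> is \<open>g\<^sub>i\<^sub>j v\<^sup>i w\<^sup>j\<close>;
  \<open>base_conn B c x v w\<close> is the vector with components \<open>\<Gamma>\<^sup>k\<^sub>i\<^sub>j v\<^sup>i w\<^sup>j\<close>;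
  \<open>fibre_conn B c t x v y\<close> is the vector with components \<open>\<Gamma>\<^sup>\<beta>\<^sub>i\<^sub>\<alpha> v\<^sup>i y\<^sup>\<alpha>\<close>.\<close>

type_synonym ('p, 'a) chart = "'p set \<times> ('p \<Rightarrow> 'a)"
type_synonym ('p, 'e, 'b) triv = "'p set \<times> ('e \<Rightarrow> 'b)"

record ('p, 'e, 'a, 'b) metric_bundle =
  charts :: "('p, 'a) chart set"
  base_metric :: "('p, 'a) chart \<Rightarrow> 'a \<Rightarrow> 'a \<Rightarrow> 'a \<Rightarrow> real"
  base_conn :: "('p, 'a) chart \<Rightarrow> 'a \<Rightarrow> 'a \<Rightarrow> 'a \<Rightarrow> 'a"
  proj :: "'e \<Rightarrow> 'p"
  fibre_add :: "'e \<Rightarrow> 'e \<Rightarrow> 'e"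
  fibre_scale :: "real \<Rightarrow> 'e \<Rightarrow> 'e"
  trivs :: "('p, 'e, 'b) triv set"
  fibre_metric :: "'e \<Rightarrow> 'e \<Rightarrow> real"
  fibre_conn :: "('p, 'a) chart \<Rightarrow> ('p, 'e, 'b) triv \<Rightarrow> 'a \<Rightarrow> 'a \<Rightarrow> 'b \<Rightarrow> 'b"

definition transition :: "('p, 'a) chart \<Rightarrow> ('p, 'a) chart \<Rightarrow> 'a \<Rightarrow> 'a" where
  "transition c' c x = snd c (inv_into (fst c') (snd c') x)"

definition smooth_manifold ::
  "('p::t2_space, 'e, 'a::euclidean_space, 'b) metric_bundle \<Rightarrow> bool" where
  "smooth_manifold B \<longleftrightarrow> (\<Union>c\<in>charts B. fst c) = UNIV \<and>
     (\<forall>c\<in>charts B. open (fst c) \<and> open (snd c ` fst c) \<and>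
        (\<exists>h. homeomorphism (fst c) (snd c ` fst c) (snd c) h)) \<and>
     (\<forall>c\<in>charts B. \<forall>c'\<in>charts B. smooth_on (snd c' ` (fst c' \<inter> fst c)) (transition c' c))"

definition riemannian_metric ::
  "('p::t2_space, 'e, 'a::euclidean_space, 'b) metric_bundle \<Rightarrow> bool" where
  "riemannian_metric B \<longleftrightarrow>
     (\<forall>c\<in>charts B.
        (\<forall>v w. smooth_on (snd c ` fst c) (\<lambda>x. base_metric B c x v w)) \<and>
        (\<forall>x\<in>snd c ` fst c. bilinear (base_metric B c x) \<and>
           (\<forall>v w. base_metric B c x v w = base_metric B c x w v) \<and>
           (\<forall>v. v \<noteq> 0 \<longrightarrow> base_metric B c x v v > 0))) \<and>
     (\<forall>c\<in>charts B. \<forall>c'\<in>charts B. \<forall>p\<in>fst c \<inter> fst c'. \<forall>v w.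
        let A = frechet_derivative (transition c' c) (at (snd c' p))
        in base_metric B c' (snd c' p) v w = base_metric B c (snd c p) (A v) (A w))"

text \<open>The Levi-Civita connection is the torsion-free metric connection; since these conditions
  determine the coefficients in every chart, the transformation rule under change of charts need
  not be required separately.\<close>

definition levi_civita_connection ::
  "('p::t2_space, 'e, 'a::euclidean_space, 'b) metric_bundle \<Rightarrow> bool" where
  "levi_civita_connection B \<longleftrightarrow>
     (\<forall>c\<in>charts B.
        (\<forall>v w. smooth_on (snd c ` fst c) (\<lambda>x. base_conn B c x v w)) \<and>
        (\<forall>x\<in>snd c ` fst c. bilinear (base_conn B c x) \<and>
           (\<forall>v w. base_conn B c x v w = base_conn B c x w v) \<and>
           (\<forall>u v w. frechet_derivative (\<lambda>x. base_metric B c x v w) (at x) u =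
              base_metric B c x (base_conn B c x u v) w +
              base_metric B c x v (base_conn B c x u w))))"

text \<open>Coordinates \<open>(x, y)\<close> on the part of the total space over \<open>fst c \<inter> fst t\<close>.\<close>

definition coords ::
  "('p, 'e, 'a, 'b) metric_bundle \<Rightarrow> ('p, 'a) chart \<Rightarrow> ('p, 'e, 'b) triv \<Rightarrow> 'e \<Rightarrow> 'a \<times> 'b" where
  "coords B c t \<xi> = (snd c (proj B \<xi>), snd t \<xi>)"

definition from_coords ::
  "('p, 'e, 'a, 'b) metric_bundle \<Rightarrow> ('p, 'a) chart \<Rightarrow> ('p, 'e, 'b) triv \<Rightarrow> 'a \<times> 'b \<Rightarrow> 'e" where
  "from_coords B c t = inv_into (proj B -` (fst c \<inter> fst t)) (coords B c t)"

definition total_transition ::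
  "('p, 'e, 'a, 'b) metric_bundle \<Rightarrow> ('p, 'a) chart \<Rightarrow> ('p, 'e, 'b) triv \<Rightarrow>
     ('p, 'a) chart \<Rightarrow> ('p, 'e, 'b) triv \<Rightarrow> 'a \<times> 'b \<Rightarrow> 'a \<times> 'b" where
  "total_transition B c' t' c t z = coords B c t (from_coords B c' t' z)"

definition vector_bundle ::
  "('p::t2_space, 'e::topological_space, 'a::euclidean_space, 'b::euclidean_space) metric_bundle \<Rightarrow> bool"
  where
  "vector_bundle B \<longleftrightarrow> continuous_on UNIV (proj B) \<and> (\<Union>t\<in>trivs B. fst t) = UNIV \<and>
     (\<forall>t\<in>trivs B. open (fst t) \<and>
        (\<exists>h. homeomorphism (proj B -` fst t) (fst t \<times> UNIV) (\<lambda>\<xi>. (proj B \<xi>, snd t \<xi>)) h)) \<and>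
     (\<forall>\<xi> \<eta>. proj B \<xi> = proj B \<eta> \<longrightarrow> proj B (fibre_add B \<xi> \<eta>) = proj B \<xi> \<and>
        (\<forall>t\<in>trivs B. proj B \<xi> \<in> fst t \<longrightarrow> snd t (fibre_add B \<xi> \<eta>) = snd t \<xi> + snd t \<eta>)) \<and>
     (\<forall>r \<xi>. proj B (fibre_scale B r \<xi>) = proj B \<xi> \<and>
        (\<forall>t\<in>trivs B. proj B \<xi> \<in> fst t \<longrightarrow> snd t (fibre_scale B r \<xi>) = r *\<^sub>R snd t \<xi>)) \<and>
     (\<forall>c\<in>charts B. \<forall>t\<in>trivs B. \<forall>c'\<in>charts B. \<forall>t'\<in>trivs B.
        smooth_on (snd c' ` (fst c \<inter> fst t \<inter> fst c' \<inter> fst t') \<times> UNIV)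
          (total_transition B c' t' c t))"

text \<open>The value \<open>g\<^sub>\<alpha>\<^sub>\<beta>(x) y\<^sup>\<alpha> z\<^sup>\<beta>\<close> of the fibre metric in the local frame.\<close>

definition local_fibre_metric ::
  "('p, 'e, 'a, 'b) metric_bundle \<Rightarrow> ('p, 'a) chart \<Rightarrow> ('p, 'e, 'b) triv \<Rightarrow> 'a \<Rightarrow> 'b \<Rightarrow> 'b \<Rightarrow> real" where
  "local_fibre_metric B c t x y z =
     fibre_metric B (from_coords B c t (x, y)) (from_coords B c t (x, z))"

definition riemannian_fibre_metric ::
  "('p, 'e, 'a::euclidean_space, 'b::euclidean_space) metric_bundle \<Rightarrow> bool" where
  "riemannian_fibre_metric B \<longleftrightarrow>
     (\<forall>c\<in>charts B. \<forall>t\<in>trivs B.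
        (\<forall>y z. smooth_on (snd c ` (fst c \<inter> fst t)) (\<lambda>x. local_fibre_metric B c t x y z)) \<and>
        (\<forall>x\<in>snd c ` (fst c \<inter> fst t). bilinear (local_fibre_metric B c t x) \<and>
           (\<forall>y z. local_fibre_metric B c t x y z = local_fibre_metric B c t x z y) \<and>
           (\<forall>y. y \<noteq> 0 \<longrightarrow> local_fibre_metric B c t x y y > 0)))"

text \<open>The last condition is the transformation rule of connection coefficients. It says that the
  covariant derivative of a section with fibre coordinates \<open>s\<close>, whose value in the direction \<open>v\<close> has
  fibre coordinates \<open>frechet_derivative s (at x) v + fibre_conn B c t x v (s x)\<close>, does not depend on
  the chart and the frame.\<close>

definition bundle_connection ::
  "('p, 'e, 'a::euclidean_space, 'b::euclidean_space) metric_bundle \<Rightarrow> bool" where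
  "bundle_connection B \<longleftrightarrow>
     (\<forall>c\<in>charts B. \<forall>t\<in>trivs B.
        (\<forall>v y. smooth_on (snd c ` (fst c \<inter> fst t)) (\<lambda>x. fibre_conn B c t x v y)) \<and>
        (\<forall>x\<in>snd c ` (fst c \<inter> fst t). bilinear (fibre_conn B c t x))) \<and>
     (\<forall>c\<in>charts B. \<forall>t\<in>trivs B. \<forall>c'\<in>charts B. \<forall>t'\<in>trivs B.
        \<forall>p\<in>fst c \<inter> fst t \<inter> fst c' \<inter> fst t'. \<forall>v y.
        let x' = snd c' p; x = snd c p;
            A = (\<lambda>x' y. snd (total_transition B c' t' c t (x', y)));
            J = frechet_derivative (transition c' c) (at x')
        in A x' (fibre_conn B c' t' x' v y) =
           frechet_derivative (\<lambda>x'. A x' y) (at x') v + fibre_conn B c t x (J v) (A x' y))"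

definition metric_connection ::
  "('p, 'e, 'a::euclidean_space, 'b::euclidean_space) metric_bundle \<Rightarrow> bool" where
  "metric_connection B \<longleftrightarrow>
     (\<forall>c\<in>charts B. \<forall>t\<in>trivs B. \<forall>x\<in>snd c ` (fst c \<inter> fst t). \<forall>v y z.
        frechet_derivative (\<lambda>x. local_fibre_metric B c t x y z) (at x) v =
          local_fibre_metric B c t x (fibre_conn B c t x v y) z +
          local_fibre_metric B c t x y (fibre_conn B c t x v z))"

text \<open>As usual for manifolds, the base is connected. Second countability follows from compactness.\<close>

definition riemannian_bundle ::
  "('p::t2_space, 'e::topological_space, 'a::euclidean_space, 'b::euclidean_space) metric_bundle \<Rightarrow> bool"
  where
  "riemannian_bundle B \<longleftrightarrow>
     compact (UNIV :: 'p set) \<and> connected (UNIV :: 'p set) \<and>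
     smooth_manifold B \<and> riemannian_metric B \<and> levi_civita_connection B \<and>
     vector_bundle B \<and> riemannian_fibre_metric B \<and> bundle_connection B \<and> metric_connection B"

section \<open>Radial graphs\<close>

definition fibre :: "('p, 'e, 'a, 'b) metric_bundle \<Rightarrow> 'p \<Rightarrow> 'e set" where
  "fibre B p = {\<xi>. proj B \<xi> = p}"

definition fibre_norm :: "('p, 'e, 'a, 'b) metric_bundle \<Rightarrow> 'e \<Rightarrow> real" where
  "fibre_norm B \<xi> = sqrt (fibre_metric B \<xi> \<xi>)"

definition nonzero_vectors :: "('p, 'e, 'a, 'b) metric_bundle \<Rightarrow> 'e set" where
  "nonzero_vectors B = {\<xi>. \<xi> \<noteq> fibre_scale B 0 \<xi>}"

definition unit_sphere_bundle :: "('p, 'e, 'a, 'b) metric_bundle \<Rightarrow> 'e set" where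
  "unit_sphere_bundle B = {\<xi>. fibre_norm B \<xi> = 1}"

definition smooth_function_on ::
  "('p, 'e::topological_space, 'a::euclidean_space, 'b::euclidean_space) metric_bundle \<Rightarrow>
     'e set \<Rightarrow> ('e \<Rightarrow> real) \<Rightarrow> bool" where
  "smooth_function_on B W f \<longleftrightarrow>
     (\<forall>c\<in>charts B. \<forall>t\<in>trivs B.
        smooth_on (coords B c t ` (W \<inter> proj B -` (fst c \<inter> fst t))) (\<lambda>z. f (from_coords B c t z)))"

text \<open>Smooth functions on the submanifold \<open>unit_sphere_bundle B\<close> are those which locally extend to
  smooth functions on open subsets of the total space.\<close>

definition smooth_on_sphere_bundle ::
  "('p, 'e::topological_space, 'a::euclidean_space, 'b::euclidean_space) metric_bundle \<Rightarrow>
     ('e \<Rightarrow> real) \<Rightarrow> bool" where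
  "smooth_on_sphere_bundle B u \<longleftrightarrow>
     (\<forall>\<xi>\<in>unit_sphere_bundle B. \<exists>W f. open W \<and> \<xi> \<in> W \<and> smooth_function_on B W f \<and>
        (\<forall>\<eta>\<in>W \<inter> unit_sphere_bundle B. f \<eta> = u \<eta>))"

definition radial_graph ::
  "('p, 'e::topological_space, 'a::euclidean_space, 'b::euclidean_space) metric_bundle \<Rightarrow>
     'e set \<Rightarrow> bool" where
  "radial_graph B Y \<longleftrightarrow>
     (\<exists>u. smooth_on_sphere_bundle B u \<and>
        Y = (\<lambda>\<xi>. fibre_scale B (exp (u \<xi>)) \<xi>) ` unit_sphere_bundle B)"

definition homothetic :: "('p, 'e, 'a, 'b) metric_bundle \<Rightarrow> 'e set \<Rightarrow> 'e set \<Rightarrow> bool" where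
  "homothetic B Y Y' \<longleftrightarrow> (\<exists>r>0. Y' = fibre_scale B r ` Y)"

text \<open>A linear isometry from the fibre over \<open>p\<close> onto the Euclidean space \<open>'b\<close>.\<close>

definition fibre_isometry ::
  "('p, 'e, 'a, 'b::euclidean_space) metric_bundle \<Rightarrow> 'p \<Rightarrow> ('e \<Rightarrow> 'b) \<Rightarrow> bool" where
  "fibre_isometry B p L \<longleftrightarrow> bij_betw L (fibre B p) UNIV \<and>
     (\<forall>\<xi>\<in>fibre B p. \<forall>\<eta>\<in>fibre B p. L (fibre_add B \<xi> \<eta>) = L \<xi> + L \<eta> \<and>
        L \<xi> \<bullet> L \<eta> = fibre_metric B \<xi> \<eta>) \<and>
     (\<forall>r. \<forall>\<xi>\<in>fibre B p. L (fibre_scale B r \<xi>) = r *\<^sub>R L \<xi>)"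

text \<open>The choice of the isometry \<open>L\<close> is immaterial, since Gaussian curvature is invariant under
  linear isometries of \<open>'b\<close>.\<close>

definition vertical_gauss_curvature_given_by ::
  "('p, 'e, 'a, 'b::euclidean_space) metric_bundle \<Rightarrow> 'e set \<Rightarrow> ('e \<Rightarrow> real) \<Rightarrow> bool" where
  "vertical_gauss_curvature_given_by B Y K \<longleftrightarrow>
     (\<forall>\<xi>\<in>Y. \<exists>L. fibre_isometry B (proj B \<xi>) L \<and>
        has_gauss_curvature (L ` (Y \<inter> fibre B (proj B \<xi>))) (L \<xi>) (K \<xi>))"

section \<open>Sasaki metric, Sasaki connection and convexity\<close>

text \<open>A tangent vector of the total space at the point with coordinates \<open>z = (x, y)\<close> is given by its
  coordinates \<open>X = (a, b)\<close> with respect to \<open>\<partial>/\<partial>x\<^sup>i\<close>, \<open>\<partial>/\<partial>y\<^sup>\<alpha>\<close>. Its components in the frame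
  \<open>e\<^sub>i = \<partial>/\<partial>x\<^sup>i - y\<^sup>\<alpha> \<Gamma>\<^sup>\<beta>\<^sub>i\<^sub>\<alpha> \<partial>/\<partial>y\<^sup>\<beta>\<close>, \<open>e\<^sub>\<alpha> = \<partial>/\<partial>y\<^sup>\<alpha>\<close> are \<open>a\<close> (horizontal) and \<open>vertical_part B c t z X\<close>.\<close>

definition vertical_part ::
  "('p, 'e, 'a, 'b::real_vector) metric_bundle \<Rightarrow> ('p, 'a) chart \<Rightarrow> ('p, 'e, 'b) triv \<Rightarrow>
     'a \<times> 'b \<Rightarrow> 'a \<times> 'b \<Rightarrow> 'b" where
  "vertical_part B c t z X = snd X + fibre_conn B c t (fst z) (fst X) (snd z)"

text \<open>The coordinates of the vector with horizontal components \<open>h\<close> and vertical components \<open>v\<close>.\<close>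

definition frame_vector ::
  "('p, 'e, 'a, 'b::real_vector) metric_bundle \<Rightarrow> ('p, 'a) chart \<Rightarrow> ('p, 'e, 'b) triv \<Rightarrow>
     'a \<times> 'b \<Rightarrow> 'a \<Rightarrow> 'b \<Rightarrow> 'a \<times> 'b" where
  "frame_vector B c t z h v = (h, v - fibre_conn B c t (fst z) h (snd z))"

definition sasaki_metric ::
  "('p, 'e, 'a, 'b::real_vector) metric_bundle \<Rightarrow> ('p, 'a) chart \<Rightarrow> ('p, 'e, 'b) triv \<Rightarrow>
     'a \<times> 'b \<Rightarrow> 'a \<times> 'b \<Rightarrow> 'a \<times> 'b \<Rightarrow> real" where
  "sasaki_metric B c t z X Y =
     base_metric B c (fst z) (fst X) (fst Y) +
     local_fibre_metric B c t (fst z) (vertical_part B c t z X) (vertical_part B c t z Y)"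

text \<open>The covariant derivative at \<open>z\<close> of the vector field \<open>Z\<close> in the direction \<open>X\<close>: apply the Leibniz
  rule to \<open>Z = Z\<^sup>j e\<^sub>j + Z\<^sup>\<alpha> e\<^sub>\<alpha>\<close> and use that \<open>e\<^sub>j\<close> and \<open>e\<^sub>\<alpha>\<close> have covariant derivatives \<open>\<Gamma>\<^sup>k\<^sub>i\<^sub>j e\<^sub>k\<close>
  and \<open>\<Gamma>\<^sup>\<beta>\<^sub>i\<^sub>\<alpha> e\<^sub>\<beta>\<close> in the direction \<open>e\<^sub>i\<close>, and zero in the vertical directions.\<close>

definition sasaki_connection ::
  "('p, 'e, 'a::euclidean_space, 'b::euclidean_space) metric_bundle \<Rightarrow> ('p, 'a) chart \<Rightarrow>
     ('p, 'e, 'b) triv \<Rightarrow> 'a \<times> 'b \<Rightarrow> 'a \<times> 'b \<Rightarrow> ('a \<times> 'b \<Rightarrow> 'a \<times> 'b) \<Rightarrow> 'a \<times> 'b" where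
  "sasaki_connection B c t z X Z = frame_vector B c t z
     (frechet_derivative (\<lambda>w. fst (Z w)) (at z) X +
        base_conn B c (fst z) (fst X) (fst (Z z)))
     (frechet_derivative (\<lambda>w. vertical_part B c t w (Z w)) (at z) X +
        fibre_conn B c t (fst z) (fst X) (vertical_part B c t z (Z z)))"

definition coord_image ::
  "('p, 'e, 'a, 'b) metric_bundle \<Rightarrow> ('p, 'a) chart \<Rightarrow> ('p, 'e, 'b) triv \<Rightarrow> 'e set \<Rightarrow> ('a \<times> 'b) set" where
  "coord_image B c t Y = coords B c t ` (Y \<inter> proj B -` (fst c \<inter> fst t))"

text \<open>For a radial graph, the outward normal is the one with positive component along the radial
  vector \<open>y\<^sup>\<alpha> e\<^sub>\<alpha>\<close>.\<close>

definition outward_unit_normal ::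
  "('p, 'e, 'a::euclidean_space, 'b::euclidean_space) metric_bundle \<Rightarrow> ('p, 'a) chart \<Rightarrow>
     ('p, 'e, 'b) triv \<Rightarrow> 'e set \<Rightarrow> 'a \<times> 'b \<Rightarrow> 'a \<times> 'b \<Rightarrow> bool" where
  "outward_unit_normal B c t Y z \<nu> \<longleftrightarrow> sasaki_metric B c t z \<nu> \<nu> = 1 \<and>
     (\<forall>X\<in>tangent_vectors (coord_image B c t Y) z. sasaki_metric B c t z X \<nu> = 0) \<and>
     sasaki_metric B c t z (0, snd z) \<nu> > 0"

text \<open>Positivity of the second fundamental form: \<open>Z\<close> ranges over the local smooth vector fields
  which are tangent to \<open>Y\<close> along \<open>Y\<close>, and \<open>X = Z z\<close>.\<close>

definition convex_radial_graph ::
  "('p, 'e::topological_space, 'a::euclidean_space, 'b::euclidean_space) metric_bundle \<Rightarrow>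
     'e set \<Rightarrow> bool" where
  "convex_radial_graph B Y \<longleftrightarrow> radial_graph B Y \<and>
     (\<forall>c\<in>charts B. \<forall>t\<in>trivs B. \<forall>z\<in>coord_image B c t Y. \<forall>\<nu> W Z.
        outward_unit_normal B c t Y z \<nu> \<and> open W \<and> z \<in> W \<and> smooth_on W Z \<and>
        (\<forall>w\<in>W \<inter> coord_image B c t Y. Z w \<in> tangent_vectors (coord_image B c t Y) w) \<longrightarrow>
        - sasaki_metric B c t z (sasaki_connection B c t z (Z z) Z) \<nu> \<ge> 0)"

end

theory Submission
  imports Defs
begin

text \<open>A fibre of a radial graph is the level set \<open>ln \<bar>z\<bar> = v z\<close> of a function \<open>v\<close> that is homogeneous of degree
  \<open>0\<close>. At a farthest point all principal curvatures are at least \<open>1 / \<bar>z\<bar>\<close>; as the Gaussian curvature does not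
  vanish, the second fundamental form stays positive definite on the whole fibre, so at a nearest point all
  principal curvatures lie between \<open>0\<close> and \<open>1 / \<bar>z\<bar>\<close>, and the intermediate value theorem gives the radius in (2).

  For \<open>K = r\<^sup>1\<^sup>-\<^sup>m\<close>, the inequality between the arithmetic and the geometric mean bounds the mean curvature from
  below, which says that the trace of the Hessian of \<open>v\<close> over the tangent space is nonpositive. By the strong
  minimum principle \<open>v\<close> is constant: every fibre is a sphere, of a radius \<open>exp (f p)\<close> that may depend smoothly
  on the base point \<open>p\<close>. Conversely every smooth \<open>f\<close> on the base gives a solution. Evaluated on horizontal
  vectors, the second fundamental form is nonnegative only if \<open>\<nabla>\<^sup>2 f + df \<otimes> df \<le> 0\<close>, and then \<open>f\<close> is constant,
  again by the strong minimum principle.\<close>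

section \<open>Calculus of smooth maps\<close>

text \<open>The height of a fibre is extended to be constant along rays, so that all derivatives are
  taken in the punctured Euclidean space and no charts of the sphere occur. The price is a
  degenerate operator: the curvature controls a trace over tangent hyperplanes only. The gap is
  closed by adding the point \<open>z\<close> itself to the tangent frame: the second radial
  derivative of a function constant along rays is 0, so the trace is unchanged, and \<open>z\<close>
  is transversal to the tangent hyperplane, which makes the enlarged family elliptic. Frames of
  principal directions need not depend continuously on the point. The minimum principle is therefore
  stated for vectors \<open>P\<close> chosen separately at each point, with uniform bounds and an
  error proportional to the gradient. In this form it also serves the base, where \<open>P\<close>
  is a coordinate basis and the Christoffel symbols supply the error. Positivity of the second
  fundamental form has to precede the estimate at a nearest point and the comparison of means: a
  positive product does not exclude an even number of negative principal curvatures.\<close>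

lemma higher_differentiable_on_cong:
  assumes "open S" "\<And>x. x \<in> S \<Longrightarrow> f x = g x" "higher_differentiable_on k S f"
  shows "higher_differentiable_on k S g"
  using assms(2,3)
proof (induction k arbitrary: f g)
  case 0
  then show ?case by (metis continuous_on_cong higher_differentiable_on.simps(1))
next
  case (Suc k)
  have d: "f differentiable (at x)" if "x \<in> S" for x using Suc.prems(2) that by simp
  have fd: "frechet_derivative f (at x) = frechet_derivative g (at x)" if "x \<in> S" for x
    using frechet_derivative_transform_within_open[OF d[OF that] assms(1) that] Suc.prems(1) by blast
  have "g differentiable (at x)" if "x \<in> S" for x
    using d[OF that] has_derivative_transform_within_open[OF _ assms(1) that] Suc.prems(1)
    unfolding differentiable_def by metis
  moreover have "higher_differentiable_on k S (\<lambda>x. frechet_derivative g (at x) v)" for v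
    by (rule Suc.IH[where f = "\<lambda>x. frechet_derivative f (at x) v"]) (use fd Suc.prems(2) in auto)
  ultimately show ?case by simp
qed

lemma smooth_on_cong:
  assumes "smooth_on S f" "open S" "\<And>x. x \<in> S \<Longrightarrow> f x = g x"
  shows "smooth_on S g"
  using assms higher_differentiable_on_cong unfolding smooth_on_def by blast

lemma higher_differentiable_on_SucD:
  "higher_differentiable_on (Suc k) S f \<Longrightarrow> higher_differentiable_on k S f"
proof (induction k arbitrary: f)
  case 0
  then show ?case
    by (simp add: continuous_at_imp_continuous_on differentiable_imp_continuous_within)
next
  case (Suc k)
  from Suc.prems have "f differentiable (at x)" if "x \<in> S" for x using that by simp
  moreover have "higher_differentiable_on k S (\<lambda>x. frechet_derivative f (at x) v)" for v
    using Suc.prems unfolding higher_differentiable_on.simps(2)[of "Suc k" S f]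
    by (intro Suc.IH) (elim conjE allE)
  ultimately show ?case by simp
qed

lemma higher_differentiable_on_subset:
  "higher_differentiable_on k S f \<Longrightarrow> T \<subseteq> S \<Longrightarrow> higher_differentiable_on k T f"
  by (induction k arbitrary: f) (auto intro: continuous_on_subset)

lemma smooth_on_subset: "smooth_on S f \<Longrightarrow> T \<subseteq> S \<Longrightarrow> smooth_on T f"
  unfolding smooth_on_def using higher_differentiable_on_subset by blast

lemma higher_differentiable_on_SucI:
  assumes "open S" "\<And>x. x \<in> S \<Longrightarrow> (f has_derivative f' x) (at x)"
    and "\<And>v. higher_differentiable_on k S (\<lambda>x. f' x v)"
  shows "higher_differentiable_on (Suc k) S f"
proof -
  have "frechet_derivative f (at x) = f' x" if "x \<in> S" for x
    using frechet_derivative_at[OF assms(2)[OF that]] by simp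
  then have "higher_differentiable_on k S (\<lambda>x. frechet_derivative f (at x) v)" for v
    by (intro higher_differentiable_on_cong[OF assms(1) _ assms(3)[of v]]) simp
  then show ?thesis using assms(2) by (auto simp: differentiable_def)
qed

lemma higher_differentiable_on_SucD':
  assumes "higher_differentiable_on (Suc k) S f"
  shows "\<And>x. x \<in> S \<Longrightarrow> (f has_derivative frechet_derivative f (at x)) (at x)"
    and "\<And>v. higher_differentiable_on k S (\<lambda>x. frechet_derivative f (at x) v)"
  using assms by (auto simp: frechet_derivative_works)

lemma higher_differentiable_on_local:
  assumes "\<And>x. x \<in> S \<Longrightarrow> \<exists>T. open T \<and> x \<in> T \<and> higher_differentiable_on k T f"
  shows "higher_differentiable_on k S f"
  using assms
proof (induction k arbitrary: f)
  case 0
  have "continuous (at x) f" if x: "x \<in> S" for x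
    using 0[OF x] by (auto simp: continuous_on_eq_continuous_at)
  then show ?case by (simp add: continuous_at_imp_continuous_on)
next
  case (Suc k)
  have "f differentiable (at x)" if x: "x \<in> S" for x
    using Suc.prems[OF x] by auto
  moreover have "higher_differentiable_on k S (\<lambda>x. frechet_derivative f (at x) v)" for v
    by (rule Suc.IH) (use Suc.prems in \<open>metis higher_differentiable_on.simps(2)\<close>)
  ultimately show ?case by simp
qed

lemma smooth_on_local:
  assumes "\<And>x. x \<in> S \<Longrightarrow> \<exists>T. open T \<and> x \<in> T \<and> smooth_on T f"
  shows "smooth_on S f"
  unfolding smooth_on_def
proof
  fix k show "higher_differentiable_on k S f"
    by (rule higher_differentiable_on_local) (use assms smooth_on_def in blast)
qed

lemma smooth_onD:
  assumes "smooth_on S f"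
  shows "\<And>x. x \<in> S \<Longrightarrow> f differentiable (at x)"
    and "\<And>x. x \<in> S \<Longrightarrow> (f has_derivative frechet_derivative f (at x)) (at x)"
    and "continuous_on S f"
    and "\<And>v. smooth_on S (\<lambda>x. frechet_derivative f (at x) v)"
proof -
  have h: "higher_differentiable_on k S f" for k using assms by (simp add: smooth_on_def)
  show "\<And>x. x \<in> S \<Longrightarrow> f differentiable (at x)"
    using h[of "Suc 0"] by simp
  show "\<And>x. x \<in> S \<Longrightarrow> (f has_derivative frechet_derivative f (at x)) (at x)"
    using higher_differentiable_on_SucD'(1)[OF h] .
  show "continuous_on S f" using h[of 0] by simp
  show "\<And>v. smooth_on S (\<lambda>x. frechet_derivative f (at x) v)"
    unfolding smooth_on_def using higher_differentiable_on_SucD'(2)[OF h] by blast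
qed

lemma higher_differentiable_on_const: "higher_differentiable_on k S (\<lambda>x. c)"
  by (induction k arbitrary: c) (auto simp: frechet_derivative_const)

lemma smooth_on_const [intro, simp]: "smooth_on S (\<lambda>x. c)"
  by (simp add: smooth_on_def higher_differentiable_on_const)

lemma smooth_on_bounded_linear:
  assumes "bounded_linear L" shows "smooth_on S L"
proof -
  have "higher_differentiable_on k S L" for k
  proof (cases k)
    case 0
    then show ?thesis using assms by (simp add: linear_continuous_on)
  next
    case (Suc n)
    have "(L has_derivative L) (at x)" for x
      using assms bounded_linear_imp_has_derivative by blast
    then have "frechet_derivative L (at x) = L" for x using frechet_derivative_at by metis
    then show ?thesis using \<open>\<And>x. (L has_derivative L) (at x)\<close> Suc
      by (auto simp: differentiable_def higher_differentiable_on_const)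
  qed
  then show ?thesis by (simp add: smooth_on_def)
qed

lemma higher_differentiable_on_add:
  assumes "open S" "higher_differentiable_on k S f" "higher_differentiable_on k S g"
  shows "higher_differentiable_on k S (\<lambda>x. f x + g x)"
  using assms(2,3)
proof (induction k arbitrary: f g)
  case 0 then show ?case by (simp add: continuous_on_add)
next
  case (Suc k)
  note f = higher_differentiable_on_SucD'[OF Suc.prems(1)] and g = higher_differentiable_on_SucD'[OF Suc.prems(2)]
  show ?case
    by (rule higher_differentiable_on_SucI[OF assms(1) has_derivative_add[OF f(1) g(1)]])
      (auto intro: Suc.IH f(2) g(2))
qed

lemma (in bounded_bilinear) higher_differentiable_on:
  assumes "open S" "higher_differentiable_on k S f" "higher_differentiable_on k S g"
  shows "higher_differentiable_on k S (\<lambda>x. prod (f x) (g x))"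
  using assms(2,3)
proof (induction k arbitrary: f g)
  case 0 then show ?case by (simp add: continuous_on)
next
  case (Suc k)
  note f = higher_differentiable_on_SucD'[OF Suc.prems(1)] and g = higher_differentiable_on_SucD'[OF Suc.prems(2)]
  show ?case
    by (rule higher_differentiable_on_SucI[OF assms(1) FDERIV[OF f(1) g(1)]])
      (auto intro!: higher_differentiable_on_add assms(1) Suc.IH f(2) g(2)
        higher_differentiable_on_SucD[OF Suc.prems(1)] higher_differentiable_on_SucD[OF Suc.prems(2)])
qed

lemma higher_differentiable_on_sum:
  assumes "open S" "finite A" "\<And>i. i \<in> A \<Longrightarrow> higher_differentiable_on k S (f i)"
  shows "higher_differentiable_on k S (\<lambda>x. \<Sum>i\<in>A. f i x)"
  using assms(2,3)
  by (induction A) (auto intro!: higher_differentiable_on_add assms(1) higher_differentiable_on_const)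

lemma higher_differentiable_on_bounded_linear:
  assumes "open S" "bounded_linear L" "higher_differentiable_on k S f"
  shows "higher_differentiable_on k S (\<lambda>x. L (f x))"
  using assms(3)
proof (induction k arbitrary: f)
  case 0 then show ?case by (simp add: bounded_linear.continuous_on[OF assms(2)])
next
  case (Suc k)
  note f = higher_differentiable_on_SucD'[OF Suc.prems(1)]
  show ?case
    by (rule higher_differentiable_on_SucI[OF assms(1) bounded_linear.has_derivative[OF assms(2) f(1)]])
      (auto intro: Suc.IH f(2))
qed

lemma linear_basis_expansion:
  fixes h :: "'b::euclidean_space \<Rightarrow> 'w::real_vector"
  assumes "linear h"
  shows "h w = (\<Sum>b\<in>Basis. (w \<bullet> b) *\<^sub>R h b)"
proof -
  have "h w = h (\<Sum>b\<in>Basis. (w \<bullet> b) *\<^sub>R b)" by (simp add: euclidean_representation)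
  also have "\<dots> = (\<Sum>b\<in>Basis. (w \<bullet> b) *\<^sub>R h b)"
    by (simp add: linear_sum[OF assms] linear_cmul[OF assms])
  finally show ?thesis .
qed

text \<open>The derivative of the composite applies a linear map depending on \<open>x\<close> to a
  vector depending on \<open>x\<close>. Expanding that vector in a basis leaves products of scalars
  with directional derivatives of \<open>f\<close> along fixed vectors, composed with
  \<open>g\<close>; to these the induction hypothesis applies.\<close>

lemma higher_differentiable_on_compose:
  fixes f :: "'b::euclidean_space \<Rightarrow> 'w::real_normed_vector" and g :: "'v::real_normed_vector \<Rightarrow> 'b"
  assumes "open S" "open T" "g ` S \<subseteq> T"
    and "higher_differentiable_on k T f" "higher_differentiable_on k S g"
  shows "higher_differentiable_on k S (\<lambda>x. f (g x))"
  using assms(4,5)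
proof (induction k arbitrary: f)
  case 0 then show ?case using assms(3) by (auto intro: continuous_on_compose2)
next
  case (Suc k)
  note f = higher_differentiable_on_SucD'[OF Suc.prems(1)] and g = higher_differentiable_on_SucD'[OF Suc.prems(2)]
  define h where "h x v = (\<Sum>b\<in>Basis. (frechet_derivative g (at x) v \<bullet> b) *\<^sub>R
      frechet_derivative f (at (g x)) b)" for x v
  show ?case
  proof (rule higher_differentiable_on_SucI[OF assms(1)])
    fix x assume x: "x \<in> S"
    have "(f \<circ> g has_derivative frechet_derivative f (at (g x)) \<circ> frechet_derivative g (at x)) (at x)"
      using f(1) g(1) x assms(3) by (intro diff_chain_at) auto
    moreover have "linear (frechet_derivative f (at (g x)))"
      using f(1) x assms(3) has_derivative_linear by blast
    from linear_basis_expansion[OF this]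
    have "frechet_derivative f (at (g x)) \<circ> frechet_derivative g (at x) = h x"
      unfolding h_def o_def by (rule ext)
    ultimately show "((\<lambda>x. f (g x)) has_derivative h x) (at x)" by (simp only: o_def)
  next
    fix v
    show "higher_differentiable_on k S (\<lambda>x. h x v)"
      unfolding h_def
      by (intro higher_differentiable_on_sum assms(1) finite_Basis
          bounded_bilinear.higher_differentiable_on[OF bounded_bilinear_scaleR]
          higher_differentiable_on_bounded_linear[OF assms(1) bounded_linear_inner_left] g(2)
          Suc.IH f(2) higher_differentiable_on_SucD[OF Suc.prems(2)])
  qed
qed

lemma smooth_on_add [intro]:
  "smooth_on S f \<Longrightarrow> smooth_on S g \<Longrightarrow> open S \<Longrightarrow> smooth_on S (\<lambda>x. f x + g x)"
  by (simp add: smooth_on_def higher_differentiable_on_add)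

lemma smooth_on_sum [intro]:
  "(\<And>i. i \<in> A \<Longrightarrow> smooth_on S (f i)) \<Longrightarrow> finite A \<Longrightarrow> open S \<Longrightarrow> smooth_on S (\<lambda>x. \<Sum>i\<in>A. f i x)"
  by (simp add: smooth_on_def higher_differentiable_on_sum)

lemma smooth_on_linear_compose:
  "bounded_linear L \<Longrightarrow> smooth_on S f \<Longrightarrow> open S \<Longrightarrow> smooth_on S (\<lambda>x. L (f x))"
  by (simp add: smooth_on_def higher_differentiable_on_bounded_linear)

lemma smooth_on_bilinear:
  "bounded_bilinear p \<Longrightarrow> smooth_on S f \<Longrightarrow> smooth_on S g \<Longrightarrow> open S \<Longrightarrow> smooth_on S (\<lambda>x. p (f x) (g x))"
  by (simp add: smooth_on_def bounded_bilinear.higher_differentiable_on)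

lemmas smooth_on_scaleR [intro] = smooth_on_bilinear[OF bounded_bilinear_scaleR]
lemmas smooth_on_mult [intro] = smooth_on_bilinear[OF bounded_bilinear_mult]
lemmas smooth_on_inner [intro] = smooth_on_bilinear[OF bounded_bilinear_inner]
lemmas smooth_on_fst [intro] = smooth_on_linear_compose[OF bounded_linear_fst]
lemmas smooth_on_snd [intro] = smooth_on_linear_compose[OF bounded_linear_snd]
lemmas smooth_on_ident [intro, simp] = smooth_on_bounded_linear[OF bounded_linear_ident]

lemma smooth_on_minus [intro]: "smooth_on S f \<Longrightarrow> open S \<Longrightarrow> smooth_on S (\<lambda>x. - f x)"
  by (rule smooth_on_linear_compose) (auto intro: bounded_linear_minus bounded_linear_ident)

lemma smooth_on_diff [intro]:
  "smooth_on S f \<Longrightarrow> smooth_on S g \<Longrightarrow> open S \<Longrightarrow> smooth_on S (\<lambda>x. f x - g x)"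
  using smooth_on_add[OF _ smooth_on_minus[of S g], of f] by simp

lemma smooth_on_Pair [intro]:
  assumes "smooth_on S f" "smooth_on S g" "open S" shows "smooth_on S (\<lambda>x. (f x, g x))"
proof -
  have "smooth_on S (\<lambda>x. (\<lambda>a. (a, 0)) (f x) + (\<lambda>b. (0, b)) (g x))"
    using assms by (intro smooth_on_add smooth_on_linear_compose[where L = "\<lambda>a. (a, 0)"]
       smooth_on_linear_compose[where L = "\<lambda>b. (0, b)"])
      (auto intro!: bounded_linear_Pair bounded_linear_ident bounded_linear_zero)
  then show ?thesis by simp
qed

lemma smooth_on_compose:
  fixes f :: "'b::euclidean_space \<Rightarrow> 'w::real_normed_vector" and g :: "'v::real_normed_vector \<Rightarrow> 'b"
  assumes "smooth_on T f" "smooth_on S g" "open S" "open T" "\<And>x. x \<in> S \<Longrightarrow> g x \<in> T"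
  shows "smooth_on S (\<lambda>x. f (g x))"
proof -
  have im: "g ` S \<subseteq> T" using assms(5) by blast
  show ?thesis
    unfolding smooth_on_def
  proof
    fix k
    show "higher_differentiable_on k S (\<lambda>x. f (g x))"
      by (rule higher_differentiable_on_compose[OF assms(3,4) im])
        (use assms(1,2) in \<open>auto simp: smooth_on_def\<close>)
  qed
qed

lemma smooth_on_exp: "smooth_on S (exp :: real \<Rightarrow> real)"
proof -
  have "higher_differentiable_on k UNIV (exp :: real \<Rightarrow> real)" for k
  proof (induction k)
    case 0 then show ?case by (simp add: continuous_on_exp)
  next
    case (Suc k)
    have "(exp has_derivative (\<lambda>v. exp x * v)) (at x)" for x :: real
      by (auto intro!: derivative_eq_intros)
    then show ?case
      by (rule higher_differentiable_on_SucI[OF open_UNIV])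
        (intro bounded_bilinear.higher_differentiable_on[OF bounded_bilinear_mult] open_UNIV Suc.IH
         higher_differentiable_on_const)
  qed
  then show ?thesis by (meson smooth_on_def smooth_on_subset subset_UNIV)
qed

lemma smooth_on_inverse: "smooth_on (- {0}) (inverse :: real \<Rightarrow> real)"
proof -
  have "higher_differentiable_on k (- {0}) (inverse :: real \<Rightarrow> real)" for k
  proof (induction k)
    case 0 then show ?case by (auto intro!: continuous_intros)
  next
    case (Suc k)
    have o: "open (- {0::real})" by auto
    \<comment> \<open>The derivative is written as a product of copies of \<open>inverse\<close>
      itself, so the induction closes.\<close>
    have "(inverse has_derivative (\<lambda>v. (inverse x * inverse x) * (- v))) (at x)" if "x \<in> - {0}" for x :: real
      using that by (auto intro!: derivative_eq_intros simp: field_simps)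
    note d = this
    show ?case
    proof (rule higher_differentiable_on_SucI[OF o d])
      fix v :: real
      show "higher_differentiable_on k (- {0}) (\<lambda>x::real. (inverse x * inverse x) * (- v))"
        by (intro bounded_bilinear.higher_differentiable_on[OF bounded_bilinear_mult] o Suc.IH
          higher_differentiable_on_const)
    qed
  qed
  then show ?thesis by (simp add: smooth_on_def)
qed

lemma smooth_on_ln: "smooth_on {0<..} (ln :: real \<Rightarrow> real)"
proof -
  have o: "open {(0::real)<..}" by auto
  have i: "smooth_on {0<..} (inverse :: real \<Rightarrow> real)"
    by (rule smooth_on_subset[OF smooth_on_inverse]) auto
  have "higher_differentiable_on k {0<..} (ln :: real \<Rightarrow> real)" for k
  proof (cases k)
    case 0 then show ?thesis by (auto intro!: continuous_intros)
  next
    case (Suc n)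
    have d: "(ln has_derivative (\<lambda>v. inverse x * v)) (at x)" if "x \<in> {0<..}" for x :: real
      using that by (auto intro!: derivative_eq_intros simp: field_simps)
    have "higher_differentiable_on (Suc n) {0<..} (ln :: real \<Rightarrow> real)"
      by (rule higher_differentiable_on_SucI[OF o d])
        (use i in \<open>auto intro!: bounded_bilinear.higher_differentiable_on[OF bounded_bilinear_mult]
         higher_differentiable_on_const simp: smooth_on_def\<close>)
    then show ?thesis using Suc by simp
  qed
  then show ?thesis by (simp add: smooth_on_def)
qed

lemma smooth_on_exp_compose [intro]:
  fixes f :: "'v::real_normed_vector \<Rightarrow> real"
  shows "smooth_on S f \<Longrightarrow> open S \<Longrightarrow> smooth_on S (\<lambda>x. exp (f x))"
  by (rule smooth_on_compose[OF smooth_on_exp[of UNIV]]) auto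

lemma smooth_on_inverse_compose [intro]:
  fixes f :: "'v::real_normed_vector \<Rightarrow> real"
  shows "smooth_on S f \<Longrightarrow> open S \<Longrightarrow> (\<And>x. x \<in> S \<Longrightarrow> f x \<noteq> 0) \<Longrightarrow> smooth_on S (\<lambda>x. inverse (f x))"
  by (rule smooth_on_compose[OF smooth_on_inverse]) auto

lemma smooth_on_ln_compose [intro]:
  fixes f :: "'v::real_normed_vector \<Rightarrow> real"
  shows "smooth_on S f \<Longrightarrow> open S \<Longrightarrow> (\<And>x. x \<in> S \<Longrightarrow> f x > 0) \<Longrightarrow> smooth_on S (\<lambda>x. ln (f x))"
  by (rule smooth_on_compose[OF smooth_on_ln]) auto

lemma smooth_on_sqrt_compose [intro]:
  fixes f :: "'v::real_normed_vector \<Rightarrow> real"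
  assumes "smooth_on S f" "open S" "\<And>x. x \<in> S \<Longrightarrow> f x > 0" 
  shows "smooth_on S (\<lambda>x. sqrt (f x))"
proof -
  have exp_ln_half: "exp (ln y / 2) = sqrt y" if "y > 0" for y :: real
    using that exp_ln[of "sqrt y"] by (simp add: ln_sqrt)
  have "smooth_on S (\<lambda>x. exp (inverse 2 * ln (f x)))"
    by (intro smooth_on_exp_compose smooth_on_mult smooth_on_const smooth_on_ln_compose assms)
  then show ?thesis
    by (rule smooth_on_cong[OF _ assms(2)]) (simp add: exp_ln_half assms(3))
qed

lemma smooth_on_norm [intro]:
  fixes f :: "'v::real_normed_vector \<Rightarrow> 'b::real_inner"
  assumes "smooth_on S f" "open S" "\<And>x. x \<in> S \<Longrightarrow> f x \<noteq> 0"
  shows "smooth_on S (\<lambda>x. norm (f x))"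
  unfolding norm_eq_sqrt_inner using assms by (intro smooth_on_sqrt_compose smooth_on_inner) auto

section \<open>A smooth function that is flat on a half line\<close>

definition bump :: "real \<Rightarrow> real" where
  "bump t = (if t > 0 then exp (- inverse t) else 0)"

lemma bump_poly_tendsto_0: "((\<lambda>t. poly p (inverse t) * exp (- inverse t)) \<longlongrightarrow> 0) (at_right (0::real))"
proof -
  have "((\<lambda>t. poly p t * exp (- t)) \<longlongrightarrow> 0) at_top" for p :: "real poly"
  proof (induction p)
    case 0 then show ?case by simp
  next
    case (pCons a p)
    have "((\<lambda>t. coeff (pCons a p) i * (t ^ i / exp t)) \<longlongrightarrow> coeff (pCons a p) i * 0) at_top" for i
      by (intro tendsto_mult tendsto_const tendsto_power_div_exp_0)
    then have "((\<lambda>t. \<Sum>i\<le>degree (pCons a p). coeff (pCons a p) i * (t ^ i / exp t)) \<longlongrightarrow> 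
       (\<Sum>i\<le>degree (pCons a p). coeff (pCons a p) i * 0)) at_top"
      by (intro tendsto_sum)
    moreover have "(\<lambda>t. \<Sum>i\<le>degree (pCons a p). coeff (pCons a p) i * (t ^ i / exp t)) = (\<lambda>t. poly (pCons a p) t * exp (- t))"
      by (simp only: poly_altdef sum_distrib_right exp_minus divide_inverse mult.assoc)
    ultimately show ?case by simp
  qed
  then show ?thesis
    by (rule filterlim_compose[OF _ filterlim_inverse_at_top_right])
qed

text \<open>The functions \<open>poly p (inverse t) * exp (- inverse t)\<close>, extended by 0, are
  closed under differentiation, with \<open>d p\<close> the polynomial of the derivative. The
  induction over the order runs over all \<open>p\<close> at once; \<open>bump\<close> is the case
  \<open>p = 1\<close>.\<close>

lemma smooth_on_bump: "smooth_on UNIV bump"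
proof -
  define h :: "real poly \<Rightarrow> real \<Rightarrow> real" where
    "h p t = (if t > 0 then poly p (inverse t) * exp (- inverse t) else 0)" for p t
  define d :: "real poly \<Rightarrow> real poly" where "d p = [:0,0,1:] * (p - pderiv p)" for p
  have lim: "((\<lambda>t. h p t) \<longlongrightarrow> 0) (at 0)" for p
  proof (rule filterlim_split_at)
    show "(h p \<longlongrightarrow> 0) (at_left 0)"
      by (rule tendsto_eventually) (auto simp: eventually_at_filter h_def)
    show "(h p \<longlongrightarrow> 0) (at_right 0)"
      by (rule Lim_transform_eventually[OF bump_poly_tendsto_0[of p]])
        (auto simp: eventually_at_filter h_def)
  qed
  have der: "(h p has_real_derivative h (d p) t) (at t)" for p t
  proof (cases t "0::real" rule: linorder_cases)
    case less
    have "((\<lambda>t. 0) has_real_derivative h (d p) t) (at t)" using less by (simp add: h_def)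
    then show ?thesis
      by (rule DERIV_cong_ev[THEN iffD1, rotated -1])
        (use less in \<open>auto simp: h_def intro!: eventually_nhds_in_open[of "{..<0}", THEN eventually_mono]\<close>)
  next
    case greater
    have "((\<lambda>t. poly p (inverse t) * exp (- inverse t)) has_real_derivative h (d p) t) (at t)"
      using greater by (auto intro!: derivative_eq_intros poly_DERIV[THEN DERIV_chain2] simp: h_def d_def field_simps power2_eq_square)
    then show ?thesis
      by (rule DERIV_cong_ev[THEN iffD1, rotated -1])
        (use greater in \<open>auto simp: h_def intro!: eventually_nhds_in_open[of "{0<..}", THEN eventually_mono]\<close>)
  next
    case equal
    \<comment> \<open>The difference quotient of \<open>h p\<close> at 0 is a function of the same
      family, since division by \<open>t\<close> multiplies the polynomial in
      \<open>inverse t\<close> by its variable.\<close>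
    have "((\<lambda>t. h (pCons 0 p) t) \<longlongrightarrow> 0) (at 0)" by (rule lim)
    moreover have "\<forall>\<^sub>F t in at 0. h (pCons 0 p) t = (h p t - h p 0) / (t - 0)"
      by (auto simp: h_def field_simps eventually_at_filter)
    ultimately have "((\<lambda>t. (h p t - h p 0) / (t - 0)) \<longlongrightarrow> 0) (at 0)"
      by (rule Lim_transform_eventually)
    then show ?thesis using equal by (simp add: has_field_derivative_iff h_def)
  qed
  have "higher_differentiable_on k UNIV (h p)" for k p
  proof (induction k arbitrary: p)
    case 0
    show ?case unfolding higher_differentiable_on.simps
      by (rule DERIV_continuous_on, rule has_field_derivative_at_within, rule der)
  next
    case (Suc k)
    show ?case
      by (rule higher_differentiable_on_SucI[OF open_UNIV der[unfolded has_field_derivative_def]])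
        (intro bounded_bilinear.higher_differentiable_on[OF bounded_bilinear_mult] open_UNIV Suc.IH
         higher_differentiable_on_const)
  qed
  moreover have "h 1 = bump" by (auto simp: h_def bump_def)
  ultimately show ?thesis by (metis smooth_on_def)
qed

section \<open>The strong minimum principle\<close>

text \<open>A negative \<open>c\<close> would make \<open>h'\<close> negative just to the right of
  0, and by the mean value theorem \<open>h\<close> would drop below \<open>h 0\<close>.\<close>

lemma second_derivative_nonneg_at_min:
  fixes h h' :: "real \<Rightarrow> real"
  assumes "\<delta> > 0" "\<And>t. \<bar>t\<bar> < \<delta> \<Longrightarrow> (h has_real_derivative h' t) (at t)"
    and "(h' has_real_derivative c) (at 0)" and "\<And>t. \<bar>t\<bar> < \<delta> \<Longrightarrow> h 0 \<le> h t"
  shows "h' 0 = 0" "c \<ge> 0"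
proof -
  show h0: "h' 0 = 0"
    using DERIV_local_min[of h "h' 0" 0 \<delta>] assms(1,2,4) by simp
  show "c \<ge> 0"
  proof (rule ccontr)
    assume "\<not> c \<ge> 0"
    then obtain d where d: "d > 0" "\<And>s. 0 < s \<Longrightarrow> s < d \<Longrightarrow> h' s < 0"
      using DERIV_neg_dec_right[OF assms(3)] h0 by auto
    define t where "t = min \<delta> d / 2"
    have t: "0 < t" "t < \<delta>" "t < d" using assms(1) d(1) by (auto simp: t_def)
    obtain s where s: "0 < s" "s < t" "h t - h 0 = (t - 0) * h' s"
      using MVT2[of 0 t h h'] t assms(2) by force
    moreover have "t * h' s < 0" using d(2)[of s] s t by (intro mult_pos_neg) auto
    ultimately have "h t < h 0" by simp
    then show False using assms(4)[of t] t by simp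
  qed
qed

text \<open>Restriction to the lines through \<open>x\<close> reduces both claims to one
  variable.\<close>

lemma gradient_hessian_at_min:
  fixes \<phi> :: "'a::euclidean_space \<Rightarrow> real" and g :: "'a \<Rightarrow> 'a"
  assumes "open U" "x \<in> U"
    and \<phi>: "\<And>y. y \<in> U \<Longrightarrow> (\<phi> has_derivative (\<lambda>w. g y \<bullet> w)) (at y)"
    and g: "(g has_derivative g') (at x)"
    and min: "\<And>y. y \<in> U \<Longrightarrow> \<phi> x \<le> \<phi> y"
  shows "g x = 0" "g' w \<bullet> w \<ge> 0"
proof -
  obtain e where e: "e > 0" "ball x e \<subseteq> U" using assms(1,2) open_contains_ball by blast
  have *: "g x \<bullet> w = 0 \<and> g' w \<bullet> w \<ge> 0" for w
  proof -
    \<comment> \<open>The summand 1 keeps the quotient meaningful for \<open>w = 0\<close>.\<close>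
    define \<delta> where "\<delta> = e / (norm w + 1)"
    have \<delta>: "\<delta> > 0" using e(1) by (simp add: \<delta>_def add_nonneg_pos)
    have inU: "x + t *\<^sub>R w \<in> U" if "\<bar>t\<bar> < \<delta>" for t
    proof -
      have "\<bar>t\<bar> * norm w \<le> \<bar>t\<bar> * (norm w + 1)" by (simp add: mult_left_mono)
      also have "\<dots> < e" using that by (simp add: \<delta>_def pos_less_divide_eq add_nonneg_pos)
      finally show ?thesis using e(2) by (auto simp: dist_norm)
    qed
    have l: "((\<lambda>t. x + t *\<^sub>R w) has_derivative (\<lambda>t. t *\<^sub>R w)) (at t)" for t
      by (auto intro!: derivative_eq_intros)
    have 1: "((\<lambda>t. \<phi> (x + t *\<^sub>R w)) has_real_derivative g (x + t *\<^sub>R w) \<bullet> w) (at t)" if "\<bar>t\<bar> < \<delta>" for t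
      using has_derivative_compose[OF l \<phi>[OF inU[OF that]]]
      by (auto simp: has_field_derivative_def mult.commute[of _ "g (x + t *\<^sub>R w) \<bullet> w"] fun_eq_iff)
    have g1: "(g has_derivative g') (at (x + 0 *\<^sub>R w))" using g by simp
    have "((\<lambda>t. g (x + t *\<^sub>R w)) has_derivative (\<lambda>t. g' (t *\<^sub>R w))) (at 0)"
      using has_derivative_compose[OF l g1] .
    then have "((\<lambda>t. g (x + t *\<^sub>R w) \<bullet> w) has_derivative (\<lambda>t. g' (t *\<^sub>R w) \<bullet> w)) (at 0)"
      by (rule has_derivative_inner_left)
    moreover have "(\<lambda>t. g' (t *\<^sub>R w) \<bullet> w) = (*) (g' w \<bullet> w)"
      using linear_cmul[OF has_derivative_linear[OF g]] by (auto simp: fun_eq_iff)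
    ultimately have 2: "((\<lambda>t. g (x + t *\<^sub>R w) \<bullet> w) has_real_derivative g' w \<bullet> w) (at 0)"
      by (simp add: has_field_derivative_def)
    show ?thesis
      using second_derivative_nonneg_at_min[OF \<delta> 1 2] min[OF inU] by simp
  qed
  show "g x = 0" "g' w \<bullet> w \<ge> 0" using *[of "g x"] *[of w] by auto
qed

text \<open>Hopf's argument: compare \<open>\<phi>\<close> with a multiple of \<open>exp (- \<alpha> \<bar>x - q\<bar>\<^sup>2)\<close> on an annulus whose
  outer sphere touches the set where the minimum is attained.\<close>

theorem strong_minimum_principle_local:
  fixes \<phi> :: "'a::euclidean_space \<Rightarrow> real" and g :: "'a \<Rightarrow> 'a"
  assumes \<phi>: "\<And>x. x \<in> ball x0 r \<Longrightarrow> (\<phi> has_derivative (\<lambda>w. g x \<bullet> w)) (at x)"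
    and g: "\<And>x. x \<in> ball x0 r \<Longrightarrow> (g has_derivative g' x) (at x)"
    and l: "l > 0" and C: "C \<ge> 0"
    and ell: "\<And>x. x \<in> ball x0 r \<Longrightarrow> \<exists>P. finite P \<and> (\<Sum>p\<in>P. g' x p \<bullet> p) \<le> C * norm (g x) \<and>
        (\<Sum>p\<in>P. (norm p)\<^sup>2) \<le> C \<and> (\<forall>w. l * (norm w)\<^sup>2 \<le> (\<Sum>p\<in>P. (p \<bullet> w)\<^sup>2))"
    and min: "\<And>x. x \<in> ball x0 r \<Longrightarrow> \<phi> x0 \<le> \<phi> x"
    and q: "q \<in> ball x0 (r / 2)"
  shows "\<phi> q = \<phi> x0"
proof (rule ccontr)
  assume neq: "\<phi> q \<noteq> \<phi> x0"
  have cont: "continuous_on (ball x0 r) \<phi>"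
    using \<phi> by (meson continuous_at_imp_continuous_on has_derivative_continuous)
  define Z where "Z = cball q (dist q x0) \<inter> {x \<in> ball x0 r. \<phi> x = \<phi> x0}"
  have dq: "dist q x0 < r / 2" using q by (simp add: dist_commute)
  \<comment> \<open>Since \<open>q\<close> lies in the concentric ball of half the radius, the ball
    around \<open>q\<close> reaching as far as \<open>x0\<close> stays where the hypotheses
    hold.\<close>
  have sub: "cball q (dist q x0) \<subseteq> ball x0 r"
  proof
    fix x assume "x \<in> cball q (dist q x0)"
    then show "x \<in> ball x0 r" using dq dist_triangle[of x0 x q] by (simp add: dist_commute)
  qed
  have "closed {x \<in> cball q (dist q x0). \<phi> x = \<phi> x0}"
    by (rule continuous_closed_preimage_constant) (use cont sub continuous_on_subset in auto)
  moreover have "Z = {x \<in> cball q (dist q x0). \<phi> x = \<phi> x0}" using sub by (auto simp: Z_def)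
  ultimately have "compact Z" unfolding Z_def
    by (metis (no_types, lifting) compact_Int_closed compact_cball Int_absorb1 Collect_mem_eq Int_Collect inf_le1 le_iff_inf)
  moreover have x0Z: "x0 \<in> Z" using dq zero_le_dist[of q x0] by (simp add: Z_def del: zero_le_dist)
  \<comment> \<open>A point of the minimum set nearest to \<open>q\<close>: the open ball around
    \<open>q\<close> of radius \<open>R\<close> misses that set and touches it at
    \<open>z0\<close>.\<close>
  ultimately obtain z0 where z0: "z0 \<in> Z" "\<And>z. z \<in> Z \<Longrightarrow> dist q z0 \<le> dist q z"
    using distance_attains_inf[of Z q] compact_imp_closed by blast
  define R where "R = dist q z0"
  have z0b: "z0 \<in> ball x0 r" "\<phi> z0 = \<phi> x0" using z0(1) by (auto simp: Z_def)
  have R: "R > 0" "R \<le> dist q x0"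
    using z0b neq z0(2)[OF x0Z] by (auto simp: R_def)
  have inb: "x \<in> ball x0 r" if "dist q x \<le> R" for x using subsetD[OF sub, of x] R that by auto
  have gt: "\<phi> x > \<phi> x0" if "dist q x < R" for x
    using that z0(2)[of x] min[OF inb[of x]] R inb[of x] by (force simp: R_def Z_def)
  \<comment> \<open>On the annulus \<open>norm (x - q)\<close> is at least \<open>R / 2\<close>, so
    the second order terms of the comparison function contribute at least
    \<open>4 * \<alpha>\<^sup>2 * l * (R/2)\<^sup>2\<close>. This has to exceed the remaining terms
    \<open>2 * \<alpha> * C\<close> and \<open>2 * \<alpha> * C * R\<close>; the final 1 makes the
    inequality strict.\<close>
  define \<alpha> where "\<alpha> = (2 * C * (1 + R) + 1) / (l * R\<^sup>2)"
  have \<alpha>: "\<alpha> > 0" "\<alpha> * (l * R\<^sup>2) = 2 * C * (1 + R) + 1"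
    using l R C by (auto simp: \<alpha>_def intro!: divide_pos_pos add_nonneg_pos)
  define E where "E x = exp (- \<alpha> * ((x - q) \<bullet> (x - q)))" for x
  define w where "w x = E x - exp (- \<alpha> * R\<^sup>2)" for x
  define h where "h x = (- 2 * \<alpha> * E x) *\<^sub>R (x - q)" for x
  define h' where "h' x v = (- 2 * \<alpha> * E x) *\<^sub>R v + (4 * \<alpha>\<^sup>2 * E x * ((x - q) \<bullet> v)) *\<^sub>R (x - q)" for x v
  have E': "(E has_derivative (\<lambda>v. h x \<bullet> v)) (at x)" for x
    unfolding E_def h_def
    by (auto intro!: derivative_eq_intros simp: fun_eq_iff inner_commute algebra_simps)
  have w': "(w has_derivative (\<lambda>v. h x \<bullet> v)) (at x)" for x
    unfolding w_def using has_derivative_diff[OF E' has_derivative_const] by simp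
  have h'd: "(h has_derivative h' x) (at x)" for x
    unfolding h_def[abs_def] h'_def[abs_def]
    by (auto intro!: derivative_eq_intros E' simp: fun_eq_iff h_def algebra_simps power2_eq_square)
  have nq: "norm (x - q) = dist q x" for x by (simp add: dist_norm norm_minus_commute)
  have E01: "0 < E x" "E x \<le> 1" for x using \<alpha> by (auto simp: E_def)
  have w1: "w x \<le> 1" for x using E01[of x] by (simp add: w_def add_increasing2 less_imp_le diff_le_eq)
  have w0: "w x = 0" if "dist q x = R" for x
    using that nq[of x] by (simp add: w_def E_def power2_norm_eq_inner[symmetric])
  \<comment> \<open>On the compact inner sphere \<phi> exceeds its minimum by some \<epsilon>. As
    \<open>w\<close> is at most 1, subtracting \<open>\<epsilon> * w\<close> does not spoil the
    comparison there.\<close>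
  obtain \<epsilon> where \<epsilon>: "\<epsilon> > 0" "\<And>x. dist q x = R / 2 \<Longrightarrow> \<phi> x \<ge> \<phi> x0 + \<epsilon>"
  proof -
    have "sphere q (R/2) \<noteq> {}" using R by simp
    moreover have "continuous_on (sphere q (R/2)) \<phi>"
      by (rule continuous_on_subset[OF cont]) (use inb R in auto)
    ultimately obtain y where y: "y \<in> sphere q (R/2)" "\<And>x. x \<in> sphere q (R/2) \<Longrightarrow> \<phi> y \<le> \<phi> x"
      using continuous_attains_inf[OF compact_sphere] by metis
    show ?thesis
      by (rule that[of "\<phi> y - \<phi> x0"]) (use y gt[of y] R in auto)
  qed
  define \<psi> where "\<psi> x = \<phi> x - \<epsilon> * w x" for x
  define K where "K = cball q R - ball q (R/2)"
  have \<psi>': "(\<psi> has_derivative (\<lambda>v. (g x - \<epsilon> *\<^sub>R h x) \<bullet> v)) (at x)" if "x \<in> ball x0 r" for x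
    unfolding \<psi>_def
    by (rule has_derivative_eq_rhs[OF has_derivative_diff[OF \<phi>[OF that] has_derivative_mult_right[OF w']]])
      (auto simp: inner_diff_left)
  have g2: "((\<lambda>x. g x - \<epsilon> *\<^sub>R h x) has_derivative (\<lambda>v. g' x v - \<epsilon> *\<^sub>R h' x v)) (at x)" if "x \<in> ball x0 r" for x
    by (intro has_derivative_diff g that has_derivative_scaleR_right h'd)
  \<comment> \<open>On both boundary spheres the claim holds by the choice of \<epsilon> and since
    \<open>w\<close> vanishes on the outer one. An interior minimum of \<psi> below the claimed
    bound would equate the gradients of \<phi> and \<open>\<epsilon> * w\<close> and order their
    Hessians; then the trace inequality for \<phi> contradicts the choice of \<alpha>.\<close>
  have barrier: "\<psi> x \<ge> \<phi> x0" if "x \<in> K" for x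
  proof (rule ccontr)
    assume neg: "\<not> \<psi> x \<ge> \<phi> x0"
    have "compact K" by (simp add: K_def compact_diff)
    moreover have "continuous_on K \<psi>"
      by (rule continuous_at_imp_continuous_on)
        (use \<psi>' inb in \<open>force simp: K_def intro: has_derivative_continuous\<close>)
    ultimately obtain x1 where x1: "x1 \<in> K" "\<And>y. y \<in> K \<Longrightarrow> \<psi> x1 \<le> \<psi> y"
      using continuous_attains_inf[of K \<psi>] \<open>x \<in> K\<close> by blast
    have lt: "\<psi> x1 < \<phi> x0" using x1(2)[OF \<open>x \<in> K\<close>] neg by simp
    have x1b: "x1 \<in> ball x0 r" using x1(1) inb by (auto simp: K_def)
    have "dist q x1 \<noteq> R"
      using lt min[OF x1b] w0[of x1] by (auto simp: \<psi>_def)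
    moreover have "dist q x1 \<noteq> R / 2"
    proof
      assume "dist q x1 = R / 2"
      then have "\<psi> x1 \<ge> \<phi> x0 + \<epsilon> - \<epsilon> * 1"
        unfolding \<psi>_def using \<epsilon> w1[of x1] by (intro diff_mono mult_left_mono) auto
      then show False using lt by simp
    qed
    ultimately have d1: "R / 2 < dist q x1" "dist q x1 < R" using x1(1) by (auto simp: K_def)
    define U where "U = ball q R - cball q (R/2)"
    have U: "open U" "x1 \<in> U" "U \<subseteq> ball x0 r" "U \<subseteq> K" using d1 inb by (auto simp: U_def K_def intro!: inb)
    have gr: "g x1 - \<epsilon> *\<^sub>R h x1 = 0" and hs: "(g' x1 p - \<epsilon> *\<^sub>R h' x1 p) \<bullet> p \<ge> 0" for p
      by (rule gradient_hessian_at_min[OF U(1,2) \<psi>' g2[OF x1b]]; use U x1(2) in blast)+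
    obtain P where P: "finite P" "(\<Sum>p\<in>P. g' x1 p \<bullet> p) \<le> C * norm (g x1)"
      "(\<Sum>p\<in>P. (norm p)\<^sup>2) \<le> C" "\<And>w. l * (norm w)\<^sup>2 \<le> (\<Sum>p\<in>P. (p \<bullet> w)\<^sup>2)"
      using ell[OF x1b] by blast
    define e where "e = E x1"
    have e: "e > 0" using E01 by (simp add: e_def)
    have hp: "h' x1 p \<bullet> p = e * (4 * \<alpha>\<^sup>2 * (p \<bullet> (x1 - q))\<^sup>2 - 2 * \<alpha> * (norm p)\<^sup>2)" for p
      unfolding power2_norm_eq_inner
      by (simp add: h'_def e_def inner_add_left inner_commute algebra_simps power2_eq_square)
    have "e * (4 * \<alpha>\<^sup>2 * (l * (norm (x1 - q))\<^sup>2) - 2 * \<alpha> * C)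
        \<le> e * (4 * \<alpha>\<^sup>2 * (\<Sum>p\<in>P. (p \<bullet> (x1 - q))\<^sup>2) - 2 * \<alpha> * (\<Sum>p\<in>P. (norm p)\<^sup>2))"
      by (intro mult_left_mono diff_mono P(3) P(4)) (use e \<alpha>(1) in auto)
    also have "\<dots> = (\<Sum>p\<in>P. h' x1 p \<bullet> p)"
      by (simp only: hp sum_distrib_left[symmetric] sum_subtractf)
    finally have 1: "\<epsilon> * (e * (4 * \<alpha>\<^sup>2 * (l * (norm (x1 - q))\<^sup>2) - 2 * \<alpha> * C)) \<le> \<epsilon> * (\<Sum>p\<in>P. h' x1 p \<bullet> p)"
      using \<epsilon> by simp
    have "\<epsilon> * (\<Sum>p\<in>P. h' x1 p \<bullet> p) \<le> (\<Sum>p\<in>P. g' x1 p \<bullet> p)"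
      unfolding sum_distrib_left using hs by (intro sum_mono) (simp add: inner_diff_left)
    also have "\<dots> \<le> C * (\<epsilon> * (2 * \<alpha> * e * norm (x1 - q)))"
    proof -
      have "norm (g x1) = norm (\<epsilon> *\<^sub>R h x1)" using gr by simp
      then show ?thesis using P(2) \<epsilon>(1) \<alpha>(1) e by (simp add: h_def e_def abs_mult)
    qed
    finally have "\<epsilon> * (e * (4 * \<alpha>\<^sup>2 * (l * (norm (x1 - q))\<^sup>2) - 2 * \<alpha> * C)) \<le> (\<epsilon> * e) * (2 * \<alpha> * C * norm (x1 - q))"
      using 1 by (simp add: algebra_simps)
    then have "4 * \<alpha>\<^sup>2 * (l * (norm (x1 - q))\<^sup>2) - 2 * \<alpha> * C \<le> 2 * \<alpha> * C * norm (x1 - q)"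
      using \<epsilon> e by (simp add: mult.assoc[symmetric] mult_le_cancel_left_pos)
    also have "\<dots> \<le> 2 * \<alpha> * C * R"
      using d1 \<alpha> C nq[of x1] by (intro mult_left_mono) auto
    finally have "4 * \<alpha>\<^sup>2 * (l * (norm (x1 - q))\<^sup>2) \<le> \<alpha> * (2 * C * (1 + R))"
      by (simp add: algebra_simps)
    moreover have "4 * \<alpha>\<^sup>2 * (l * (norm (x1 - q))\<^sup>2) \<ge> 4 * \<alpha>\<^sup>2 * (l * (R/2)\<^sup>2)"
      using d1 l R nq[of x1] by (intro mult_left_mono power_mono) auto
    moreover have "4 * \<alpha>\<^sup>2 * (l * (R/2)\<^sup>2) = \<alpha> * (\<alpha> * (l * R\<^sup>2))"
      by (simp add: power2_eq_square)
    ultimately have "\<alpha> * (\<alpha> * (l * R\<^sup>2)) \<le> \<alpha> * (2 * C * (1 + R))" by linarith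
    then show False using \<alpha> by (simp add: mult_le_cancel_left_pos)
  qed
  have gz0: "g z0 = 0"
  proof (rule gradient_hessian_at_min(1)[OF _ z0b(1) _ g[OF z0b(1)]])
    show "\<And>y. y \<in> ball x0 r \<Longrightarrow> \<phi> z0 \<le> \<phi> y" using min z0b by simp
  qed (use \<phi> in auto)
  \<comment> \<open>At the minimum \<open>z0\<close> the gradient of \<phi> vanishes, while that of
    \<open>w\<close> points towards \<open>q\<close>. So \<psi> decreases strictly from
    \<open>z0\<close> towards \<open>q\<close>, into the annulus, against
    \<open>barrier\<close>.\<close>
  define k where "k t = \<psi> (z0 + t *\<^sub>R (q - z0))" for t :: real
  have "((\<lambda>t. z0 + t *\<^sub>R (q - z0)) has_derivative (\<lambda>t. t *\<^sub>R (q - z0))) (at (0::real))"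
    by (auto intro!: derivative_eq_intros)
  then have "(k has_derivative (\<lambda>t. (g z0 - \<epsilon> *\<^sub>R h z0) \<bullet> (t *\<^sub>R (q - z0)))) (at 0)"
    unfolding k_def by (rule has_derivative_compose) (use \<psi>'[OF z0b(1)] in simp)
  then have "(k has_real_derivative ((g z0 - \<epsilon> *\<^sub>R h z0) \<bullet> (q - z0))) (at 0)"
    by (simp add: has_field_derivative_def mult.commute[of _ "(g z0 - \<epsilon> *\<^sub>R h z0) \<bullet> (q - z0)"])
  moreover have "(g z0 - \<epsilon> *\<^sub>R h z0) \<bullet> (q - z0) = - (\<epsilon> * (2 * \<alpha> * E z0) * ((q - z0) \<bullet> (q - z0)))"
    unfolding gz0 h_def by (simp add: inner_diff_left inner_diff_right algebra_simps)
  moreover have "(q - z0) \<bullet> (q - z0) > 0" using R by (simp add: R_def)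
  ultimately have "(k has_real_derivative ((g z0 - \<epsilon> *\<^sub>R h z0) \<bullet> (q - z0))) (at 0)"
    and "(g z0 - \<epsilon> *\<^sub>R h z0) \<bullet> (q - z0) < 0"
    using \<epsilon>(1) \<alpha>(1) E01(1)[of z0] by (auto simp: mult_pos_pos)
  from DERIV_neg_dec_right[OF this] obtain d where d: "d > 0" "\<And>s. 0 < s \<Longrightarrow> s < d \<Longrightarrow> k s < k 0"
    by auto
  \<comment> \<open>The bound \<open>1/2\<close> on \<open>s\<close> keeps the point outside the
    inner ball, hence in \<open>K\<close>.\<close>
  define s where "s = min d 1 / 2"
  have s: "0 < s" "s < d" "s \<le> 1/2" using d by (auto simp: s_def)
  have "dist q (z0 + s *\<^sub>R (q - z0)) = (1 - s) * R"
  proof -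
    have "q - (z0 + s *\<^sub>R (q - z0)) = (1 - s) *\<^sub>R (q - z0)" by (simp add: algebra_simps)
    then show ?thesis using s by (simp add: dist_norm R_def)
  qed
  moreover have "(1 - s) * R \<le> 1 * R" "(1/2) * R \<le> (1 - s) * R"
    using s R by (auto intro!: mult_right_mono)
  ultimately have "z0 + s *\<^sub>R (q - z0) \<in> K" by (auto simp: K_def)
  then have "k s \<ge> \<phi> x0" using barrier by (simp add: k_def)
  moreover have "k 0 = \<phi> x0" using w0[of z0] z0b by (simp add: k_def \<psi>_def R_def)
  ultimately show False using d(2) s by force
qed

section \<open>Radial graphs in a Euclidean space\<close>

definition grad :: "('a::euclidean_space \<Rightarrow> real) \<Rightarrow> 'a \<Rightarrow> 'a" where
  "grad f x = (\<Sum>b\<in>Basis. frechet_derivative f (at x) b *\<^sub>R b)"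

lemma has_derivative_grad:
  assumes "f differentiable (at x)"
  shows "(f has_derivative (\<lambda>w. grad f x \<bullet> w)) (at x)"
proof -
  have d: "(f has_derivative frechet_derivative f (at x)) (at x)"
    using assms frechet_derivative_works by blast
  have "frechet_derivative f (at x) w = grad f x \<bullet> w" for w
    using linear_basis_expansion[OF has_derivative_linear[OF d], of w]
    by (simp add: grad_def inner_sum_right inner_commute[of _ w] mult.commute)
  then have "frechet_derivative f (at x) = (\<lambda>w. grad f x \<bullet> w)" by blast
  with d show ?thesis by simp
qed

lemma smooth_on_grad: "smooth_on S f \<Longrightarrow> open S \<Longrightarrow> smooth_on S (grad f)"
  unfolding grad_def[abs_def] by (intro smooth_on_sum smooth_on_scaleR smooth_onD(4)) auto

lemma has_derivative_imp_grad:
  assumes "(f has_derivative f') (at x)"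
  shows "f' w = grad f x \<bullet> w"
  using has_derivative_unique[OF assms has_derivative_grad] assms by (metis differentiableI)

lemma has_derivative_along_curve:
  assumes "(f has_derivative f') (at (\<gamma> (0::real)))" "(\<gamma> has_vector_derivative q) (at 0)"
  shows "((\<lambda>s. f (\<gamma> s)) has_vector_derivative f' q) (at 0)"
proof -
  have "((\<lambda>s. f (\<gamma> s)) has_derivative (\<lambda>s. f' (s *\<^sub>R q))) (at 0)"
    using assms(2) unfolding has_vector_derivative_def
    by (rule has_derivative_compose) (rule assms(1))
  then show ?thesis
    unfolding has_vector_derivative_def
    by (simp add: linear_cmul[OF has_derivative_linear[OF assms(1)]])
qed

lemma eventually_nhds_0:
  "\<epsilon> > 0 \<Longrightarrow> (\<And>s. s \<in> {-\<epsilon><..<\<epsilon>} \<Longrightarrow> P s) \<Longrightarrow> \<forall>\<^sub>F s in nhds (0::real). P s"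
  using eventually_nhds_in_open[of "{-\<epsilon><..<\<epsilon>}" 0] by (auto elim: eventually_mono)

lemma has_vector_derivative_eventually_cong:
  assumes "(f has_vector_derivative f') (at (x::real))" "\<forall>\<^sub>F s in nhds x. f s = g s"
  shows "(g has_vector_derivative f') (at x)"
proof -
  obtain T where "open T" "x \<in> T" "\<And>s. s \<in> T \<Longrightarrow> f s = g s"
    using assms(2) unfolding eventually_nhds by blast
  then show ?thesis using has_vector_derivative_transform_within_open[OF assms(1)] by blast
qed

text \<open>Moving along the radial field \<open>E\<close> by the factor \<open>exp (- F)\<close> retracts a neighbourhood onto the level
  set, which turns straight lines into curves in the level set.\<close>

lemma tangent_vectors_level_set:
  fixes F :: "'v::euclidean_space \<Rightarrow> real"
  assumes D: "open D" "smooth_on D F" and E: "bounded_linear E"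
    and S: "S = {z \<in> D. F z = 0}"
    and retract: "\<And>z. z \<in> D \<Longrightarrow> z + (exp (- F z) - 1) *\<^sub>R E z \<in> S"
    and z: "z \<in> S" and F': "(F has_derivative F') (at z)"
  shows "tangent_vectors S z = {w. F' w = 0}"
proof (intro equalityI subsetI)
  fix w assume "w \<in> tangent_vectors S z"
  then obtain \<gamma> e where g: "e > 0" "\<gamma> 0 = z" "\<And>s. s \<in> {-e<..<e} \<Longrightarrow> \<gamma> s \<in> S"
      "(\<gamma> has_vector_derivative w) (at (0::real))"
    unfolding tangent_vectors_def by blast
  have "((\<lambda>s. F (\<gamma> s)) has_vector_derivative F' w) (at 0)"
    using has_derivative_along_curve[OF _ g(4), of F F'] F' g(2) by simp
  moreover have "((\<lambda>s. F (\<gamma> s)) has_vector_derivative 0) (at 0)"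
    by (rule has_vector_derivative_eventually_cong[OF has_vector_derivative_const[of 0]
        eventually_nhds_0[OF g(1)]]) (use g(3) in \<open>auto simp: S\<close>)
  ultimately show "w \<in> {w. F' w = 0}" using vector_derivative_unique_at by blast
next
  fix w assume "w \<in> {w. F' w = 0}"
  then have w: "F' w = 0" by simp
  have z0: "z \<in> D" "F z = 0" using z by (auto simp: S)
  define \<zeta> where "\<zeta> s = z + s *\<^sub>R w" for s :: real
  define \<gamma> where "\<gamma> s = \<zeta> s + (exp (- F (\<zeta> s)) - 1) *\<^sub>R E (\<zeta> s)" for s
  have "isCont \<zeta> 0" unfolding \<zeta>_def by (intro continuous_intros)
  moreover have "\<zeta> 0 \<in> D" using z0 by (simp add: \<zeta>_def)
  ultimately obtain e where e: "e > 0" "\<And>s. dist s 0 < e \<Longrightarrow> \<zeta> s \<in> D"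
    using D(1) unfolding continuous_at_open open_dist by (metis dist_commute)
  have inD: "\<zeta> s \<in> D" if "s \<in> {-e<..<e}" for s using e(2)[of s] that by (auto simp: abs_less_iff)
  have o: "open {-e<..<e}" by simp
  have s\<zeta>: "smooth_on {-e<..<e} \<zeta>" unfolding \<zeta>_def
    by (intro smooth_on_add smooth_on_scaleR smooth_on_const smooth_on_ident o)
  have "smooth_on {-e<..<e} \<gamma>" unfolding \<gamma>_def
    by (intro smooth_on_add smooth_on_scaleR smooth_on_diff smooth_on_exp_compose smooth_on_minus
        smooth_on_compose[OF D(2) s\<zeta> o D(1) inD] smooth_on_linear_compose[OF E] smooth_on_const s\<zeta> o)
  moreover have "\<gamma> 0 = z" using z0 by (simp add: \<gamma>_def \<zeta>_def)
  moreover have "\<gamma> s \<in> S" if "s \<in> {-e<..<e}" for s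
    unfolding \<gamma>_def by (rule retract[OF inD[OF that]])
  \<comment> \<open>As \<open>F' w = 0\<close>, the factor \<open>exp (- F (\<zeta> s)) - 1\<close>
    vanishes together with its derivative at 0, so the correction leaves the velocity of the line
    unchanged.\<close>
  moreover have "(\<gamma> has_vector_derivative w) (at 0)"
  proof -
    have \<zeta>': "(\<zeta> has_vector_derivative w) (at 0)"
      unfolding \<zeta>_def by (auto intro!: derivative_eq_intros)
    have "((\<lambda>s. F (\<zeta> s)) has_vector_derivative F' w) (at 0)"
      using has_derivative_along_curve[OF _ \<zeta>', of F F'] F' by (simp add: \<zeta>_def)
    then have "((\<lambda>s. F (\<zeta> s)) has_real_derivative 0) (at 0)"
      using w by (simp add: has_real_derivative_iff_has_vector_derivative)
    from DERIV_diff[OF DERIV_fun_exp[OF DERIV_minus[OF this]] DERIV_const[of 1]]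
    have "((\<lambda>s. exp (- F (\<zeta> s)) - 1) has_real_derivative 0) (at 0)" by simp
    from has_vector_derivative_add[OF \<zeta>' has_vector_derivative_scaleR[OF this
        bounded_linear.has_vector_derivative[OF E \<zeta>']]]
    show ?thesis using z0(2) unfolding \<gamma>_def by (simp add: \<zeta>_def)
  qed
  ultimately show "w \<in> tangent_vectors S z"
    unfolding tangent_vectors_def using e(1) by blast
qed

text \<open>The Gram-Schmidt remainder \<open>d\<close> lies in the span of \<open>P\<close> and is
  orthogonal to that span, hence to itself.\<close>

lemma orthonormal_expansion:
  fixes P :: "'b::euclidean_space set"
  assumes "pairwise orthogonal P" "\<And>p. p \<in> P \<Longrightarrow> norm p = 1" "x \<in> span P"
  shows "(\<Sum>p\<in>P. (x \<bullet> p) *\<^sub>R p) = x"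
proof -
  define d where "d = x - (\<Sum>p\<in>P. (p \<bullet> x / (p \<bullet> p)) *\<^sub>R p)"
  have "d \<in> span P"
    unfolding d_def using assms(3) by (intro span_diff span_sum span_scale) (auto intro: span_base)
  then have "orthogonal d d" unfolding d_def by (intro Gram_Schmidt_step[OF assms(1)])
  then have "x = (\<Sum>p\<in>P. (p \<bullet> x / (p \<bullet> p)) *\<^sub>R p)" by (simp add: orthogonal_self d_def)
  also have "\<dots> = (\<Sum>p\<in>P. (x \<bullet> p) *\<^sub>R p)"
    using assms(2) by (intro sum.cong) (auto simp: inner_commute power2_norm_eq_inner[symmetric])
  finally show ?thesis by simp
qed

section \<open>Graphs of heights that are constant along rays\<close>

locale star_graph =
  fixes v :: "'b::euclidean_space \<Rightarrow> real"
  assumes smooth_v: "smooth_on (- {0}) v"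
    and homog: "\<And>s z. s > 0 \<Longrightarrow> v (s *\<^sub>R z) = v z"
begin

definition graph :: "'b set" where
  "graph = {z. z \<noteq> 0 \<and> ln (norm z) = v z}"

definition hess :: "'b \<Rightarrow> 'b \<Rightarrow> 'b" where
  "hess z = frechet_derivative (grad v) (at z)"

text \<open>The gradient and the Hessian of \<open>ln (norm z) - v z\<close>, of which the graph is the zero set.\<close>

definition G :: "'b \<Rightarrow> 'b" where
  "G z = (1 / (norm z)\<^sup>2) *\<^sub>R z - grad v z"

definition G' :: "'b \<Rightarrow> 'b \<Rightarrow> 'b" where
  "G' z w = (1 / (norm z)\<^sup>2) *\<^sub>R w - (2 * (z \<bullet> w) / (norm z) ^ 4) *\<^sub>R z - hess z w"

lemma open_punctured: "open (- {0::'b})" by auto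

lemma v_deriv: "z \<noteq> 0 \<Longrightarrow> (v has_derivative (\<lambda>w. grad v z \<bullet> w)) (at z)"
  using smooth_onD(1)[OF smooth_v] has_derivative_grad by blast

lemma smooth_grad_v: "smooth_on (- {0}) (grad v)"
  using smooth_on_grad[OF smooth_v open_punctured] .

lemma grad_deriv: "z \<noteq> 0 \<Longrightarrow> (grad v has_derivative hess z) (at z)"
  unfolding hess_def using smooth_onD(2)[OF smooth_grad_v] by blast

lemma ln_norm_deriv:
  assumes "z \<noteq> (0::'b)"
  shows "((\<lambda>z. ln (norm z)) has_derivative (\<lambda>w. ((1 / (norm z)\<^sup>2) *\<^sub>R z) \<bullet> w)) (at z)"
proof -
  have "((\<lambda>z. ln (z \<bullet> z) / 2) has_derivative (\<lambda>w. ((1 / (norm z)\<^sup>2) *\<^sub>R z) \<bullet> w)) (at z)"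
    using assms by (auto intro!: derivative_eq_intros simp: fun_eq_iff inner_commute power2_norm_eq_inner divide_real_def[of _ "z \<bullet> z"])
  then show ?thesis
    by (rule has_derivative_transform_within_open[OF _ open_punctured])
      (use assms in \<open>auto simp: norm_eq_sqrt_inner ln_sqrt\<close>)
qed

lemma F_deriv:
  assumes "z \<noteq> 0"
  shows "((\<lambda>z. ln (norm z) - v z) has_derivative (\<lambda>w. G z \<bullet> w)) (at z)"
  unfolding G_def inner_diff_left by (intro has_derivative_diff ln_norm_deriv v_deriv assms)

lemma G_deriv:
  assumes "z \<noteq> 0"
  shows "(G has_derivative G' z) (at z)"
proof -
  have "((\<lambda>z. 1 / (z \<bullet> z)) has_derivative (\<lambda>w. - 2 * (z \<bullet> w) / (z \<bullet> z)\<^sup>2)) (at z)"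
    using assms by (auto intro!: derivative_eq_intros
      simp: fun_eq_iff inner_commute power2_eq_square divide_inverse)
  moreover have "(z \<bullet> z)\<^sup>2 = norm z ^ 4" by (simp add: power2_norm_eq_inner[symmetric])
  ultimately have n: "((\<lambda>z. 1 / (z \<bullet> z)) has_derivative (\<lambda>w. - 2 * (z \<bullet> w) / (norm z) ^ 4)) (at z)"
    by simp
  have "((\<lambda>z. (1 / (z \<bullet> z)) *\<^sub>R z - grad v z) has_derivative
      (\<lambda>w. ((1 / (z \<bullet> z)) *\<^sub>R w + (- 2 * (z \<bullet> w) / (norm z) ^ 4) *\<^sub>R z) - hess z w)) (at z)"
    by (intro has_derivative_diff has_derivative_scaleR n has_derivative_ident grad_deriv assms)
  then show ?thesis
    unfolding G_def[abs_def] G'_def[abs_def] power2_norm_eq_inner by simp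
qed

text \<open>Euler's relation for degree 0: the derivative of a constant along the ray.\<close>

lemma grad_radial:
  assumes "z \<noteq> 0" shows "grad v z \<bullet> z = 0"
proof -
  have "((\<lambda>s. z + s *\<^sub>R z) has_vector_derivative z) (at (0::real))"
    by (auto intro!: derivative_eq_intros)
  from has_derivative_along_curve[OF _ this, of v "\<lambda>w. grad v z \<bullet> w"]
  have "((\<lambda>s. v (z + s *\<^sub>R z)) has_vector_derivative grad v z \<bullet> z) (at 0)"
    using v_deriv[OF assms] by simp
  moreover have "((\<lambda>s. v (z + s *\<^sub>R z)) has_vector_derivative 0) (at 0)"
  proof (rule has_vector_derivative_eventually_cong[OF has_vector_derivative_const[of "v z"]])
    show "\<forall>\<^sub>F s in nhds 0. v z = v (z + s *\<^sub>R z)"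
    proof (rule eventually_nhds_0[of 1])
      fix s :: real assume "s \<in> {-1<..<1}"
      then show "v z = v (z + s *\<^sub>R z)" using homog[of "1 + s" z] by (simp add: algebra_simps)
    qed simp
  qed
  ultimately show ?thesis using vector_derivative_unique_at by blast
qed

lemma grad_homog:
  assumes "z \<noteq> 0" "s > 0" shows "s *\<^sub>R grad v (s *\<^sub>R z) = grad v z"
proof -
  have "((\<lambda>z. v (s *\<^sub>R z)) has_derivative (\<lambda>w. grad v (s *\<^sub>R z) \<bullet> (s *\<^sub>R w))) (at z)"
    by (rule has_derivative_compose[of "\<lambda>z. s *\<^sub>R z" "\<lambda>w. s *\<^sub>R w"])
      (use assms v_deriv[of "s *\<^sub>R z"] in \<open>auto intro!: derivative_eq_intros\<close>)
  then have "(v has_derivative (\<lambda>w. grad v (s *\<^sub>R z) \<bullet> (s *\<^sub>R w))) (at z)"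
    using homog[OF assms(2)] by simp
  from has_derivative_imp_grad[OF this]
  have "(s *\<^sub>R grad v (s *\<^sub>R z)) \<bullet> w = grad v z \<bullet> w" for w by simp
  then show ?thesis using vector_eq_rdot by blast
qed

lemma hess_homog:
  assumes "z \<noteq> 0" "s > 0" shows "s\<^sup>2 *\<^sub>R hess (s *\<^sub>R z) w = hess z w"
proof -
  have "((\<lambda>z. s *\<^sub>R grad v (s *\<^sub>R z)) has_derivative (\<lambda>w. s *\<^sub>R hess (s *\<^sub>R z) (s *\<^sub>R w))) (at z)"
    by (rule has_derivative_scaleR_right, rule has_derivative_compose[of "\<lambda>z. s *\<^sub>R z" "\<lambda>w. s *\<^sub>R w"])
      (use assms grad_deriv[of "s *\<^sub>R z"] in \<open>auto intro!: derivative_eq_intros\<close>)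
  then have "(grad v has_derivative (\<lambda>w. s *\<^sub>R hess (s *\<^sub>R z) (s *\<^sub>R w))) (at z)"
    by (rule has_derivative_transform_within_open[OF _ open_punctured])
      (use assms grad_homog in auto)
  from has_derivative_unique[OF this grad_deriv[OF assms(1)]]
  have "s *\<^sub>R hess (s *\<^sub>R z) (s *\<^sub>R w) = hess z w" by metis
  moreover have "hess (s *\<^sub>R z) (s *\<^sub>R w) = s *\<^sub>R hess (s *\<^sub>R z) w"
    using linear_cmul[OF has_derivative_linear[OF grad_deriv]] assms by simp
  ultimately show ?thesis by (simp add: power2_eq_square)
qed

text \<open>Euler's relation is differentiated in the direction \<open>z\<close> and then used once
  more. Because of this identity \<open>z\<close> can join a tangent frame without changing the
  trace of the Hessian.\<close>

lemma hess_radial: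
  assumes "z \<noteq> 0" shows "hess z z \<bullet> z = 0"
proof -
  have "((\<lambda>z. grad v z \<bullet> z) has_derivative (\<lambda>w. grad v z \<bullet> w + hess z w \<bullet> z)) (at z)"
    by (intro has_derivative_inner grad_deriv assms has_derivative_ident)
  moreover have "((\<lambda>z. grad v z \<bullet> z) has_derivative (\<lambda>w. 0)) (at z)"
    by (rule has_derivative_transform_within_open[OF has_derivative_const[of 0] open_punctured])
      (use assms grad_radial in auto)
  ultimately have "grad v z \<bullet> z + hess z z \<bullet> z = 0" using has_derivative_unique by metis
  then show ?thesis using grad_radial[OF assms] by simp
qed

text \<open>Only \<open>ln (norm z)\<close> varies along a ray. So \<open>G\<close> never vanishes,
  points outward, and \<open>z\<close> is transversal to the tangent hyperplane.\<close>

lemma G_radial: "z \<noteq> 0 \<Longrightarrow> G z \<bullet> z = 1"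
  by (simp add: G_def inner_diff_left grad_radial power2_norm_eq_inner)

lemma G_nonzero: "z \<noteq> 0 \<Longrightarrow> G z \<noteq> 0" using G_radial by force

lemma norm_G_ge: assumes "z \<noteq> 0" shows "norm (G z) \<ge> 1 / norm z"
proof -
  have "1 \<le> norm (G z) * norm z" using norm_cauchy_schwarz[of "G z" z] G_radial[OF assms] by simp
  then show ?thesis using assms by (simp add: divide_le_eq mult.commute)
qed

lemma graph_scaled:
  assumes "z \<noteq> 0" shows "exp (v z - ln (norm z)) *\<^sub>R z \<in> graph"
  using assms homog[of "exp (v z - ln (norm z))" z] by (simp add: graph_def ln_mult)

lemma tangent_vectors_graph:
  assumes z: "z \<in> graph"
  shows "tangent_vectors graph z = {w. G z \<bullet> w = 0}"
proof (rule tangent_vectors_level_set[OF open_punctured _ bounded_linear_ident _ _ z F_deriv])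
  show "smooth_on (- {0}) (\<lambda>z. ln (norm z) - v z)"
    by (intro smooth_on_diff smooth_on_ln_compose smooth_on_norm smooth_on_ident smooth_v open_punctured) auto
  show "graph = {z \<in> - {0}. ln (norm z) - v z = 0}" by (auto simp: graph_def)
  show "y + (exp (- (ln (norm y) - v y)) - 1) *\<^sub>R y \<in> graph" if "y \<in> - {0}" for y
    using graph_scaled[of y] that by (simp add: algebra_simps)
  show "z \<noteq> 0" using z by (simp add: graph_def)
qed

lemma outward_normal_graph:
  assumes N: "outward_normal_field graph W N" and y: "y \<in> graph \<inter> W"
  shows "norm (G y) *\<^sub>R N y = G y"
proof -
  define n where "n = N y"
  have y0: "y \<noteq> 0" using y by (simp add: graph_def)
  have n: "n \<bullet> n = 1" "\<And>w. G y \<bullet> w = 0 \<Longrightarrow> n \<bullet> w = 0" "n \<bullet> y > 0"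
    using N y tangent_vectors_graph[of y]
    by (auto simp: outward_normal_field_def n_def power2_norm_eq_inner[symmetric])
  \<comment> \<open>Up to a factor, the part of \<open>n\<close> orthogonal to \<open>G y\<close>.
    It is tangent, so \<open>n\<close> is orthogonal to it as well, which forces it to vanish; the
    sign of the multiple of \<open>G y\<close> then follows from pairing with
    \<open>y\<close>.\<close>
  define w where "w = (G y \<bullet> G y) *\<^sub>R n - (n \<bullet> G y) *\<^sub>R G y"
  have Gw: "G y \<bullet> w = 0" by (simp add: w_def inner_diff_right inner_commute)
  then have "n \<bullet> w = 0" using n(2) by simp
  then have "w \<bullet> w = 0" using Gw by (subst (1) w_def) (simp add: inner_diff_left)
  then have eq: "(G y \<bullet> G y) *\<^sub>R n = (n \<bullet> G y) *\<^sub>R G y" by (simp add: w_def)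
  have "(G y \<bullet> G y) * (n \<bullet> y) = n \<bullet> G y"
    using arg_cong[OF eq, of "\<lambda>a. a \<bullet> y"] G_radial[OF y0] by simp
  then have pos: "n \<bullet> G y > 0" using G_nonzero[OF y0] n(3) by (metis inner_gt_zero_iff mult_pos_pos)
  have "(G y \<bullet> G y) = (n \<bullet> G y)\<^sup>2"
    using arg_cong[OF eq, of "\<lambda>a. a \<bullet> n"] n(1) by (simp add: inner_commute power2_eq_square)
  then have *: "n \<bullet> G y = norm (G y)" using pos by (simp add: norm_eq_sqrt_inner)
  have "norm (G y) *\<^sub>R (norm (G y) *\<^sub>R n) = norm (G y) *\<^sub>R G y"
    using eq unfolding * by (simp add: power2_norm_eq_inner[symmetric] power2_eq_square)
  from iffD1[OF scaleR_cancel_left this] show ?thesis using G_nonzero[OF y0] by (simp add: n_def)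
qed

text \<open>Parseval's identity on the tangent hyperplane stands in for orthogonality and spanning,
  since the ellipticity estimate uses a frame in this form. The condition depends on
  \<open>z\<close> only through the hyperplane orthogonal to \<open>G z\<close>.\<close>

definition orthonormal_frame :: "'b \<Rightarrow> 'b set \<Rightarrow> bool" where
  "orthonormal_frame z P \<longleftrightarrow> finite P \<and> card P = DIM('b) - 1 \<and> (\<forall>p\<in>P. norm p = 1 \<and> G z \<bullet> p = 0) \<and>
     (\<forall>q. G z \<bullet> q = 0 \<longrightarrow> (norm q)\<^sup>2 = (\<Sum>p\<in>P. (p \<bullet> q)\<^sup>2))"

text \<open>On the graph \<open>norm (G y) *\<^sub>R N y = G y\<close>. This holds only there, so it
  is differentiated along a curve in the graph. Pairing with the velocity \<open>q\<close> removes
  the term with the derivative of \<open>norm (G y)\<close>, because \<open>N z\<close> is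
  orthogonal to \<open>q\<close>. Thus the shape form of \<open>N'\<close> is that of
  \<open>G'\<close> divided by \<open>norm (G z)\<close>.\<close>

lemma gauss_curvatureE:
  assumes "has_gauss_curvature graph z k"
  obtains P \<kappa> where "orthonormal_frame z P" "k = (\<Prod>p\<in>P. \<kappa> p)"
    "\<And>p. p \<in> P \<Longrightarrow> G' z p \<bullet> p = norm (G z) * \<kappa> p"
    "\<And>q. G z \<bullet> q = 0 \<Longrightarrow> G' z q \<bullet> q = norm (G z) * (\<Sum>p\<in>P. \<kappa> p * (p \<bullet> q)\<^sup>2)"
proof -
  from assms obtain W N N' P \<kappa> where z: "z \<in> graph" "z \<in> W" and N: "outward_normal_field graph W N"
    and N': "(N has_derivative N') (at z)"
    and P: "pairwise orthogonal P" "\<And>p. p \<in> P \<Longrightarrow> norm p = 1" "span P = tangent_vectors graph z"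
    and \<kappa>: "\<And>p. p \<in> P \<Longrightarrow> N' p = \<kappa> p *\<^sub>R p" "k = (\<Prod>p\<in>P. \<kappa> p)"
    unfolding has_gauss_curvature_def by blast
  have z0: "z \<noteq> 0" using z by (simp add: graph_def)
  note T = tangent_vectors_graph[OF z(1)]
  have fin: "finite P" using P(1) pairwise_orthogonal_imp_finite by blast
  have "independent P" using pairwise_orthogonal_independent[OF P(1)] P(2) by force
  then have "card P = dim (span P)" by (simp add: dim_eq_card_independent)
  then have card: "card P = DIM('b) - 1"
    using dim_hyperplane[OF G_nonzero[OF z0]] P(3) T by simp
  have ex: "(\<Sum>p\<in>P. (q \<bullet> p) *\<^sub>R p) = q" if "G z \<bullet> q = 0" for q
    using orthonormal_expansion[OF P(1,2), of q] that P(3) T by auto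
  have shape: "G' z q \<bullet> q = norm (G z) * (N' q \<bullet> q)" if q: "G z \<bullet> q = 0" for q
  proof -
    obtain \<gamma> \<epsilon> where g: "\<epsilon> > 0" "\<gamma> 0 = z" "\<And>s. s \<in> {-\<epsilon><..<\<epsilon>} \<Longrightarrow> \<gamma> s \<in> graph"
      "(\<gamma> has_vector_derivative q) (at (0::real))"
      using q T unfolding tangent_vectors_def by blast
    have "isCont \<gamma> 0" using g(4) has_vector_derivative_continuous by blast
    moreover have "open W" using N by (simp add: outward_normal_field_def)
    ultimately have W: "\<forall>\<^sub>F s in nhds 0. \<gamma> s \<in> W"
      using z(2) g(2) by (metis isCont_def tendsto_at_iff_tendsto_nhds topological_tendstoD)
    have Gr: "\<forall>\<^sub>F s in nhds 0. \<gamma> s \<in> graph" by (rule eventually_nhds_0[OF g(1,3)])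
    have G1: "((\<lambda>s. G (\<gamma> s)) has_vector_derivative G' z q) (at 0)"
      using has_derivative_along_curve[OF _ g(4), of G] G_deriv[OF z0] g(2) by simp
    have N1: "((\<lambda>s. N (\<gamma> s)) has_vector_derivative N' q) (at 0)"
      using has_derivative_along_curve[OF _ g(4), of N] N' g(2) by simp
    have nG: "(norm has_derivative (\<lambda>h. h \<bullet> sgn (G z))) (at (G z))"
      by (rule has_derivative_norm[OF G_nonzero[OF z0]])
    have "((\<lambda>s. norm (G (\<gamma> s))) has_vector_derivative G' z q \<bullet> sgn (G z)) (at 0)"
      using has_derivative_along_curve[OF _ G1, of norm] nG g(2) by simp
    then have "((\<lambda>s. norm (G (\<gamma> s))) has_real_derivative G' z q \<bullet> sgn (G z)) (at 0)"
      by (simp add: has_real_derivative_iff_has_vector_derivative)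
    from has_vector_derivative_scaleR[OF this N1]
    have "((\<lambda>s. norm (G (\<gamma> s)) *\<^sub>R N (\<gamma> s)) has_vector_derivative
       norm (G z) *\<^sub>R N' q + (G' z q \<bullet> sgn (G z)) *\<^sub>R N z) (at 0)"
      using g(2) by simp
    moreover have "\<forall>\<^sub>F s in nhds 0. norm (G (\<gamma> s)) *\<^sub>R N (\<gamma> s) = G (\<gamma> s)"
      using W Gr by eventually_elim (use outward_normal_graph[OF N] in blast)
    ultimately have "((\<lambda>s. G (\<gamma> s)) has_vector_derivative
       norm (G z) *\<^sub>R N' q + (G' z q \<bullet> sgn (G z)) *\<^sub>R N z) (at 0)"
      by (rule has_vector_derivative_eventually_cong)
    from vector_derivative_unique_at[OF G1 this]
    have "G' z q = norm (G z) *\<^sub>R N' q + (G' z q \<bullet> sgn (G z)) *\<^sub>R N z" .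
    from arg_cong[OF this, of "\<lambda>a. a \<bullet> q"]
    have "G' z q \<bullet> q = norm (G z) * (N' q \<bullet> q) + (G' z q \<bullet> sgn (G z)) * (N z \<bullet> q)"
      by (simp add: inner_add_left)
    moreover have "norm (G z) * (N z \<bullet> q) = 0"
      using arg_cong[OF outward_normal_graph[OF N], of z "\<lambda>a. a \<bullet> q"] z q by simp
    ultimately show ?thesis using G_nonzero[OF z0] by simp
  qed
  have Pt: "G z \<bullet> p = 0" if "p \<in> P" for p using span_base[OF that] P(3) T by blast
  have "N' q \<bullet> q = (\<Sum>p\<in>P. \<kappa> p * (p \<bullet> q)\<^sup>2)" if q: "G z \<bullet> q = 0" for q
  proof -
    have l: "linear N'" using N' has_derivative_linear by blast
    have "N' q = N' (\<Sum>p\<in>P. (q \<bullet> p) *\<^sub>R p)" using ex[OF q] by simp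
    also have "\<dots> = (\<Sum>p\<in>P. (q \<bullet> p) *\<^sub>R \<kappa> p *\<^sub>R p)"
      by (simp add: linear_sum[OF l] linear_cmul[OF l] \<kappa>(1))
    finally have "N' q \<bullet> q = (\<Sum>p\<in>P. (q \<bullet> p) * (\<kappa> p * (p \<bullet> q)))"
      by (simp add: inner_sum_left mult.assoc)
    then show ?thesis by (simp add: inner_commute[of q] power2_eq_square mult.left_commute mult.assoc)
  qed
  moreover have "(norm q)\<^sup>2 = (\<Sum>p\<in>P. (p \<bullet> q)\<^sup>2)" if q: "G z \<bullet> q = 0" for q
  proof -
    have "(norm q)\<^sup>2 = (\<Sum>p\<in>P. (q \<bullet> p) *\<^sub>R p) \<bullet> q"
      unfolding ex[OF q] by (simp add: power2_norm_eq_inner)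
    also have "\<dots> = (\<Sum>p\<in>P. (q \<bullet> p) * (p \<bullet> q))" by (simp add: inner_sum_left)
    finally show ?thesis by (simp add: inner_commute power2_eq_square)
  qed
  moreover have "N' p \<bullet> p = \<kappa> p" if "p \<in> P" for p
    using \<kappa>(1)[OF that] P(2)[OF that] by (simp add: power2_norm_eq_inner[symmetric])
  ultimately show ?thesis
    using that[of P \<kappa>] fin card \<kappa>(2) P(2) Pt shape by (simp add: orthonormal_frame_def)
qed

section \<open>Compactness, connectedness and extremal points\<close>

definition param :: "'b \<Rightarrow> 'b" where
  "param \<theta> = exp (v \<theta>) *\<^sub>R \<theta>"

lemma graph_eq_image: "graph = param ` sphere 0 1"
proof (intro equalityI subsetI)
  fix z assume z: "z \<in> graph"
  then have z0: "z \<noteq> 0" "ln (norm z) = v z" by (auto simp: graph_def)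
  have e: "exp (v z) = norm z" using z0 by (metis exp_ln zero_less_norm_iff)
  have "v ((1 / norm z) *\<^sub>R z) = v z" using z0 by (intro homog) simp
  then have "z = param ((1 / norm z) *\<^sub>R z)"
    using z0 e by (simp add: param_def)
  moreover have "(1 / norm z) *\<^sub>R z \<in> sphere 0 1" using z0 by simp
  ultimately show "z \<in> param ` sphere 0 1" by blast
next
  fix z assume "z \<in> param ` sphere 0 1"
  then obtain \<theta> where t: "norm \<theta> = 1" "z = param \<theta>" by auto
  then have "z \<noteq> 0" by (auto simp: param_def)
  moreover have "v (param \<theta>) = v \<theta>" unfolding param_def by (rule homog) simp
  ultimately show "z \<in> graph" using t by (simp add: graph_def param_def)
qed

lemma continuous_on_param: "continuous_on (sphere 0 1) param"
proof -
  have "continuous_on (sphere 0 1) v"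
    by (rule continuous_on_subset[OF smooth_onD(3)[OF smooth_v]]) auto
  then show ?thesis unfolding param_def by (intro continuous_intros)
qed

lemma compact_graph: "compact graph"
  unfolding graph_eq_image by (intro compact_continuous_image continuous_on_param compact_sphere)

lemma connected_graph: "DIM('b) \<ge> 2 \<Longrightarrow> connected graph"
  unfolding graph_eq_image
  by (intro connected_continuous_image continuous_on_param connected_sphere)

lemma norm_graph: "z \<in> graph \<Longrightarrow> norm z = exp (v z)"
  unfolding graph_def by (metis (mono_tags, lifting) exp_ln mem_Collect_eq zero_less_norm_iff)

lemma graph_scaled_exists:
  assumes "z \<noteq> 0" obtains s where "s > 0" "s *\<^sub>R z \<in> graph"
  using graph_scaled[OF assms] by (metis exp_gt_zero)

lemma graph_nonempty: "graph \<noteq> {}"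
proof -
  obtain e :: 'b where "e \<in> Basis" using nonempty_Basis by blast
  then show ?thesis unfolding graph_eq_image by (metis image_is_empty empty_iff mem_sphere_0 norm_Basis)
qed

lemma height_eq_ln_norm_on_graph:
  assumes "y \<noteq> 0" obtains y' where "y' \<in> graph" "v y = ln (norm y')"
proof -
  obtain s where s: "s > 0" "s *\<^sub>R y \<in> graph" using graph_scaled_exists[OF assms] .
  then have "ln (norm (s *\<^sub>R y)) = v y" using homog[of s y] by (simp add: graph_def)
  then show ?thesis using that[OF s(2)] by simp
qed

text \<open>The norm attains its maximum on the compact graph. As \<open>v\<close> takes the same
  values off the graph as on it, this is a maximum of \<open>v\<close> on a whole open set, and the
  derivative tests of Euclidean space apply.\<close>

lemma farthest_point: obtains z where "z \<in> graph" "\<And>y. y \<noteq> 0 \<Longrightarrow> v y \<le> v z"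
proof -
  obtain z where z: "z \<in> graph" "\<And>y. y \<in> graph \<Longrightarrow> norm y \<le> norm z"
    using continuous_attains_sup[OF compact_graph graph_nonempty continuous_on_norm_id] by blast
  have "v y \<le> v z" if y: "y \<noteq> 0" for y
  proof -
    obtain y' where y': "y' \<in> graph" "v y = ln (norm y')" using height_eq_ln_norm_on_graph[OF y] .
    have "norm y' > 0" "norm z > 0" using y'(1) z(1) by (auto simp: graph_def)
    then have "ln (norm y') \<le> ln (norm z)" using z(2)[OF y'(1)] by (simp only: ln_le_cancel_iff)
    then show ?thesis using y'(2) z(1) by (simp add: graph_def)
  qed
  then show ?thesis using that z(1) by blast
qed

lemma nearest_point: obtains z where "z \<in> graph" "\<And>y. y \<noteq> 0 \<Longrightarrow> v z \<le> v y"
proof -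
  obtain z where z: "z \<in> graph" "\<And>y. y \<in> graph \<Longrightarrow> norm z \<le> norm y"
    using continuous_attains_inf[OF compact_graph graph_nonempty continuous_on_norm_id] by blast
  have "v z \<le> v y" if y: "y \<noteq> 0" for y
  proof -
    obtain y' where y': "y' \<in> graph" "v y = ln (norm y')" using height_eq_ln_norm_on_graph[OF y] .
    have "norm y' > 0" "norm z > 0" using y'(1) z(1) by (auto simp: graph_def)
    then have "ln (norm z) \<le> ln (norm y')" using z(2)[OF y'(1)] by (simp only: ln_le_cancel_iff)
    then show ?thesis using y'(2) z(1) by (simp add: graph_def)
  qed
  then show ?thesis using that z(1) by blast
qed

lemma at_nearest_point:
  assumes z: "z \<noteq> 0" and min: "\<And>y. y \<noteq> 0 \<Longrightarrow> v z \<le> v y"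
  shows "grad v z = 0" "hess z w \<bullet> w \<ge> 0"
  by (rule gradient_hessian_at_min[OF open_punctured _ v_deriv grad_deriv]; use assms in simp)+

lemma at_farthest_point:
  assumes z: "z \<noteq> 0" and max: "\<And>y. y \<noteq> 0 \<Longrightarrow> v y \<le> v z"
  shows "grad v z = 0" "hess z w \<bullet> w \<le> 0"
proof -
  have d: "((\<lambda>y. - v y) has_derivative (\<lambda>w. - grad v y \<bullet> w)) (at y)" if "y \<in> - {0}" for y
    using has_derivative_minus[OF v_deriv] that by simp
  have h: "((\<lambda>y. - grad v y) has_derivative (\<lambda>w. - hess z w)) (at z)"
    using has_derivative_minus[OF grad_deriv[OF z]] .
  have "- grad v z = 0" "- hess z w \<bullet> w \<ge> 0" for w
    by (rule gradient_hessian_at_min[OF open_punctured _ d h]; use assms in simp)+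
  then show "grad v z = 0" "hess z w \<bullet> w \<le> 0" by auto
qed

lemma G'_radial_tangent:
  assumes "z \<bullet> w = 0" shows "G' z w \<bullet> w = (norm w)\<^sup>2 / (norm z)\<^sup>2 - hess z w \<bullet> w"
  using assms by (simp add: G'_def inner_diff_left power2_norm_eq_inner)

lemma norm_G_critical: "z \<noteq> 0 \<Longrightarrow> grad v z = 0 \<Longrightarrow> norm (G z) = 1 / norm z"
  by (simp add: G_def power2_eq_square)

lemma linear_G': "z \<noteq> 0 \<Longrightarrow> linear (G' z)"
  using G_deriv has_derivative_linear by blast

lemma continuous_on_hess: "continuous_on (- {0}) (\<lambda>z. hess z b)"
  unfolding hess_def by (rule smooth_onD(3)[OF smooth_onD(4)[OF smooth_grad_v]])

lemma continuous_on_G: "continuous_on (- {0}) G"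
  using G_deriv has_derivative_continuous by (intro continuous_at_imp_continuous_on) blast

text \<open>Continuity of \<open>hess\<close> in the point is known for fixed directions; expanding
  the direction in a basis gives joint continuity.\<close>

lemma continuous_on_second_form: 
  "continuous_on ((- {0}) \<times> UNIV) (\<lambda>(z, q). G' z q \<bullet> q)"
proof -
  have h: "continuous_on ((- {0}) \<times> UNIV) (\<lambda>x. hess (fst x) b)" for b
    by (rule continuous_on_compose2[OF continuous_on_hess[of b] continuous_on_fst[OF continuous_on_id]]) auto
  have c: "continuous_on ((- {0}) \<times> UNIV) (\<lambda>x::'b \<times> 'b. 1 / (norm (fst x))\<^sup>2)"
    "continuous_on ((- {0}) \<times> UNIV) (\<lambda>x::'b \<times> 'b. 2 * (fst x \<bullet> snd x) / (norm (fst x)) ^ 4)"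
    by (intro continuous_on_divide continuous_on_const continuous_on_power continuous_on_norm
      continuous_on_mult continuous_on_inner continuous_on_fst continuous_on_snd continuous_on_id; force)+
  have "continuous_on ((- {0}) \<times> UNIV) (\<lambda>x. ((1 / (norm (fst x))\<^sup>2) *\<^sub>R snd x
      - (2 * (fst x \<bullet> snd x) / (norm (fst x)) ^ 4) *\<^sub>R fst x
      - (\<Sum>b\<in>Basis. (snd x \<bullet> b) *\<^sub>R hess (fst x) b)) \<bullet> snd x)"
    by (intro continuous_on_inner continuous_on_diff continuous_on_sum continuous_on_scaleR h c continuous_intros)
  then show ?thesis
  proof (rule continuous_on_eq)
    fix x :: "'b \<times> 'b" assume "x \<in> (- {0}) \<times> UNIV"
    then have "fst x \<noteq> 0" by auto
    then have l: "linear (hess (fst x))" using grad_deriv has_derivative_linear by blast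
    show "((1 / (norm (fst x))\<^sup>2) *\<^sub>R snd x
      - (2 * (fst x \<bullet> snd x) / (norm (fst x)) ^ 4) *\<^sub>R fst x
      - (\<Sum>b\<in>Basis. (snd x \<bullet> b) *\<^sub>R hess (fst x) b)) \<bullet> snd x = (case x of (z, q) \<Rightarrow> G' z q \<bullet> q)"
      by (simp add: case_prod_beta G'_def linear_basis_expansion[OF l, of "snd x", symmetric])
  qed
qed

section \<open>Positivity of the second fundamental form\<close>

definition positive_at :: "'b \<Rightarrow> bool" where
  "positive_at z \<longleftrightarrow> (\<forall>q. q \<noteq> 0 \<longrightarrow> G z \<bullet> q = 0 \<longrightarrow> G' z q \<bullet> q > 0)"

text \<open>There \<open>G z\<close> is radial, so tangent vectors are orthogonal to
  \<open>z\<close>, and the form is that of the sphere through \<open>z\<close> minus the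
  nonpositive Hessian of \<open>v\<close>.\<close>

lemma positive_at_farthest:
  assumes "z \<noteq> 0" "\<And>y. y \<noteq> 0 \<Longrightarrow> v y \<le> v z"
  shows "positive_at z"
  unfolding positive_at_def
proof (intro allI impI)
  fix q assume q: "q \<noteq> 0" "G z \<bullet> q = 0"
  note f = at_farthest_point[OF assms]
  have "z \<bullet> q = 0" using q(2) f(1) assms(1) by (simp add: G_def)
  moreover have "(norm q)\<^sup>2 / (norm z)\<^sup>2 > 0" using q(1) assms(1) by simp
  ultimately show "G' z q \<bullet> q > 0" using G'_radial_tangent f(2)[of q] by fastforce
qed

text \<open>A nonnegative form has nonnegative principal curvatures, and none is 0 since their
  product is not; it would be positive definite. So positivity can only fail by a strict inequality,
  which persists at nearby points.\<close>

lemma not_positive_atD: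
  assumes "has_gauss_curvature graph z k" "k > 0" "\<not> positive_at z"
  shows "\<exists>q. G z \<bullet> q = 0 \<and> G' z q \<bullet> q < 0"
proof (rule ccontr)
  assume n: "\<not> ?thesis"
  have z0: "z \<noteq> 0" using assms(1) by (simp add: has_gauss_curvature_def graph_def)
  obtain P \<kappa> where P: "orthonormal_frame z P" "k = (\<Prod>p\<in>P. \<kappa> p)"
    "\<And>p. p \<in> P \<Longrightarrow> G' z p \<bullet> p = norm (G z) * \<kappa> p"
    "\<And>q. G z \<bullet> q = 0 \<Longrightarrow> G' z q \<bullet> q = norm (G z) * (\<Sum>p\<in>P. \<kappa> p * (p \<bullet> q)\<^sup>2)"
    by (rule gauss_curvatureE[OF assms(1)]) blast
  note F = P(1)[unfolded orthonormal_frame_def]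
  have nG: "norm (G z) > 0" using G_nonzero[OF z0] by simp
  have pos: "\<kappa> p > 0" if "p \<in> P" for p
  proof -
    have "norm (G z) * \<kappa> p \<ge> 0" using n P(3)[OF that] F that by force
    then have "\<kappa> p \<ge> 0" using nG by (simp add: zero_le_mult_iff)
    moreover have "\<kappa> p \<noteq> 0" using assms(2) P(2) F that by (metis less_irrefl prod_zero)
    ultimately show ?thesis by simp
  qed
  have "G' z q \<bullet> q > 0" if q: "q \<noteq> 0" "G z \<bullet> q = 0" for q
  proof -
    have "(norm q)\<^sup>2 \<noteq> 0" using q(1) by simp
    then have "(\<Sum>p\<in>P. (p \<bullet> q)\<^sup>2) \<noteq> 0" using F q(2) by simp
    then obtain p where p: "p \<in> P" "(p \<bullet> q)\<^sup>2 \<noteq> 0" by (meson sum.neutral)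
    have "(\<Sum>p\<in>P. \<kappa> p * (p \<bullet> q)\<^sup>2) > 0"
    proof (rule sum_pos2[OF _ p(1)])
      show "finite P" using F by simp
      show "0 < \<kappa> p * (p \<bullet> q)\<^sup>2" using pos[OF p(1)] p(2) by simp
      show "0 \<le> \<kappa> i * (i \<bullet> q)\<^sup>2" if "i \<in> P" for i using pos[OF that] by simp
    qed
    then show ?thesis using P(4)[OF q(2)] nG by simp
  qed
  then show False using assms(3) by (simp add: positive_at_def)
qed

text \<open>The set of points with positive definite second fundamental form contains the farthest point
  and is open; it is closed since a degenerate form has zero curvature.\<close>

lemma positive_at_graph:
  assumes "DIM('b) \<ge> 2"
    and K: "\<And>z. z \<in> graph \<Longrightarrow> has_gauss_curvature graph z (k z)" "\<And>z. z \<in> graph \<Longrightarrow> k z > 0"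
    and "z \<in> graph"
  shows "positive_at z"
proof -
  define A where "A = {z \<in> graph. positive_at z}"
  have nz: "z \<noteq> 0" if "z \<in> graph" for z using that by (simp add: graph_def)
  have clg: "closed graph" using compact_graph compact_imp_closed by blast
  have "closed (graph - A)"
  proof -
    define C where "C = graph \<times> sphere (0::'b) 1"
    have C: "compact C" "C \<subseteq> (- {0}) \<times> UNIV"
      using nz by (auto simp: C_def intro!: compact_Times compact_graph)
    have c1: "continuous_on C (\<lambda>x. G (fst x) \<bullet> snd x)"
      by (intro continuous_intros continuous_on_compose2[OF continuous_on_G] ) (use C(2) in auto)
    have c2: "continuous_on C (\<lambda>(z, q). G' z q \<bullet> q)"
      using continuous_on_subset[OF continuous_on_second_form C(2)] .
    \<comment> \<open>The unit tangent vectors on which the form is not positive. The complement of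
      \<open>A\<close> is the projection of this compact set, hence closed.\<close>
    define D where "D = (C \<inter> (\<lambda>x. G (fst x) \<bullet> snd x) -` {0}) \<inter> (C \<inter> (\<lambda>(z, q). G' z q \<bullet> q) -` {..0})"
    have "closed D" unfolding D_def
      by (intro closed_Int continuous_closed_preimage c1 c2 compact_imp_closed[OF C(1)]) auto
    moreover have "D \<subseteq> C" by (auto simp: D_def)
    ultimately have "compact D" using C(1) by (metis compact_Int_closed Int_absorb1)
    then have "compact (fst ` D)" by (intro compact_continuous_image continuous_on_fst continuous_on_id)
    moreover have "fst ` D = graph - A"
    proof (intro equalityI subsetI)
      fix z assume "z \<in> fst ` D"
      then obtain q where q: "z \<in> graph" "norm q = 1" "G z \<bullet> q = 0" "G' z q \<bullet> q \<le> 0"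
        by (auto simp: D_def C_def)
      then have "q \<noteq> 0" by auto
      then have "\<not> positive_at z" using q unfolding positive_at_def by (meson not_less)
      then show "z \<in> graph - A" using q(1) by (simp add: A_def)
    next
      fix z assume "z \<in> graph - A"
      then obtain q where q: "z \<in> graph" "q \<noteq> 0" "G z \<bullet> q = 0" "G' z q \<bullet> q \<le> 0"
        by (force simp: A_def positive_at_def)
      define p where "p = (1 / norm q) *\<^sub>R q"
      have "G' z p \<bullet> p = (1 / norm q)\<^sup>2 * (G' z q \<bullet> q)"
        using linear_cmul[OF linear_G'[OF nz[OF q(1)]]] by (simp add: p_def power2_eq_square)
      then have "(z, p) \<in> D"
        using q by (simp add: D_def C_def p_def mult_nonneg_nonpos)
      then show "z \<in> fst ` D" by force
    qed
    ultimately show ?thesis using compact_imp_closed by auto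
  qed
  then have "openin (top_of_set graph) (graph \<inter> - (graph - A))"
    by (intro openin_open_Int open_Compl)
  moreover have "graph \<inter> - (graph - A) = A" by (auto simp: A_def)
  ultimately have "openin (top_of_set graph) A" by simp
  moreover have "closedin (top_of_set graph) A"
  proof -
    have "openin (top_of_set graph) (graph - A)"
    proof (subst openin_subopen, intro ballI)
      fix z assume z: "z \<in> graph - A"
      then obtain q where q: "G z \<bullet> q = 0" "G' z q \<bullet> q < 0"
        using not_positive_atD K by (force simp: A_def)
      \<comment> \<open>The projection of the fixed vector \<open>q\<close> to the tangent
        hyperplane at \<open>y\<close>. It varies continuously and equals \<open>q\<close> at
        \<open>z\<close>, so the form stays negative on it for \<open>y\<close> near
        \<open>z\<close>.\<close>
      define r where "r y = q - ((G y \<bullet> q) / (G y \<bullet> G y)) *\<^sub>R G y" for y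
      define T where "T = graph \<inter> (\<lambda>y. G' y (r y) \<bullet> r y) -` {..<0}"
      have Gr: "G y \<bullet> r y = 0" if "y \<in> graph" for y
        using G_nonzero[OF nz[OF that]] by (simp add: r_def inner_diff_right)
      have cG: "continuous_on graph G"
        by (rule continuous_on_subset[OF continuous_on_G]) (use nz in auto)
      have "continuous_on graph r" unfolding r_def
        by (intro continuous_intros cG) (use G_nonzero nz in auto)
      then have "continuous_on graph (\<lambda>y. (y, r y))" by (intro continuous_intros)
      from continuous_on_compose2[OF continuous_on_second_form this]
      have "continuous_on graph (\<lambda>y. G' y (r y) \<bullet> r y)" using nz by auto
      then have "openin (top_of_set graph) T"
        unfolding T_def by (intro continuous_openin_preimage_gen) auto
      moreover have "r z = q" using q by (simp add: r_def)
      then have "z \<in> T" using z q by (simp add: T_def)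
      moreover have "T \<subseteq> graph - A"
      proof
        fix y assume y: "y \<in> T"
        then have "r y \<noteq> 0" using linear_0[OF linear_G'[OF nz]] by (auto simp: T_def)
        then show "y \<in> graph - A" using y Gr[of y] by (auto simp: T_def A_def positive_at_def)
      qed
      ultimately show "\<exists>T. openin (top_of_set graph) T \<and> z \<in> T \<and> T \<subseteq> graph - A" by blast
    qed
    then show ?thesis by (simp add: closedin_def A_def)
  qed
  moreover have "A \<noteq> {}"
    using farthest_point positive_at_farthest nz unfolding A_def by (metis (mono_tags, lifting) empty_iff mem_Collect_eq)
  ultimately have "A = graph" using connected_graph[OF assms(1)] unfolding connected_clopen by blast
  then show ?thesis using assms(4) by (auto simp: A_def)
qed

lemma curvature_at_farthest:
  assumes "z \<in> graph" "\<And>y. y \<noteq> 0 \<Longrightarrow> v y \<le> v z" "has_gauss_curvature graph z k"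
  shows "k \<ge> (1 / norm z) ^ (DIM('b) - 1)"
proof -
  have z0: "z \<noteq> 0" using assms(1) by (simp add: graph_def)
  note f = at_farthest_point[OF z0 assms(2)]
  have nG: "norm (G z) = 1 / norm z" by (rule norm_G_critical[OF z0 f(1)])
  obtain P \<kappa> where P: "orthonormal_frame z P" "k = (\<Prod>p\<in>P. \<kappa> p)"
    "\<And>p. p \<in> P \<Longrightarrow> G' z p \<bullet> p = norm (G z) * \<kappa> p"
    "\<And>q. G z \<bullet> q = 0 \<Longrightarrow> G' z q \<bullet> q = norm (G z) * (\<Sum>p\<in>P. \<kappa> p * (p \<bullet> q)\<^sup>2)"
    by (rule gauss_curvatureE[OF assms(3)]) blast
  note F = P(1)[unfolded orthonormal_frame_def]
  have "1 / norm z \<le> \<kappa> p" if "p \<in> P" for p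
  proof -
    have "z \<bullet> p = 0" using F that f(1) z0 by (simp add: G_def)
    from G'_radial_tangent[OF this] have "(1 / norm z) * \<kappa> p = 1 / (norm z)\<^sup>2 - hess z p \<bullet> p"
      using P(3)[OF that] F that nG by simp
    also have "\<dots> \<ge> (1 / norm z) * (1 / norm z)" using f(2)[of p] by (simp add: power2_eq_square)
    finally show ?thesis using z0 by (simp add: divide_right_mono field_simps)
  qed
  then have "(\<Prod>p\<in>P. 1 / norm z) \<le> (\<Prod>p\<in>P. \<kappa> p)" by (intro prod_mono) auto
  then show ?thesis using P(2) F by simp
qed

text \<open>The nonnegative Hessian of \<open>v\<close> bounds each principal curvature from above
  by that of the sphere. Positivity is what allows these bounds to be multiplied.\<close>

lemma curvature_at_nearest:
  assumes "z \<in> graph" "\<And>y. y \<noteq> 0 \<Longrightarrow> v z \<le> v y" "has_gauss_curvature graph z k" "positive_at z"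
  shows "k \<le> (1 / norm z) ^ (DIM('b) - 1)"
proof -
  have z0: "z \<noteq> 0" using assms(1) by (simp add: graph_def)
  note f = at_nearest_point[OF z0 assms(2)]
  have nG: "norm (G z) = 1 / norm z" by (rule norm_G_critical[OF z0 f(1)])
  obtain P \<kappa> where P: "orthonormal_frame z P" "k = (\<Prod>p\<in>P. \<kappa> p)"
    "\<And>p. p \<in> P \<Longrightarrow> G' z p \<bullet> p = norm (G z) * \<kappa> p"
    "\<And>q. G z \<bullet> q = 0 \<Longrightarrow> G' z q \<bullet> q = norm (G z) * (\<Sum>p\<in>P. \<kappa> p * (p \<bullet> q)\<^sup>2)"
    by (rule gauss_curvatureE[OF assms(3)]) blast
  note F = P(1)[unfolded orthonormal_frame_def]
  have "0 \<le> \<kappa> p \<and> \<kappa> p \<le> 1 / norm z" if "p \<in> P" for p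
  proof -
    have "z \<bullet> p = 0" using F that f(1) z0 by (simp add: G_def)
    from G'_radial_tangent[OF this] have *: "(1 / norm z) * \<kappa> p = 1 / (norm z)\<^sup>2 - hess z p \<bullet> p"
      using P(3)[OF that] F that nG by simp
    also have "\<dots> \<le> (1 / norm z) * (1 / norm z)" using f(2)[of p] by (simp add: power2_eq_square)
    finally have "\<kappa> p \<le> 1 / norm z" using z0 by (simp add: divide_right_mono field_simps)
    moreover have "p \<noteq> 0" using F that by auto
    then have "norm (G z) * \<kappa> p > 0" using P(3)[OF that] F that assms(4) unfolding positive_at_def by metis
    then have "\<kappa> p \<ge> 0" by (simp add: zero_less_mult_iff)
    ultimately show ?thesis by simp
  qed
  then have "(\<Prod>p\<in>P. \<kappa> p) \<le> (\<Prod>p\<in>P. 1 / norm z)" by (intro prod_mono) auto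
  then show ?thesis using P(2) F by simp
qed

end

section \<open>Rigidity when the curvature is that of the sphere through each point\<close>

context star_graph
begin

lemma G_homog:
  assumes "z \<noteq> 0" "s > 0" shows "s *\<^sub>R G (s *\<^sub>R z) = G z"
proof -
  have "s * (1 / (norm (s *\<^sub>R z))\<^sup>2 * s) = 1 / (norm z)\<^sup>2"
    using assms by (simp add: power_mult_distrib power2_eq_square)
  then show ?thesis using grad_homog[OF assms] by (simp add: G_def scaleR_diff_right)
qed

text \<open>By the inequality between the arithmetic and the geometric mean the mean curvature of the graph
  is at least that of the sphere through the same point.\<close>

lemma hess_trace_nonpos_graph:
  assumes "DIM('b) \<ge> 2" "z \<in> graph" "has_gauss_curvature graph z ((1 / norm z) ^ (DIM('b) - 1))" "positive_at z"
  obtains P where "orthonormal_frame z P" "(\<Sum>p\<in>P. hess z p \<bullet> p) \<le> 0"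
proof -
  have z0: "z \<noteq> 0" using assms(2) by (simp add: graph_def)
  obtain P \<kappa> where P: "orthonormal_frame z P" "(1 / norm z) ^ (DIM('b) - 1) = (\<Prod>p\<in>P. \<kappa> p)"
    "\<And>p. p \<in> P \<Longrightarrow> G' z p \<bullet> p = norm (G z) * \<kappa> p"
    by (rule gauss_curvatureE[OF assms(3)]) blast
  note F = P(1)[unfolded orthonormal_frame_def]
  define n where "n = card P"
  have n: "n > 0" "finite P" "P \<noteq> {}" "(1 / norm z) ^ n = (\<Prod>p\<in>P. \<kappa> p)"
    using F assms(1) P(2) by (auto simp: n_def)
  have pos: "\<kappa> p \<ge> 0" if "p \<in> P" for p
  proof -
    have "p \<noteq> 0" using F that by auto
    then have "norm (G z) * \<kappa> p > 0" using P(3)[OF that] F that assms(4) unfolding positive_at_def by metis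
    then show ?thesis by (simp add: zero_less_mult_iff)
  qed
  have "1 / norm z = ((1 / norm z) ^ n) powr (1 / n)"
    using z0 n(1) by (simp add: powr_realpow[symmetric] powr_powr)
  also have "\<dots> \<le> (\<Sum>p\<in>P. \<kappa> p / n)"
    using arith_geom_mean[OF n(2,3) pos] n(4) by (simp add: n_def)
  finally have "1 / norm z \<le> (\<Sum>p\<in>P. \<kappa> p) / n" by (simp add: sum_divide_distrib)
  then have mean: "n / norm z \<le> (\<Sum>p\<in>P. \<kappa> p)" using n(1) by (simp add: field_simps)
  \<comment> \<open>The tangent space may be tilted against the sphere through \<open>z\<close>. The
    tilt enters through \<open>z \<bullet> p\<close> here and through
    \<open>norm (G z) \<ge> 1 / norm z\<close> in the sum below, both times with the favourable
    sign.\<close>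
  have "hess z p \<bullet> p \<le> 1 / (norm z)\<^sup>2 - norm (G z) * \<kappa> p" if "p \<in> P" for p
  proof -
    have "norm p = 1" using F that by blast
    then have "norm (G z) * \<kappa> p = 1 / (norm z)\<^sup>2 - 2 * (z \<bullet> p)\<^sup>2 / norm z ^ 4 - hess z p \<bullet> p"
      using P(3)[OF that, symmetric]
      by (simp add: G'_def inner_diff_left power2_norm_eq_inner[symmetric] power2_eq_square mult.assoc)
    moreover have "2 * (z \<bullet> p)\<^sup>2 / norm z ^ 4 \<ge> 0" by simp
    ultimately show ?thesis by linarith
  qed
  then have "(\<Sum>p\<in>P. hess z p \<bullet> p) \<le> (\<Sum>p\<in>P. 1 / (norm z)\<^sup>2 - norm (G z) * \<kappa> p)" by (rule sum_mono)
  also have "\<dots> = n / (norm z)\<^sup>2 - norm (G z) * (\<Sum>p\<in>P. \<kappa> p)"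
    by (simp add: sum_subtractf n_def sum_distrib_left)
  also have "\<dots> \<le> n / (norm z)\<^sup>2 - (1 / norm z) * (n / norm z)"
    by (intro diff_left_mono mult_mono mean norm_G_ge[OF z0]) auto
  also have "\<dots> = 0" by (simp add: power2_eq_square)
  finally show ?thesis using that[OF P(1)] by blast
qed

text \<open>Along a ray \<open>G\<close> and the Hessian change only by positive factors, so the
  frame found on the graph serves at every point of the ray and the sign of the trace is kept. The
  minimum principle needs the inequality on an open set.\<close>

lemma hess_trace_nonpos:
  assumes "DIM('b) \<ge> 2"
    and K: "\<And>z. z \<in> graph \<Longrightarrow> has_gauss_curvature graph z ((1 / norm z) ^ (DIM('b) - 1))"
    and z: "z \<noteq> 0"
  obtains P where "orthonormal_frame z P" "(\<Sum>p\<in>P. hess z p \<bullet> p) \<le> 0"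
proof -
  obtain s where s: "s > 0" "s *\<^sub>R z \<in> graph" using graph_scaled_exists[OF z] .
  have "positive_at (s *\<^sub>R z)"
    by (rule positive_at_graph[OF assms(1) K _ s(2)]) (auto simp: graph_def)
  then obtain P where P: "orthonormal_frame (s *\<^sub>R z) P" "(\<Sum>p\<in>P. hess (s *\<^sub>R z) p \<bullet> p) \<le> 0"
    using hess_trace_nonpos_graph[OF assms(1) s(2) K[OF s(2)]] by blast
  have G: "G (s *\<^sub>R z) \<bullet> q = 0 \<longleftrightarrow> G z \<bullet> q = 0" for q
    using G_homog[OF z s(1), symmetric] s(1) by simp
  have "hess z p \<bullet> p = s\<^sup>2 * (hess (s *\<^sub>R z) p \<bullet> p)" for p
    using hess_homog[OF z s(1), of p, symmetric] by simp
  then have "(\<Sum>p\<in>P. hess z p \<bullet> p) = s\<^sup>2 * (\<Sum>p\<in>P. hess (s *\<^sub>R z) p \<bullet> p)"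
    by (simp add: sum_distrib_left)
  also have "\<dots> \<le> 0" using P(2) by (simp add: mult_nonneg_nonpos)
  finally show ?thesis using that[of P] P(1) unfolding orthonormal_frame_def G by blast
qed

text \<open>The frame \<open>P\<close> controls the tangential part \<open>w'\<close> of
  \<open>w\<close> by Parseval's identity. The normal component \<open>a\<close> is recovered from
  \<open>z \<bullet> w\<close>, because the unit normal \<open>n\<close> satisfies
  \<open>z \<bullet> n = 1 / norm (G z)\<close>. The constant depends only on bounds for
  \<open>norm (G z)\<close> and \<open>norm z\<close>, so it is uniform on small balls.\<close>

lemma ellipticity:
  assumes z: "z \<noteq> 0" and "norm (G z) \<le> M" "norm z \<le> C"
    and frame: "orthonormal_frame z P"
  shows "(norm w)\<^sup>2 \<le> (2 * M\<^sup>2 + 2 * M\<^sup>2 * C\<^sup>2 + 1) * (\<Sum>p\<in>insert z P. (p \<bullet> w)\<^sup>2)"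
proof -
  have P: "finite P" "\<And>p. p \<in> P \<Longrightarrow> G z \<bullet> p = 0"
      "\<And>q. G z \<bullet> q = 0 \<Longrightarrow> (norm q)\<^sup>2 = (\<Sum>p\<in>P. (p \<bullet> q)\<^sup>2)"
    using frame by (auto simp: orthonormal_frame_def)
  define n where "n = (1 / norm (G z)) *\<^sub>R G z"
  define a where "a = n \<bullet> w"
  define w' where "w' = w - a *\<^sub>R n"
  have nG: "norm (G z) > 0" using G_nonzero[OF z] by simp
  have nn: "n \<bullet> n = 1" using nG by (simp add: n_def power2_norm_eq_inner[symmetric] power2_eq_square)
  have "n \<bullet> w' = 0" using nn by (simp add: w'_def a_def inner_diff_right)
  then have Gw': "G z \<bullet> w' = 0" using nG by (simp add: n_def)
  have w: "w = w' + a *\<^sub>R n" by (simp add: w'_def)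
  have nw: "(norm w)\<^sup>2 = (norm w')\<^sup>2 + a\<^sup>2"
    unfolding w power2_norm_eq_inner using \<open>n \<bullet> w' = 0\<close> nn
    by (simp add: inner_add_left inner_add_right inner_commute power2_eq_square)
  have pw: "p \<bullet> w = p \<bullet> w'" if "p \<in> P" for p
    using P(2)[OF that] by (simp add: w inner_add_right n_def inner_commute)
  have zn: "z \<bullet> n = 1 / norm (G z)" using G_radial[OF z] by (simp add: n_def inner_commute)
  have "z \<bullet> w = z \<bullet> w' + a / norm (G z)" by (simp add: w inner_add_right zn)
  then have "a = norm (G z) * (z \<bullet> w - z \<bullet> w')" using nG by (simp add: field_simps)
  then have "a\<^sup>2 = (norm (G z))\<^sup>2 * (z \<bullet> w - z \<bullet> w')\<^sup>2" by (simp add: power_mult_distrib)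
  also have "\<dots> \<le> M\<^sup>2 * (2 * (z \<bullet> w)\<^sup>2 + 2 * (C\<^sup>2 * (norm w')\<^sup>2))"
  proof (intro mult_mono power_mono assms(2))
    have "(z \<bullet> w')\<^sup>2 \<le> (norm z)\<^sup>2 * (norm w')\<^sup>2"
      using Cauchy_Schwarz_ineq[of z w'] by (simp add: power2_norm_eq_inner)
    also have "\<dots> \<le> C\<^sup>2 * (norm w')\<^sup>2" using assms(3) by (intro mult_right_mono power_mono) auto
    finally have 1: "(z \<bullet> w')\<^sup>2 \<le> C\<^sup>2 * (norm w')\<^sup>2" .
    have "(z \<bullet> w - z \<bullet> w')\<^sup>2 \<le> 2 * (z \<bullet> w)\<^sup>2 + 2 * (z \<bullet> w')\<^sup>2"
      using zero_le_power2[of "z \<bullet> w + z \<bullet> w'"] by (simp add: power2_sum power2_diff)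
    with 1 show "(z \<bullet> w - z \<bullet> w')\<^sup>2 \<le> 2 * (z \<bullet> w)\<^sup>2 + 2 * (C\<^sup>2 * (norm w')\<^sup>2)" by linarith
  qed auto
  finally have "(norm w)\<^sup>2 \<le> (2 * M\<^sup>2) * (z \<bullet> w)\<^sup>2 + (2 * M\<^sup>2 * C\<^sup>2 + 1) * (norm w')\<^sup>2"
    by (simp add: nw algebra_simps)
  also have "\<dots> \<le> (2 * M\<^sup>2 + 2 * M\<^sup>2 * C\<^sup>2 + 1) * (z \<bullet> w)\<^sup>2 + (2 * M\<^sup>2 + 2 * M\<^sup>2 * C\<^sup>2 + 1) * (norm w')\<^sup>2"
    by (intro add_mono mult_right_mono) auto
  also have "\<dots> = (2 * M\<^sup>2 + 2 * M\<^sup>2 * C\<^sup>2 + 1) * ((z \<bullet> w)\<^sup>2 + (\<Sum>p\<in>P. (p \<bullet> w)\<^sup>2))"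
    using P(3)[OF Gw'] pw by (simp add: distrib_left)
  also have "(z \<bullet> w)\<^sup>2 + (\<Sum>p\<in>P. (p \<bullet> w)\<^sup>2) = (\<Sum>p\<in>insert z P. (p \<bullet> w)\<^sup>2)"
    using P(1) P(2)[of z] G_radial[OF z] by (subst sum.insert) auto
  finally show ?thesis .
qed

theorem constant_if_curvature_homogeneous:
  assumes "DIM('b) \<ge> 2"
    and K: "\<And>z. z \<in> graph \<Longrightarrow> has_gauss_curvature graph z ((1 / norm z) ^ (DIM('b) - 1))"
    and "y \<noteq> 0" "z \<noteq> 0"
  shows "v y = v z"
proof -
  obtain z0 where z0: "z0 \<in> graph" "\<And>y. y \<noteq> 0 \<Longrightarrow> v z0 \<le> v y" using nearest_point by blast
  define A where "A = {y \<in> - {0}. v y = v z0}"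
  have cv: "continuous_on (- {0}) v" using smooth_onD(3)[OF smooth_v] .
  have "closedin (top_of_set (- {0})) A"
    unfolding A_def by (rule continuous_closedin_preimage_constant[OF cv])
  moreover have "openin (top_of_set (- {0})) A"
  proof -
    have "\<exists>r>0. ball x0 r \<subseteq> A" if x0: "x0 \<in> A" for x0
    proof -
      \<comment> \<open>The closed ball of this radius avoids the origin, so \<open>G\<close> is
        bounded on it.\<close>
      define r where "r = norm x0 / 2"
      have r: "r > 0" using x0 by (auto simp: r_def A_def)
      have nz: "x \<noteq> 0" if "x \<in> cball x0 r" for x
        using that r by (auto simp: r_def)
      have "continuous_on (cball x0 r) G" by (rule continuous_on_subset[OF continuous_on_G]) (use nz in blast)
      then have "bounded (G ` cball x0 r)" by (intro compact_imp_bounded compact_continuous_image) auto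
      then obtain M where M: "\<And>x. x \<in> cball x0 r \<Longrightarrow> norm (G x) \<le> M"
        unfolding bounded_iff by blast
      define C where "C = norm x0 + r"
      have C: "norm x \<le> C" if "x \<in> ball x0 r" for x
        using that norm_triangle_sub[of x x0] by (simp add: C_def dist_norm norm_minus_commute)
      define L where "L = 2 * M\<^sup>2 + 2 * M\<^sup>2 * C\<^sup>2 + 1"
      have L: "L > 0" by (simp add: L_def add_nonneg_pos)
      have "v q = v z0" if "q \<in> ball x0 (r / 2)" for q
      proof -
        \<comment> \<open>The vectors used at \<open>x\<close> are \<open>insert x P\<close>. Their
          squared lengths are bounded by \<open>C\<^sup>2\<close> for \<open>x\<close> and by 1 for
          each of the \<open>DIM('b) - 1\<close> frame vectors, and \<open>1 / L\<close> is the
          ellipticity constant.\<close>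
        have "v q = v x0"
        proof (rule strong_minimum_principle_local[where \<phi> = v and g = "grad v" and g' = hess and r = r
              and l = "1 / L" and C = "C\<^sup>2 + (DIM('b) - 1)"])
          fix x assume x: "x \<in> ball x0 r"
          have xz: "x \<noteq> 0" using nz[OF subsetD[OF ball_subset_cball x]] by blast
          show "(v has_derivative (\<lambda>w. grad v x \<bullet> w)) (at x)" using v_deriv[OF xz] .
          show "(grad v has_derivative hess x) (at x)" using grad_deriv[OF xz] .
          show "v x0 \<le> v x" using z0(2)[OF xz] x0 by (simp add: A_def)
          obtain P where P: "orthonormal_frame x P" "(\<Sum>p\<in>P. hess x p \<bullet> p) \<le> 0"
            using hess_trace_nonpos[OF assms(1) K xz] by blast
          note F = P(1)[unfolded orthonormal_frame_def]
          have xP: "x \<notin> P" using F G_radial[OF xz] by auto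
          \<comment> \<open>The radial summand is 0 by \<open>hess_radial\<close>. The trace is then
            nonpositive, so the bound by the gradient holds trivially.\<close>
          have 1: "(\<Sum>p\<in>insert x P. hess x p \<bullet> p) \<le> (C\<^sup>2 + (DIM('b) - 1)) * norm (grad v x)"
          proof -
            have "(\<Sum>p\<in>insert x P. hess x p \<bullet> p) \<le> 0" using P(2) F xP hess_radial[OF xz] by simp
            also have "\<dots> \<le> (C\<^sup>2 + (DIM('b) - 1)) * norm (grad v x)" by simp
            finally show ?thesis .
          qed
          have "(\<Sum>p\<in>P. (norm p)\<^sup>2) = DIM('b) - 1" using F by simp
          moreover have "(norm x)\<^sup>2 \<le> C\<^sup>2" using C[OF x] by (intro power_mono) auto
          ultimately have 2: "(\<Sum>p\<in>insert x P. (norm p)\<^sup>2) \<le> C\<^sup>2 + (DIM('b) - 1)"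
            using F xP by simp
          have "(norm w)\<^sup>2 \<le> L * (\<Sum>p\<in>insert x P. (p \<bullet> w)\<^sup>2)" for w
            unfolding L_def by (rule ellipticity[OF xz M C[OF x] P(1)]) (use x in auto)
          then have "1 / L * (norm w)\<^sup>2 \<le> (\<Sum>p\<in>insert x P. (p \<bullet> w)\<^sup>2)" for w
            using L by (simp add: divide_le_eq mult.commute)
          with 1 2 show "\<exists>P. finite P \<and> (\<Sum>p\<in>P. hess x p \<bullet> p) \<le> (C\<^sup>2 + (DIM('b) - 1)) * norm (grad v x) \<and>
            (\<Sum>p\<in>P. (norm p)\<^sup>2) \<le> C\<^sup>2 + (DIM('b) - 1) \<and> (\<forall>w. 1 / L * (norm w)\<^sup>2 \<le> (\<Sum>p\<in>P. (p \<bullet> w)\<^sup>2))"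
            using F by (intro exI[of _ "insert x P"]) simp
        qed (use that L in auto)
        then show ?thesis using x0 by (simp add: A_def)
      qed
      moreover have "q \<noteq> 0" if "q \<in> ball x0 (r / 2)" for q using that nz[of q] r by auto
      ultimately have "ball x0 (r / 2) \<subseteq> A" using x0 unfolding A_def by (intro subsetI) blast
      then show ?thesis using r by (metis half_gt_zero)
    qed
    then have "open A" unfolding open_contains_ball by blast
    then show ?thesis unfolding openin_open_eq[OF open_punctured] by (auto simp: A_def)
  qed
  moreover have "z0 \<in> A" using z0(1) by (simp add: A_def graph_def)
  \<comment> \<open>Removing a point leaves the space connected because its dimension is at least
    2.\<close>
  moreover have "connected (- {0::'b})" by (rule connected_punctured_universe[OF assms(1)])
  ultimately have "A = - {0}" unfolding connected_clopen by blast
  then have "y \<in> A" "z \<in> A" using assms by auto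
  then show ?thesis by (simp add: A_def)
qed

end

section \<open>Round spheres\<close>

lemma star_graph_const: "star_graph (\<lambda>z::'b::euclidean_space. c)"
  by (simp add: star_graph_def)

lemma graph_const:
  assumes "r > 0" shows "star_graph.graph (\<lambda>z::'b::euclidean_space. ln r) = sphere 0 r"
  using assms by (auto simp: star_graph.graph_def[OF star_graph_const])

lemma tangent_vectors_sphere:
  fixes z :: "'b::euclidean_space"
  assumes "norm z = r" "r > 0"
  shows "tangent_vectors (sphere 0 r) z = {w. z \<bullet> w = 0}"
proof -
  interpret star_graph "\<lambda>z::'b. ln r" by (rule star_graph_const)
  have "grad (\<lambda>z::'b. ln r) z = 0" by (simp add: grad_def frechet_derivative_const)
  then show ?thesis
    using tangent_vectors_graph[of z] assms by (auto simp: graph_const G_def)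
qed

text \<open>The normal field \<open>z / r\<close> is linear, hence its own derivative, and every
  orthonormal basis of the tangent hyperplane consists of principal directions.\<close>

lemma has_gauss_curvature_sphere:
  fixes z :: "'b::euclidean_space"
  assumes "norm z = r" "r > 0"
  shows "has_gauss_curvature (sphere 0 r) z ((1 / r) ^ (DIM('b) - 1))"
proof -
  have z0: "z \<noteq> 0" using assms by auto
  define N where "N z = (1 / r) *\<^sub>R z" for z :: 'b
  have bl: "bounded_linear N" unfolding N_def by (rule bounded_linear_scaleR_right)
  obtain P where P: "pairwise orthogonal P" "\<And>p. p \<in> P \<Longrightarrow> norm p = 1"
     "card P = dim {w. z \<bullet> w = 0}" "span P = {w. z \<bullet> w = 0}"
    using orthonormal_basis_subspace[OF subspace_hyperplane[of z]] by metis
  have "outward_normal_field (sphere 0 r) UNIV N"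
    unfolding outward_normal_field_def
  proof (intro conjI ballI)
    show "smooth_on UNIV N" by (rule smooth_on_bounded_linear[OF bl])
    fix y :: 'b assume "y \<in> sphere 0 r \<inter> UNIV"
    then have y: "norm y = r" by simp
    show "norm (N y) = 1" "N y \<bullet> y > 0"
      using y assms(2) by (auto simp: N_def power2_norm_eq_inner[symmetric])
    fix w assume "w \<in> tangent_vectors (sphere 0 r) y"
    then show "N y \<bullet> w = 0" using tangent_vectors_sphere[OF y assms(2)] by (auto simp: N_def)
  qed simp
  moreover have "(N has_derivative N) (at z)" using bl by (rule bounded_linear_imp_has_derivative)
  moreover have "(1 / r) ^ (DIM('b) - 1) = (\<Prod>p\<in>P. 1 / r)"
    using P(3) dim_hyperplane[OF z0] by simp
  ultimately show ?thesis
    unfolding has_gauss_curvature_def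
    using P(1,2,4) tangent_vectors_sphere[OF assms] assms
    by (intro conjI exI[of _ UNIV] exI[of _ N] exI[of _ P] exI[of _ "\<lambda>_. 1 / r"]) (auto simp: N_def)
qed

section \<open>Coordinates on Riemannian vector bundles\<close>

lemma bilinear_expansion:
  fixes \<beta> :: "'b::euclidean_space \<Rightarrow> 'c::euclidean_space \<Rightarrow> 'w::real_vector"
  assumes "bilinear \<beta>"
  shows "\<beta> y z = (\<Sum>i\<in>Basis. \<Sum>j\<in>Basis. ((y \<bullet> i) * (z \<bullet> j)) *\<^sub>R \<beta> i j)"
proof -
  have l: "linear (\<beta> y)" "linear (\<lambda>y. \<beta> y z)" for y z using assms by (auto simp: bilinear_def)
  have "\<beta> y z = (\<Sum>i\<in>Basis. (y \<bullet> i) *\<^sub>R \<beta> i z)" using linear_basis_expansion[OF l(2)] .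
  also have "\<dots> = (\<Sum>i\<in>Basis. (y \<bullet> i) *\<^sub>R (\<Sum>j\<in>Basis. (z \<bullet> j) *\<^sub>R \<beta> i j))"
    by (intro sum.cong refl arg_cong[where f = "\<lambda>a. _ *\<^sub>R a"] linear_basis_expansion[OF l(1)])
  finally show ?thesis by (simp add: scaleR_sum_right)
qed

text \<open>The coefficients of metrics and connections are given as smooth in the base point for
  fixed vectors. Expansion in bases allows the vectors to vary smoothly too.\<close>

lemma smooth_on_bilinear_family:
  fixes \<beta> :: "'a::euclidean_space \<Rightarrow> 'b::euclidean_space \<Rightarrow> 'c::euclidean_space \<Rightarrow> 'w::real_normed_vector"
  assumes "open S" "open T"
    and \<beta>: "\<And>y z. smooth_on T (\<lambda>x. \<beta> x y z)" "\<And>x. x \<in> T \<Longrightarrow> bilinear (\<beta> x)"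
    and f: "smooth_on S X" "smooth_on S Y" "smooth_on S Z" "\<And>s. s \<in> S \<Longrightarrow> X s \<in> T"
  shows "smooth_on S (\<lambda>s. \<beta> (X s) (Y s) (Z s))"
proof -
  have "smooth_on S (\<lambda>s. \<beta> (X s) i j)" for i j
    by (rule smooth_on_compose[OF \<beta>(1) f(1) assms(1,2) f(4)])
  then have "smooth_on S (\<lambda>s. \<Sum>i\<in>Basis. \<Sum>j\<in>Basis. ((Y s \<bullet> i) * (Z s \<bullet> j)) *\<^sub>R \<beta> (X s) i j)"
    by (intro smooth_on_sum smooth_on_scaleR smooth_on_mult smooth_on_inner f smooth_on_const assms(1) finite_Basis)
  then show ?thesis
    by (rule smooth_on_cong[OF _ assms(1)]) (rule bilinear_expansion[OF \<beta>(2)[OF f(4)], symmetric])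
qed

text \<open>A product rule whose first term keeps both vectors frozen; this is the derivative that
  occurs in the compatibility of metric and connection.\<close>

lemma has_derivative_bilinear_family:
  fixes \<beta> :: "'a::euclidean_space \<Rightarrow> 'b::euclidean_space \<Rightarrow> 'c::euclidean_space \<Rightarrow> 'w::real_normed_vector"
  assumes "open T" "X s \<in> T"
    and \<beta>: "\<And>y z. smooth_on T (\<lambda>x. \<beta> x y z)" "\<And>x. x \<in> T \<Longrightarrow> bilinear (\<beta> x)"
    and f: "(X has_derivative X') (at s)" "(Y has_derivative Y') (at s)" "(Z has_derivative Z') (at s)"
  shows "((\<lambda>s. \<beta> (X s) (Y s) (Z s)) has_derivative
     (\<lambda>h. frechet_derivative (\<lambda>x. \<beta> x (Y s) (Z s)) (at (X s)) (X' h) + \<beta> (X s) (Y' h) (Z s) + \<beta> (X s) (Y s) (Z' h))) (at s)"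
proof -
  define d where "d y z = frechet_derivative (\<lambda>x. \<beta> x y z) (at (X s))" for y z
  have d: "((\<lambda>x. \<beta> x y z) has_derivative d y z) (at (X s))" for y z
    unfolding d_def using smooth_onD(2)[OF \<beta>(1) assms(2)] .
  have dX: "((\<lambda>s. \<beta> (X s) y z) has_derivative (\<lambda>h. d y z (X' h))) (at s)" for y z
    using has_derivative_compose[OF f(1) d] .
  have E: "((\<lambda>s. \<Sum>i\<in>Basis. \<Sum>j\<in>Basis. ((Y s \<bullet> i) * (Z s \<bullet> j)) *\<^sub>R \<beta> (X s) i j) has_derivative
     (\<lambda>h. \<Sum>i\<in>Basis. \<Sum>j\<in>Basis. ((Y s \<bullet> i) * (Z s \<bullet> j)) *\<^sub>R d i j (X' h) + 
        ((Y s \<bullet> i) * (Z' h \<bullet> j) + (Y' h \<bullet> i) * (Z s \<bullet> j)) *\<^sub>R \<beta> (X s) i j)) (at s)"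
    by (intro has_derivative_sum has_derivative_scaleR has_derivative_mult has_derivative_inner_left f dX)
  have "d y z h = (\<Sum>i\<in>Basis. \<Sum>j\<in>Basis. ((y \<bullet> i) * (z \<bullet> j)) *\<^sub>R d i j h)" for y z h
  proof -
    have "((\<lambda>x. \<Sum>i\<in>Basis. \<Sum>j\<in>Basis. ((y \<bullet> i) * (z \<bullet> j)) *\<^sub>R \<beta> x i j) has_derivative
      (\<lambda>h. \<Sum>i\<in>Basis. \<Sum>j\<in>Basis. ((y \<bullet> i) * (z \<bullet> j)) *\<^sub>R d i j h)) (at (X s))"
      by (intro has_derivative_sum has_derivative_scaleR_right d)
    then have "((\<lambda>x. \<beta> x y z) has_derivative
      (\<lambda>h. \<Sum>i\<in>Basis. \<Sum>j\<in>Basis. ((y \<bullet> i) * (z \<bullet> j)) *\<^sub>R d i j h)) (at (X s))"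
      by (rule has_derivative_transform_within_open[OF _ assms(1,2)])
        (rule bilinear_expansion[OF \<beta>(2), symmetric])
    from has_derivative_unique[OF d this] show ?thesis by (rule fun_cong)
  qed
  note dexp = this
  note bexp = bilinear_expansion[OF \<beta>(2)[OF assms(2)]]
  have *: "(\<lambda>h. \<Sum>i\<in>Basis. \<Sum>j\<in>Basis. ((Y s \<bullet> i) * (Z s \<bullet> j)) *\<^sub>R d i j (X' h) + 
        ((Y s \<bullet> i) * (Z' h \<bullet> j) + (Y' h \<bullet> i) * (Z s \<bullet> j)) *\<^sub>R \<beta> (X s) i j)
     = (\<lambda>h. d (Y s) (Z s) (X' h) + \<beta> (X s) (Y' h) (Z s) + \<beta> (X s) (Y s) (Z' h))"
  proof
    fix h
    show "(\<Sum>i\<in>Basis. \<Sum>j\<in>Basis. ((Y s \<bullet> i) * (Z s \<bullet> j)) *\<^sub>R d i j (X' h) + 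
        ((Y s \<bullet> i) * (Z' h \<bullet> j) + (Y' h \<bullet> i) * (Z s \<bullet> j)) *\<^sub>R \<beta> (X s) i j)
      = d (Y s) (Z s) (X' h) + \<beta> (X s) (Y' h) (Z s) + \<beta> (X s) (Y s) (Z' h)"
      unfolding dexp[of "Y s" "Z s" "X' h"] bexp[of "Y' h" "Z s"] bexp[of "Y s" "Z' h"]
      by (simp add: sum.distrib scaleR_add_left add_ac)
  qed
  from has_derivative_continuous[OF f(1), unfolded continuous_at_open, rule_format, OF conjI[OF assms(1,2)]]
  obtain V where V: "open V" "s \<in> V" "\<forall>u\<in>V. X u \<in> T" by (elim exE conjE)
  show ?thesis
    unfolding d_def[symmetric] *[symmetric]
    by (rule has_derivative_transform_within_open[OF E V(1,2)])
      (rule bilinear_expansion[OF \<beta>(2)[OF bspec[OF V(3)]], symmetric])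
qed

text \<open>By Gram-Schmidt a family \<open>e\<close>, indexed by the standard basis, is made
  orthonormal for \<beta>. The map \<open>S\<close> sending the standard basis to \<open>e\<close>
  carries the inner product to \<beta>, and the isometry is its inverse.\<close>

lemma exists_linear_isometry:
  fixes \<beta> :: "'b::euclidean_space \<Rightarrow> 'b \<Rightarrow> real"
  assumes bil: "bilinear \<beta>" and sym: "\<And>y z. \<beta> y z = \<beta> z y" and pos: "\<And>y. y \<noteq> 0 \<Longrightarrow> \<beta> y y > 0"
  obtains T :: "'b \<Rightarrow> 'b" where "linear T" "bij T" "\<And>y z. T y \<bullet> T z = \<beta> y z"
proof -
  have l: "linear (\<beta> y)" "linear (\<lambda>y. \<beta> y z)" for y z using bil by (auto simp: bilinear_def)
  have "\<exists>e. \<forall>i\<in>A. \<forall>j\<in>A. \<beta> (e i) (e j) = (if i = j then 1 else 0)" if "A \<subseteq> Basis" for A :: "'b set"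
    using finite_subset[OF that finite_Basis] that
  proof (induction A rule: finite_induct)
    case empty then show ?case by simp
  next
    case (insert a A)
    then obtain e where e: "\<And>i j. i \<in> A \<Longrightarrow> j \<in> A \<Longrightarrow> \<beta> (e i) (e j) = (if i = j then 1 else 0)" by auto
    \<comment> \<open>Fewer than \<open>DIM('b)\<close> vectors have been chosen, so some
      \<open>y\<close> lies outside their span.\<close>
    have "dim (span (e ` A)) \<le> card (e ` A)" using insert.hyps(1) by (simp add: dim_le_card')
    also have "\<dots> \<le> card A" using insert.hyps(1) by (rule card_image_le)
    also have "\<dots> < DIM('b)"
      using insert.prems insert.hyps by (intro psubset_card_mono) auto
    finally have "span (e ` A) \<noteq> UNIV" by (metis dim_UNIV less_irrefl)
    then obtain y where y: "y \<notin> span (e ` A)" by blast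
    define z where "z = y - (\<Sum>i\<in>A. \<beta> y (e i) *\<^sub>R e i)"
    have "(\<Sum>i\<in>A. \<beta> y (e i) *\<^sub>R e i) \<in> span (e ` A)"
      by (intro span_sum span_scale span_base) auto
    then have "z \<noteq> 0" using y by (auto simp: z_def)
    have zA: "\<beta> z (e j) = 0" if "j \<in> A" for j
    proof -
      have "\<beta> z (e j) = \<beta> y (e j) - (\<Sum>i\<in>A. \<beta> y (e i) * \<beta> (e i) (e j))"
        unfolding z_def by (simp add: linear_diff[OF l(2)] linear_sum[OF l(2)] linear_cmul[OF l(2)])
      also have "(\<Sum>i\<in>A. \<beta> y (e i) * \<beta> (e i) (e j)) = (\<Sum>i\<in>A. if i = j then \<beta> y (e j) else 0)"
        using that by (intro sum.cong) (auto simp: e)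
      finally show ?thesis using that insert.hyps by simp
    qed
    define f where "f = (1 / sqrt (\<beta> z z)) *\<^sub>R z"
    have "\<beta> f f = 1" unfolding f_def
      using pos[OF \<open>z \<noteq> 0\<close>] by (simp add: linear_cmul[OF l(1)] linear_cmul[OF l(2)])
    moreover have "\<beta> f (e j) = 0" "\<beta> (e j) f = 0" if "j \<in> A" for j
      using zA[OF that] sym[of "e j" f] by (auto simp: f_def linear_cmul[OF l(2)])
    ultimately show ?case
      using insert.hyps e by (intro exI[of _ "e(a := f)"]) auto
  qed
  from this[of Basis] obtain e :: "'b \<Rightarrow> 'b"
    where e: "\<And>i j. i \<in> Basis \<Longrightarrow> j \<in> Basis \<Longrightarrow> \<beta> (e i) (e j) = (if i = j then 1 else 0)" by auto
  define S where "S z = (\<Sum>i\<in>Basis. (z \<bullet> i) *\<^sub>R e i)" for z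
  have S: "linear S" unfolding S_def
    by (intro linear_compose_sum ballI bounded_linear.linear bounded_linear_scaleR_const bounded_linear_inner_left)
  have SS: "\<beta> (S y) (S z) = y \<bullet> z" for y z
  proof -
    have 1: "\<beta> x (S z) = (\<Sum>j\<in>Basis. (z \<bullet> j) * \<beta> x (e j))" for x
      unfolding S_def by (simp add: linear_sum[OF l(1)] linear_cmul[OF l(1)])
    have "\<beta> (S y) (S z) = (\<Sum>i\<in>Basis. (y \<bullet> i) * \<beta> (e i) (S z))"
      unfolding S_def[of y] by (simp add: linear_sum[OF l(2)] linear_cmul[OF l(2)])
    also have "\<dots> = (\<Sum>i\<in>Basis. \<Sum>j\<in>Basis. (y \<bullet> i) * ((z \<bullet> j) * \<beta> (e i) (e j)))"
      unfolding 1 by (simp add: sum_distrib_left)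
    also have "\<dots> = (\<Sum>i\<in>Basis. \<Sum>j\<in>Basis. if i = j then (y \<bullet> i) * (z \<bullet> i) else 0)"
      by (intro sum.cong refl) (auto simp: e)
    also have "\<dots> = y \<bullet> z" by (simp add: euclidean_inner[of y z])
    finally show ?thesis .
  qed
  have "inj S"
  proof (rule linear_injective_0[OF S, THEN iffD2], intro allI impI)
    fix z assume "S z = 0"
    then have "z \<bullet> z = 0" using SS[of z z] linear_0[OF l(1)] by simp
    then show "z = 0" by simp
  qed
  then obtain T where T: "linear T" "\<And>x. T (S x) = x" "\<And>x. S (T x) = x"
    using linear_injective_isomorphism[OF S] by blast
  show ?thesis
  proof (rule that[of T])
    show "bij T" by (rule bijI') (metis T(3), metis T(2))
    show "T y \<bullet> T z = \<beta> y z" for y z using SS[of "T y" "T z"] T(3) by simp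
  qed (rule T(1))
qed

section \<open>Charts, local trivializations and the fibre norm\<close>

locale metric_vector_bundle =
  fixes B :: "('p::t2_space, 'e::topological_space, 'a::euclidean_space, 'b::euclidean_space) metric_bundle"
  assumes riemannian: "riemannian_bundle B"
begin

definition point :: "('p, 'a) chart \<Rightarrow> 'a \<Rightarrow> 'p" where
  "point c x = inv_into (fst c) (snd c) x"

definition overlap :: "('p, 'a) chart \<Rightarrow> ('p, 'e, 'b) triv \<Rightarrow> 'a set" where
  "overlap c t = snd c ` (fst c \<inter> fst t)"

lemma bundleD:
  "smooth_manifold B" "riemannian_metric B" "levi_civita_connection B" "vector_bundle B"
  "riemannian_fibre_metric B" "bundle_connection B" "metric_connection B"
  "compact (UNIV :: 'p set)" "connected (UNIV :: 'p set)"
  using riemannian by (auto simp: riemannian_bundle_def)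

lemma chart_exists: obtains c where "c \<in> charts B" "p \<in> fst c"
  using bundleD(1) unfolding smooth_manifold_def by blast

lemma triv_exists: obtains t where "t \<in> trivs B" "p \<in> fst t"
  using bundleD(4) unfolding vector_bundle_def by blast

lemma chart_homeomorphism:
  assumes "c \<in> charts B"
  shows "homeomorphism (fst c) (snd c ` fst c) (snd c) (point c)"
proof -
  obtain h where h: "homeomorphism (fst c) (snd c ` fst c) (snd c) h"
    using bundleD(1) assms unfolding smooth_manifold_def by blast
  have "inj_on (snd c) (fst c)" using h by (metis homeomorphism_apply1 inj_on_inverseI)
  then have eq: "h x = point c x" if "x \<in> snd c ` fst c" for x
    using that h by (auto simp: point_def homeomorphism_apply1)
  show ?thesis
    by (rule homeomorphism_cong[OF h refl refl]) (use eq in auto)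
qed

lemma open_chart: "c \<in> charts B \<Longrightarrow> open (fst c)"
  and open_chart_image: "c \<in> charts B \<Longrightarrow> open (snd c ` fst c)"
  using bundleD(1) unfolding smooth_manifold_def by auto

lemma point: 
  assumes "c \<in> charts B"
  shows "x \<in> snd c ` fst c \<Longrightarrow> point c x \<in> fst c" "x \<in> snd c ` fst c \<Longrightarrow> snd c (point c x) = x"
    "p \<in> fst c \<Longrightarrow> point c (snd c p) = p"
  using chart_homeomorphism[OF assms] unfolding homeomorphism_def by auto

lemma continuous_on_point: "c \<in> charts B \<Longrightarrow> continuous_on (snd c ` fst c) (point c)"
  using chart_homeomorphism by (rule homeomorphism_cont2)

lemma continuous_on_chart: "c \<in> charts B \<Longrightarrow> continuous_on (fst c) (snd c)"
  using chart_homeomorphism by (rule homeomorphism_cont1)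

lemma chart_image_eq:
  assumes "c \<in> charts B" "U \<subseteq> fst c"
  shows "snd c ` U = snd c ` fst c \<inter> point c -` U"
  using assms(2) point[OF assms(1)] by (auto simp: subset_iff intro!: image_eqI[OF _ assms(2)[THEN subsetD]])

lemma open_chart_image_subset:
  assumes "c \<in> charts B" "U \<subseteq> fst c" "open U"
  shows "open (snd c ` U)"
  unfolding chart_image_eq[OF assms(1,2)]
  by (rule continuous_open_preimage[OF continuous_on_point[OF assms(1)] open_chart_image[OF assms(1)] assms(3)])

lemma open_triv: "t \<in> trivs B \<Longrightarrow> open (fst t)"
  using bundleD(4) unfolding vector_bundle_def by blast

lemma triv_homeomorphism:
  assumes "t \<in> trivs B"
  obtains h where "homeomorphism (proj B -` fst t) (fst t \<times> UNIV) (\<lambda>\<xi>. (proj B \<xi>, snd t \<xi>)) h"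
  using bundleD(4) assms unfolding vector_bundle_def by blast

lemma proj_scale [simp]: "proj B (fibre_scale B r \<xi>) = proj B \<xi>"
  using bundleD(4) unfolding vector_bundle_def by blast

lemma triv_scale: "t \<in> trivs B \<Longrightarrow> proj B \<xi> \<in> fst t \<Longrightarrow> snd t (fibre_scale B r \<xi>) = r *\<^sub>R snd t \<xi>"
  using bundleD(4) unfolding vector_bundle_def by blast

lemma proj_add: "proj B \<xi> = proj B \<eta> \<Longrightarrow> proj B (fibre_add B \<xi> \<eta>) = proj B \<xi>"
  using bundleD(4) unfolding vector_bundle_def by blast

lemma triv_add:
  "t \<in> trivs B \<Longrightarrow> proj B \<xi> \<in> fst t \<Longrightarrow> proj B \<xi> = proj B \<eta> \<Longrightarrow> snd t (fibre_add B \<xi> \<eta>) = snd t \<xi> + snd t \<eta>"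
  using bundleD(4) unfolding vector_bundle_def by blast

lemma triv_inject:
  assumes "t \<in> trivs B" "proj B \<xi> \<in> fst t" "proj B \<xi> = proj B \<eta>" "snd t \<xi> = snd t \<eta>"
  shows "\<xi> = \<eta>"
proof -
  obtain h where h: "homeomorphism (proj B -` fst t) (fst t \<times> UNIV) (\<lambda>\<xi>. (proj B \<xi>, snd t \<xi>)) h"
    using triv_homeomorphism[OF assms(1)] .
  have eq: "h (proj B \<zeta>, snd t \<zeta>) = \<zeta>" if "proj B \<zeta> \<in> fst t" for \<zeta>
    using homeomorphism_apply1[OF h, of \<zeta>] that by simp
  have "\<xi> = h (proj B \<xi>, snd t \<xi>)" using eq[OF assms(2)] by (rule sym)
  also have "\<dots> = h (proj B \<eta>, snd t \<eta>)" unfolding assms(3,4) ..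
  also have "\<dots> = \<eta>" by (rule eq) (use assms(2,3) in simp)
  finally show ?thesis .
qed

context
  fixes c :: "('p, 'a) chart" and t :: "('p, 'e, 'b) triv"
  assumes c: "c \<in> charts B" and t: "t \<in> trivs B"
begin

lemma open_overlap: "open (overlap c t)"
  unfolding overlap_def
  by (rule open_chart_image_subset[OF c]) (use open_chart[OF c] open_triv[OF t] in auto)

lemma point_overlap:
  assumes "x \<in> overlap c t"
  shows "point c x \<in> fst c" "point c x \<in> fst t" "snd c (point c x) = x"
  using assms point[OF c] by (auto simp: overlap_def)

lemma overlapI: "p \<in> fst c \<Longrightarrow> p \<in> fst t \<Longrightarrow> snd c p \<in> overlap c t"
  by (simp add: overlap_def)

lemma inj_on_coords: "inj_on (coords B c t) (proj B -` (fst c \<inter> fst t))"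
proof (rule inj_onI)
  fix \<xi> \<eta> assume a: "\<xi> \<in> proj B -` (fst c \<inter> fst t)" "\<eta> \<in> proj B -` (fst c \<inter> fst t)"
    and "coords B c t \<xi> = coords B c t \<eta>"
  then have "snd c (proj B \<xi>) = snd c (proj B \<eta>)" "snd t \<xi> = snd t \<eta>" by (auto simp: coords_def)
  then show "\<xi> = \<eta>" using a point(3)[OF c] triv_inject[OF t] by (metis IntD1 IntD2 vimageD)
qed

lemma from_coords_coords:
  "proj B \<xi> \<in> fst c \<Longrightarrow> proj B \<xi> \<in> fst t \<Longrightarrow> from_coords B c t (snd c (proj B \<xi>), snd t \<xi>) = \<xi>"
  unfolding from_coords_def using inv_into_f_f[OF inj_on_coords, of \<xi>] by (simp add: coords_def)

text \<open>Over the overlap \<open>from_coords\<close>, defined by choice, is the continuous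
  inverse \<open>h\<close> of the trivialization after \<open>point c\<close>. Continuity in
  coordinates comes from this factorization.\<close>

lemma from_coords_eq:
  obtains h where "continuous_on (fst t \<times> UNIV) h"
    "\<And>x y. x \<in> overlap c t \<Longrightarrow> from_coords B c t (x, y) = h (point c x, y)"
    "\<And>p y. p \<in> fst t \<Longrightarrow> proj B (h (p, y)) = p \<and> snd t (h (p, y)) = y"
proof -
  obtain h where h: "homeomorphism (proj B -` fst t) (fst t \<times> UNIV) (\<lambda>\<xi>. (proj B \<xi>, snd t \<xi>)) h"
    using triv_homeomorphism[OF t] .
  have 1: "proj B (h (p, y)) = p \<and> snd t (h (p, y)) = y" if "p \<in> fst t" for p y
    using homeomorphism_apply2[OF h, of "(p, y)"] that by simp
  have "from_coords B c t (x, y) = h (point c x, y)" if "x \<in> overlap c t" for x y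
    using from_coords_coords[of "h (point c x, y)"] 1[of "point c x" y] point_overlap[OF that] by simp
  then show ?thesis using that[OF homeomorphism_cont2[OF h]] 1 by blast
qed

lemma from_coords:
  assumes "x \<in> overlap c t"
  shows "proj B (from_coords B c t (x, y)) = point c x" "snd t (from_coords B c t (x, y)) = y"
proof -
  obtain h where h: "\<And>x y. x \<in> overlap c t \<Longrightarrow> from_coords B c t (x, y) = h (point c x, y)"
    "\<And>p y. p \<in> fst t \<Longrightarrow> proj B (h (p, y)) = p \<and> snd t (h (p, y)) = y"
    by (rule from_coords_eq) (rule that)
  show "proj B (from_coords B c t (x, y)) = point c x" "snd t (from_coords B c t (x, y)) = y"
    using h(1)[OF assms] h(2)[OF point_overlap(2)[OF assms]] by auto
qed

lemma continuous_on_from_coords: "continuous_on (overlap c t \<times> UNIV) (from_coords B c t)"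
proof -
  obtain h where h: "continuous_on (fst t \<times> UNIV) h"
    "\<And>x y. x \<in> overlap c t \<Longrightarrow> from_coords B c t (x, y) = h (point c x, y)"
    by (rule from_coords_eq) (rule that)
  have "continuous_on (overlap c t) (point c)"
    by (rule continuous_on_subset[OF continuous_on_point[OF c]]) (auto simp: overlap_def)
  then have "continuous_on (overlap c t \<times> UNIV) (\<lambda>z. (point c (fst z), snd z))"
    by (intro continuous_on_Pair continuous_on_snd continuous_on_id
        continuous_on_compose2[OF _ continuous_on_fst[OF continuous_on_id]]) auto
  then have "continuous_on (overlap c t \<times> UNIV) (\<lambda>z. h (point c (fst z), snd z))"
    by (rule continuous_on_compose2[OF h(1)]) (use point_overlap in auto)
  then show ?thesis by (rule continuous_on_eq) (use h(2) in auto)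
qed

lemma coords_image: "coords B c t ` (W \<inter> proj B -` (fst c \<inter> fst t)) = (overlap c t \<times> UNIV) \<inter> from_coords B c t -` W"
proof (intro equalityI subsetI)
  fix z assume "z \<in> coords B c t ` (W \<inter> proj B -` (fst c \<inter> fst t))"
  then show "z \<in> (overlap c t \<times> UNIV) \<inter> from_coords B c t -` W"
    using from_coords_coords by (auto simp: coords_def overlap_def)
next
  fix z assume "z \<in> (overlap c t \<times> UNIV) \<inter> from_coords B c t -` W"
  then obtain x y where z: "z = (x, y)" "x \<in> overlap c t" "from_coords B c t (x, y) \<in> W" by (cases z) auto
  have "coords B c t (from_coords B c t (x, y)) = z"
    using from_coords[OF z(2)] point_overlap[OF z(2)] z(1) by (simp add: coords_def)
  moreover have "from_coords B c t (x, y) \<in> W \<inter> proj B -` (fst c \<inter> fst t)"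
    using from_coords[OF z(2)] point_overlap[OF z(2)] z(3) by simp
  ultimately show "z \<in> coords B c t ` (W \<inter> proj B -` (fst c \<inter> fst t))" by (metis imageI)
qed

lemma open_coords_image: "open W \<Longrightarrow> open (coords B c t ` (W \<inter> proj B -` (fst c \<inter> fst t)))"
  unfolding coords_image
  by (intro continuous_open_preimage continuous_on_from_coords open_Times open_overlap open_UNIV)

lemma metric_bilinear: "x \<in> overlap c t \<Longrightarrow> bilinear (local_fibre_metric B c t x)"
  and metric_sym: "x \<in> overlap c t \<Longrightarrow> local_fibre_metric B c t x y z = local_fibre_metric B c t x z y"
  and metric_pos: "x \<in> overlap c t \<Longrightarrow> y \<noteq> 0 \<Longrightarrow> local_fibre_metric B c t x y y > 0"
  and metric_smooth: "smooth_on (overlap c t) (\<lambda>x. local_fibre_metric B c t x y z)"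
  using bundleD(5) c t unfolding riemannian_fibre_metric_def overlap_def by blast+

lemma conn_bilinear: "x \<in> overlap c t \<Longrightarrow> bilinear (fibre_conn B c t x)"
  and conn_smooth: "smooth_on (overlap c t) (\<lambda>x. fibre_conn B c t x v y)"
  using bundleD(6) c t unfolding bundle_connection_def overlap_def by blast+

lemma metric_conn:
  "x \<in> overlap c t \<Longrightarrow> frechet_derivative (\<lambda>x. local_fibre_metric B c t x y z) (at x) v =
     local_fibre_metric B c t x (fibre_conn B c t x v y) z +
     local_fibre_metric B c t x y (fibre_conn B c t x v z)"
  using bundleD(7) c t unfolding metric_connection_def overlap_def by blast

lemma fibre_metric_local:
  assumes "proj B \<xi> \<in> fst c" "proj B \<xi> \<in> fst t" "proj B \<eta> = proj B \<xi>"
  shows "fibre_metric B \<xi> \<eta> = local_fibre_metric B c t (snd c (proj B \<xi>)) (snd t \<xi>) (snd t \<eta>)"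
  using from_coords_coords[of \<xi>] from_coords_coords[of \<eta>] assms by (simp add: local_fibre_metric_def)

lemma fibre_norm_local:
  assumes "proj B \<xi> \<in> fst c" "proj B \<xi> \<in> fst t"
  shows "fibre_norm B \<xi> = sqrt (local_fibre_metric B c t (snd c (proj B \<xi>)) (snd t \<xi>) (snd t \<xi>))"
  using fibre_metric_local[OF assms refl] by (simp add: fibre_norm_def)

lemma fibre_norm_from_coords:
  "x \<in> overlap c t \<Longrightarrow> fibre_norm B (from_coords B c t (x, y)) = sqrt (local_fibre_metric B c t x y y)"
  by (simp add: fibre_norm_def local_fibre_metric_def)

lemma metric_scale: "x \<in> overlap c t \<Longrightarrow> local_fibre_metric B c t x (r *\<^sub>R y) (s *\<^sub>R z) = r * s * local_fibre_metric B c t x y z"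
  using metric_bilinear[of x] by (simp add: bilinear_lmul bilinear_rmul)

end

lemma bundle_point_cases:
  obtains c t where "c \<in> charts B" "t \<in> trivs B" "p \<in> fst c" "p \<in> fst t"
  using chart_exists triv_exists by metis

lemma fibre_norm_scale: "fibre_norm B (fibre_scale B r \<xi>) = \<bar>r\<bar> * fibre_norm B \<xi>"
proof -
  obtain c t where ct: "c \<in> charts B" "t \<in> trivs B" "proj B \<xi> \<in> fst c" "proj B \<xi> \<in> fst t"
    by (rule bundle_point_cases)
  then show ?thesis
    using fibre_norm_local[OF ct(1,2), of \<xi>] fibre_norm_local[OF ct(1,2), of "fibre_scale B r \<xi>"]
      metric_scale[OF ct(1,2) overlapI[OF ct]] triv_scale[OF ct(2,4)]
    by (simp add: real_sqrt_mult real_sqrt_abs2 abs_mult[symmetric])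
qed

lemma fibre_scale_scale: "fibre_scale B r (fibre_scale B s \<xi>) = fibre_scale B (r * s) \<xi>"
proof -
  obtain t where t: "t \<in> trivs B" "proj B \<xi> \<in> fst t" by (rule triv_exists)
  then show ?thesis by (intro triv_inject[OF t(1)]) (auto simp: triv_scale)
qed

lemma fibre_scale_1 [simp]: "fibre_scale B 1 \<xi> = \<xi>"
proof -
  obtain t where t: "t \<in> trivs B" "proj B \<xi> \<in> fst t" by (rule triv_exists)
  then show ?thesis by (intro triv_inject[OF t(1)]) (auto simp: triv_scale)
qed

lemma nonzero_iff_norm: "\<xi> \<in> nonzero_vectors B \<longleftrightarrow> fibre_norm B \<xi> > 0"
proof -
  obtain c t where ct: "c \<in> charts B" "t \<in> trivs B" "proj B \<xi> \<in> fst c" "proj B \<xi> \<in> fst t"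
    by (rule bundle_point_cases)
  have 1: "\<xi> = fibre_scale B 0 \<xi> \<longleftrightarrow> snd t \<xi> = 0"
    using triv_inject[OF ct(2,4), of "fibre_scale B 0 \<xi>"] triv_scale[OF ct(2,4), of 0] by auto
  have "snd t \<xi> = 0 \<Longrightarrow> fibre_norm B \<xi> = 0"
    using fibre_norm_local[OF ct] bilinear_lzero[OF metric_bilinear[OF ct(1,2) overlapI[OF ct]]] by simp
  moreover have "snd t \<xi> \<noteq> 0 \<Longrightarrow> fibre_norm B \<xi> > 0"
    using fibre_norm_local[OF ct] metric_pos[OF ct(1,2) overlapI[OF ct]] by simp
  ultimately show ?thesis using 1 unfolding nonzero_vectors_def by force
qed

lemma unit_vector_exists: obtains \<xi> where "\<xi> \<in> unit_sphere_bundle B" "proj B \<xi> = p"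
proof -
  obtain c t where ct: "c \<in> charts B" "t \<in> trivs B" "p \<in> fst c" "p \<in> fst t"
    by (rule bundle_point_cases)
  obtain b :: 'b where b: "b \<in> Basis" using nonempty_Basis by blast
  define \<eta> where "\<eta> = from_coords B c t (snd c p, b)"
  note x = overlapI[OF ct]
  have n: "fibre_norm B \<eta> > 0"
    using fibre_norm_from_coords[OF ct(1,2) x] metric_pos[OF ct(1,2) x nonzero_Basis[OF b]]
    by (simp add: \<eta>_def)
  show ?thesis
    by (rule that[of "fibre_scale B (1 / fibre_norm B \<eta>) \<eta>"])
      (use n from_coords(1)[OF ct(1,2) x] point(3)[OF ct(1,3)] in
        \<open>auto simp: unit_sphere_bundle_def fibre_norm_scale \<eta>_def\<close>)
qed

text \<open>A function on the sphere bundle is smooth only through local extensions. Along a smooth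
  map with values in the sphere bundle each extension agrees with \<open>u\<close>, so
  \<open>u\<close> can be differentiated there without choosing one globally.\<close>

lemma smooth_sphere_function_compose:
  fixes h :: "'x::real_normed_vector \<Rightarrow> 'a \<times> 'b"
  assumes ct: "c \<in> charts B" "t \<in> trivs B"
    and u: "smooth_on_sphere_bundle B u"
    and T: "open T" "smooth_on T h"
    and h: "\<And>z. z \<in> T \<Longrightarrow> fst (h z) \<in> overlap c t"
      "\<And>z. z \<in> T \<Longrightarrow> from_coords B c t (h z) \<in> unit_sphere_bundle B"
  shows "smooth_on T (\<lambda>z. u (from_coords B c t (h z)))"
proof (rule smooth_on_local)
  fix z0 assume z0: "z0 \<in> T"
  from u[unfolded smooth_on_sphere_bundle_def, THEN bspec, OF h(2)[OF z0]]
  obtain W f where W: "open W" "from_coords B c t (h z0) \<in> W" "smooth_function_on B W f"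
    "\<forall>\<eta>\<in>W \<inter> unit_sphere_bundle B. f \<eta> = u \<eta>"
    by (elim exE conjE)
  define V where "V = coords B c t ` (W \<inter> proj B -` (fst c \<inter> fst t))"
  have V: "V = (overlap c t \<times> UNIV) \<inter> from_coords B c t -` W" unfolding V_def by (rule coords_image[OF ct])
  have oV: "open V" unfolding V_def by (rule open_coords_image[OF ct W(1)])
  have sV: "smooth_on V (\<lambda>z. f (from_coords B c t z))"
    using W(3) ct unfolding smooth_function_on_def V_def by blast
  define S where "S = T \<inter> h -` V"
  have oS: "open S" unfolding S_def by (rule continuous_open_preimage[OF smooth_onD(3)[OF T(2)] T(1) oV])
  have "smooth_on S (\<lambda>z. f (from_coords B c t (h z)))"
    by (rule smooth_on_compose[OF sV smooth_on_subset[OF T(2)] oS oV]) (auto simp: S_def)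
  then have "smooth_on S (\<lambda>z. u (from_coords B c t (h z)))"
    by (rule smooth_on_cong[OF _ oS]) (use W(4) h(2) in \<open>auto simp: S_def V\<close>)
  moreover have "z0 \<in> S"
    using z0 h(1)[OF z0] W(2) by (cases "h z0") (auto simp: S_def V)
  ultimately show "\<exists>T. open T \<and> z0 \<in> T \<and> smooth_on T (\<lambda>z. u (from_coords B c t (h z)))"
    using oS by blast
qed

end

context metric_vector_bundle
begin

definition radial :: "('e \<Rightarrow> real) \<Rightarrow> 'e set" where
  "radial u = (\<lambda>\<xi>. fibre_scale B (exp (u \<xi>)) \<xi>) ` unit_sphere_bundle B"

lemma radial_graph_iff: "radial_graph B Y \<longleftrightarrow> (\<exists>u. smooth_on_sphere_bundle B u \<and> Y = radial u)"
  by (simp add: radial_graph_def radial_def)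

section \<open>The fibres of radial graphs\<close>

lemma fibre_isometry_exists: "\<exists>L. fibre_isometry B p L"
proof -
  obtain c t where ct: "c \<in> charts B" "t \<in> trivs B" "p \<in> fst c" "p \<in> fst t"
    by (rule bundle_point_cases)
  note x = overlapI[OF ct]
  obtain T :: "'b \<Rightarrow> 'b" where T: "linear T" "bij T"
    "\<And>y z. T y \<bullet> T z = local_fibre_metric B c t (snd c p) y z"
    using exists_linear_isometry[OF metric_bilinear[OF ct(1,2) x] metric_sym[OF ct(1,2) x] metric_pos[OF ct(1,2) x]]
    by blast
  have "bij_betw (snd t) (fibre B p) UNIV"
  proof (rule bij_betwI')
    show "(snd t \<xi> = snd t \<eta>) = (\<xi> = \<eta>)" if "\<xi> \<in> fibre B p" "\<eta> \<in> fibre B p" for \<xi> \<eta>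
      using triv_inject[OF ct(2), of \<xi> \<eta>] that ct(4) by (auto simp: fibre_def)
    show "\<exists>\<xi>\<in>fibre B p. y = snd t \<xi>" for y
      using from_coords[OF ct(1,2) x, of y] point(3)[OF ct(1,3)]
      by (intro bexI[of _ "from_coords B c t (snd c p, y)"]) (auto simp: fibre_def)
  qed simp
  then have "bij_betw (T \<circ> snd t) (fibre B p) UNIV" using T(2) by (rule bij_betw_trans)
  moreover have "T (snd t \<xi>) \<bullet> T (snd t \<eta>) = fibre_metric B \<xi> \<eta>"
    if "\<xi> \<in> fibre B p" "\<eta> \<in> fibre B p" for \<xi> \<eta>
    using fibre_metric_local[OF ct(1,2), of \<xi> \<eta>] that ct T(3) by (simp add: fibre_def)
  moreover have "T (snd t (fibre_add B \<xi> \<eta>)) = T (snd t \<xi>) + T (snd t \<eta>)"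
    if "\<xi> \<in> fibre B p" "\<eta> \<in> fibre B p" for \<xi> \<eta>
    using triv_add[OF ct(2), of \<xi> \<eta>] that ct(4) linear_add[OF T(1)] by (simp add: fibre_def)
  moreover have "T (snd t (fibre_scale B r \<xi>)) = r *\<^sub>R T (snd t \<xi>)" if "\<xi> \<in> fibre B p" for r \<xi>
    using triv_scale[OF ct(2), of \<xi>] that ct(4) linear_cmul[OF T(1)] by (simp add: fibre_def)
  ultimately show ?thesis by (intro exI[of _ "T \<circ> snd t"]) (simp add: fibre_isometry_def)
qed

context
  fixes p :: 'p and L :: "'e \<Rightarrow> 'b"
  assumes L: "fibre_isometry B p L"
begin

definition lift :: "'b \<Rightarrow> 'e" where
  "lift = inv_into (fibre B p) L"

lemma bij_L: "bij_betw L (fibre B p) UNIV"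
  using L by (simp add: fibre_isometry_def)

lemma L_lift [simp]: "L (lift z) = z"
  using bij_betw_inv_into_right[OF bij_L] by (simp add: lift_def)

lemma lift_in_fibre: "lift z \<in> fibre B p"
  unfolding lift_def by (rule inv_into_into) (simp add: bij_betw_imp_surj_on[OF bij_L])

lemma proj_lift [simp]: "proj B (lift z) = p"
  using lift_in_fibre by (simp add: fibre_def)

lemma lift_L: "proj B \<xi> = p \<Longrightarrow> lift (L \<xi>) = \<xi>"
  using bij_betw_inv_into_left[OF bij_L, of \<xi>] by (simp add: lift_def fibre_def)

lemma L_scale: "proj B \<xi> = p \<Longrightarrow> L (fibre_scale B r \<xi>) = r *\<^sub>R L \<xi>"
  using L unfolding fibre_isometry_def fibre_def by simp

lemma L_add: "proj B \<xi> = p \<Longrightarrow> proj B \<eta> = p \<Longrightarrow> L (fibre_add B \<xi> \<eta>) = L \<xi> + L \<eta>"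
  using L unfolding fibre_isometry_def fibre_def by simp

lemma norm_L: "proj B \<xi> = p \<Longrightarrow> norm (L \<xi>) = fibre_norm B \<xi>"
  using L unfolding fibre_isometry_def fibre_def fibre_norm_def norm_eq_sqrt_inner by simp

lemma lift_scale: "lift (r *\<^sub>R z) = fibre_scale B r (lift z)"
  using lift_L[of "fibre_scale B r (lift z)"] by (simp add: L_scale)

lemma lift_add: "lift (y + z) = fibre_add B (lift y) (lift z)"
  using lift_L[of "fibre_add B (lift y) (lift z)"] by (simp add: L_add proj_add)

lemma fibre_norm_lift: "fibre_norm B (lift z) = norm z"
  using norm_L[of "lift z"] by simp

definition fibre_height :: "('e \<Rightarrow> real) \<Rightarrow> 'b \<Rightarrow> real" where
  "fibre_height u z = u (lift ((1 / norm z) *\<^sub>R z))"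

lemma star_graph_fibre_height:
  assumes u: "smooth_on_sphere_bundle B u"
  shows "star_graph (fibre_height u)"
proof
  obtain c t where ct: "c \<in> charts B" "t \<in> trivs B" "p \<in> fst c" "p \<in> fst t"
    by (rule bundle_point_cases)
  have lin: "linear (\<lambda>z. snd t (lift z))"
    by (rule linearI) (use ct in \<open>simp_all add: lift_add lift_scale triv_add triv_scale\<close>)
  define h where "h z = (snd c p, snd t (lift (inverse (norm z) *\<^sub>R z)))" for z :: 'b
  have o: "open (- {0::'b})" by auto
  have "smooth_on (- {0}) (\<lambda>z::'b. snd t (lift (inverse (norm z) *\<^sub>R z)))"
    by (rule smooth_on_linear_compose[OF linear_conv_bounded_linear[THEN iffD1, OF lin] _ o])
      (intro smooth_on_scaleR smooth_on_inverse_compose smooth_on_norm smooth_on_ident o; simp)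
  then have "smooth_on (- {0}) h" unfolding h_def by (intro smooth_on_Pair smooth_on_const o)
  moreover have eq: "from_coords B c t (h z) = lift (inverse (norm z) *\<^sub>R z)" for z
    using from_coords_coords[OF ct(1,2), of "lift (inverse (norm z) *\<^sub>R z)"] ct(3,4) by (simp add: h_def)
  moreover have "fst (h z) \<in> overlap c t" for z using overlapI[OF ct] by (simp add: h_def)
  moreover have "from_coords B c t (h z) \<in> unit_sphere_bundle B" if "z \<in> - {0}" for z
    using that by (simp add: eq unit_sphere_bundle_def fibre_norm_lift)
  ultimately have "smooth_on (- {0}) (\<lambda>z. u (from_coords B c t (h z)))"
    by (intro smooth_sphere_function_compose[OF ct(1,2) u o]) 
  then show "smooth_on (- {0}) (fibre_height u)"
    by (simp add: eq fibre_height_def[abs_def] divide_inverse)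
  show "fibre_height u (s *\<^sub>R z) = fibre_height u z" if "s > 0" for s z
    using that by (simp add: fibre_height_def)
qed

lemma image_radial:
  assumes u: "smooth_on_sphere_bundle B u"
  shows "L ` (radial u \<inter> fibre B p) = star_graph.graph (fibre_height u)"
proof -
  interpret star_graph "fibre_height u" by (rule star_graph_fibre_height[OF u])
  show ?thesis
  proof (intro equalityI subsetI)
    fix z assume "z \<in> L ` (radial u \<inter> fibre B p)"
    then obtain \<eta> where e: "\<eta> \<in> unit_sphere_bundle B" "proj B \<eta> = p" "z = L (fibre_scale B (exp (u \<eta>)) \<eta>)"
      by (auto simp: radial_def fibre_def)
    have z: "z = exp (u \<eta>) *\<^sub>R L \<eta>" using e by (simp add: L_scale)
    have n: "norm (L \<eta>) = 1" using e norm_L by (simp add: unit_sphere_bundle_def)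
    then have "norm z = exp (u \<eta>)" by (simp add: z)
    moreover have "fibre_height u z = u \<eta>" using n e(2) by (simp add: z fibre_height_def lift_L)
    ultimately show "z \<in> graph" by (auto simp: graph_def)
  next
    fix z assume zg: "z \<in> graph"
    have z: "z \<noteq> 0" "norm z = exp (fibre_height u z)" using zg norm_graph[OF zg] by (auto simp: graph_def)
    define \<eta> where "\<eta> = lift ((1 / norm z) *\<^sub>R z)"
    have "\<eta> \<in> unit_sphere_bundle B" using z by (simp add: unit_sphere_bundle_def \<eta>_def fibre_norm_lift)
    then have "fibre_scale B (exp (u \<eta>)) \<eta> \<in> radial u \<inter> fibre B p"
      by (auto simp: radial_def fibre_def \<eta>_def)
    moreover have "L (fibre_scale B (exp (u \<eta>)) \<eta>) = z"
      using z by (simp add: L_scale \<eta>_def fibre_height_def)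
    ultimately show "z \<in> L ` (radial u \<inter> fibre B p)" by (intro image_eqI[OF sym])
  qed
qed

end

lemma unit_normalization:
  assumes "\<xi> \<in> nonzero_vectors B"
  shows "fibre_scale B (1 / fibre_norm B \<xi>) \<xi> \<in> unit_sphere_bundle B"
    "fibre_scale B (fibre_norm B \<xi>) (fibre_scale B (1 / fibre_norm B \<xi>) \<xi>) = \<xi>"
  using assms by (simp_all add: nonzero_iff_norm unit_sphere_bundle_def fibre_norm_scale fibre_scale_scale)

section \<open>Graphs over the base: sphere bundles of variable radius\<close>

definition spheres :: "('p \<Rightarrow> real) \<Rightarrow> 'e set" where
  "spheres f = {\<xi>. fibre_norm B \<xi> = exp (f (proj B \<xi>))}"

lemma radial_eq_spheres:
  assumes "\<And>\<xi>. \<xi> \<in> unit_sphere_bundle B \<Longrightarrow> u \<xi> = f (proj B \<xi>)"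
  shows "radial u = spheres f"
proof (intro equalityI subsetI)
  fix \<xi> assume "\<xi> \<in> radial u"
  then show "\<xi> \<in> spheres f"
    using assms by (auto simp: radial_def spheres_def fibre_norm_scale unit_sphere_bundle_def)
next
  fix \<xi> assume x: "\<xi> \<in> spheres f"
  define \<eta> where "\<eta> = fibre_scale B (1 / fibre_norm B \<xi>) \<xi>"
  have "\<xi> \<in> nonzero_vectors B" using x by (simp add: nonzero_iff_norm spheres_def)
  note n = unit_normalization[OF this, folded \<eta>_def]
  have "exp (u \<eta>) = fibre_norm B \<xi>" using assms[OF n(1)] x by (simp add: spheres_def \<eta>_def)
  then show "\<xi> \<in> radial u" unfolding radial_def using n(2) by (intro image_eqI[OF _ n(1)]) simp
qed

lemma vertical_curvature_spheres:
  assumes "\<And>\<xi>. \<xi> \<in> spheres f \<Longrightarrow> K \<xi> = (1 / fibre_norm B \<xi>) ^ (DIM('b) - 1)"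
  shows "vertical_gauss_curvature_given_by B (spheres f) K"
  unfolding vertical_gauss_curvature_given_by_def
proof
  fix \<xi> assume x: "\<xi> \<in> spheres f"
  define p where "p = proj B \<xi>"
  obtain L where L: "fibre_isometry B p L" using fibre_isometry_exists by blast
  have "L ` (spheres f \<inter> fibre B p) = sphere 0 (exp (f p))"
  proof (intro equalityI subsetI)
    fix z assume "z \<in> L ` (spheres f \<inter> fibre B p)"
    then show "z \<in> sphere 0 (exp (f p))" by (auto simp: spheres_def fibre_def norm_L[OF L])
  next
    fix z :: 'b assume "z \<in> sphere 0 (exp (f p))"
    then have "lift p L z \<in> spheres f \<inter> fibre B p"
      by (simp add: spheres_def fibre_def fibre_norm_lift[OF L] proj_lift[OF L])
    then show "z \<in> L ` (spheres f \<inter> fibre B p)" by (rule image_eqI[rotated]) (simp add: L_lift[OF L])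
  qed
  moreover have "norm (L \<xi>) = exp (f p)" "fibre_norm B \<xi> = exp (f p)"
    using x norm_L[OF L, of \<xi>] by (auto simp: p_def spheres_def)
  ultimately have "has_gauss_curvature (L ` (spheres f \<inter> fibre B p)) (L \<xi>) (K \<xi>)"
    using has_gauss_curvature_sphere[of "L \<xi>" "exp (f p)"] assms[OF x] by simp
  with L show "\<exists>L. fibre_isometry B (proj B \<xi>) L \<and>
        has_gauss_curvature (L ` (spheres f \<inter> fibre B (proj B \<xi>))) (L \<xi>) (K \<xi>)"
    unfolding p_def by blast
qed

context
  fixes c :: "('p, 'a) chart" and t :: "('p, 'e, 'b) triv" and f :: "'p \<Rightarrow> real"
  assumes c: "c \<in> charts B" and t: "t \<in> trivs B"
    and f: "smooth_on (overlap c t) (\<lambda>x. f (point c x))"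
begin

abbreviation "lm \<equiv> local_fibre_metric B c t"
abbreviation "fc \<equiv> \<lambda>x. f (point c x)"

text \<open>Half the logarithm of the squared norm is preferred to the norm itself: scaling the
  fibre by \<open>exp (- s)\<close> lowers this defining function by exactly \<open>s\<close>, as
  the retraction in \<open>tangent_vectors_level_set\<close> requires.\<close>

lemma coord_image_spheres:
  "coord_image B c t (spheres f) = {z. fst z \<in> overlap c t \<and> snd z \<noteq> 0 \<and>
     ln (lm (fst z) (snd z) (snd z)) / 2 - fc (fst z) = 0}"
proof -
  have "sqrt (lm x y y) = exp (fc x) \<longleftrightarrow> y \<noteq> 0 \<and> ln (lm x y y) / 2 - fc x = 0"
    if x: "x \<in> overlap c t" for x y
  proof (cases "y = 0")
    case True then show ?thesis using bilinear_lzero[OF metric_bilinear[OF c t x]] by simp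
  next
    case False
    then have p: "sqrt (lm x y y) > 0" using metric_pos[OF c t x] by simp
    have "sqrt (lm x y y) = exp (fc x) \<longleftrightarrow> ln (sqrt (lm x y y)) = fc x"
      using p by (metis exp_ln ln_exp)
    then show ?thesis using False metric_pos[OF c t x False] by (simp add: ln_sqrt)
  qed
  then show ?thesis
    unfolding coord_image_def coords_image[OF c t] spheres_def
    by (auto simp: fibre_norm_from_coords[OF c t] from_coords[OF c t])
qed

text \<open>Compatibility of connection and metric turns the derivative of the metric coefficients
  into connection terms, which combine with the change of \<open>y\<close> to the vertical part. In
  particular the norm is constant in horizontal directions.\<close>

lemma metric_square_deriv:
  assumes "x \<in> overlap c t"
  shows "((\<lambda>z. lm (fst z) (snd z) (snd z)) has_derivative (\<lambda>X. 2 * lm x (vertical_part B c t (x, y) X) y)) (at (x, y))"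
proof -
  have "((\<lambda>z. lm (fst z) (snd z) (snd z)) has_derivative
     (\<lambda>X. frechet_derivative (\<lambda>x'. lm x' (snd (x, y)) (snd (x, y))) (at (fst (x, y))) (fst X) +
        lm (fst (x, y)) (snd X) (snd (x, y)) + lm (fst (x, y)) (snd (x, y)) (snd X))) (at (x, y))"
    by (rule has_derivative_bilinear_family[OF open_overlap[OF c t] _ metric_smooth[OF c t] metric_bilinear[OF c t]])
      (use assms in \<open>auto intro!: derivative_intros\<close>)
  moreover have "frechet_derivative (\<lambda>x'. lm x' y y) (at x) (fst X) + lm x (snd X) y + lm x y (snd X)
     = 2 * lm x (vertical_part B c t (x, y) X) y" for X
    using metric_conn[OF c t assms, of y y "fst X"] metric_sym[OF c t assms, of y]
    by (simp add: vertical_part_def bilinear_ladd[OF metric_bilinear[OF c t assms]])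
  ultimately show ?thesis by simp
qed

lemma fc_deriv: "x \<in> overlap c t \<Longrightarrow> (fc has_derivative (\<lambda>w. grad fc x \<bullet> w)) (at x)"
  by (rule has_derivative_grad[OF smooth_onD(1)[OF f]])

lemma defining_function_deriv:
  assumes "x \<in> overlap c t" "y \<noteq> 0"
  shows "((\<lambda>z. ln (lm (fst z) (snd z) (snd z)) / 2 - fc (fst z)) has_derivative
    (\<lambda>X. lm x (vertical_part B c t (x, y) X) y / lm x y y - grad fc x \<bullet> fst X)) (at (x, y))"
proof -
  have p: "lm x y y > 0" by (rule metric_pos[OF c t assms])
  have "((\<lambda>z. ln (lm (fst z) (snd z) (snd z)) / 2) has_derivative
    (\<lambda>X. lm x (vertical_part B c t (x, y) X) y / lm x y y)) (at (x, y))"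
  proof -
    have "((\<lambda>z. ln (lm (fst z) (snd z) (snd z))) has_derivative
        (\<lambda>X. 2 * lm x (vertical_part B c t (x, y) X) y * inverse (lm (fst (x, y)) (snd (x, y)) (snd (x, y))))) (at (x, y))"
      by (rule has_derivative_ln[OF _ metric_square_deriv[OF assms(1)]]) (simp add: p)
    then have "((\<lambda>z. ln (lm (fst z) (snd z) (snd z)) / 2) has_derivative
        (\<lambda>X. 2 * lm x (vertical_part B c t (x, y) X) y * inverse (lm (fst (x, y)) (snd (x, y)) (snd (x, y))) / 2)) (at (x, y))"
      by (rule bounded_linear.has_derivative[OF bounded_linear_divide])
    then show ?thesis by (simp only: fst_conv snd_conv divide_real_def[of _ "lm x y y"]
        mult.assoc nonzero_mult_div_cancel_left[OF zero_neq_numeral[symmetric]])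
  qed
  moreover have "((\<lambda>z. fc (fst z)) has_derivative (\<lambda>X. grad fc x \<bullet> fst X)) (at (x, y))"
    by (rule has_derivative_compose[OF has_derivative_fst[OF has_derivative_ident]]) (simp add: fc_deriv assms)
  ultimately show ?thesis by (rule has_derivative_diff)
qed

lemma tangent_vectors_spheres:
  assumes z: "(x, y) \<in> coord_image B c t (spheres f)"
  shows "tangent_vectors (coord_image B c t (spheres f)) (x, y) =
     {X. lm x (vertical_part B c t (x, y) X) y = (grad fc x \<bullet> fst X) * lm x y y}"
proof -
  define F where "F z = ln (lm (fst z) (snd z) (snd z)) / 2 - fc (fst z)" for z
  define F' where "F' X = lm x (vertical_part B c t (x, y) X) y / lm x y y - grad fc x \<bullet> fst X" for X
  note im = coord_image_spheres[folded F_def]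
  have xy: "x \<in> overlap c t" "y \<noteq> 0" "F (x, y) = 0" using z unfolding im by auto
  have p: "lm x y y > 0" by (rule metric_pos[OF c t xy(1,2)])
  have F: "(F has_derivative F') (at (x, y))"
    unfolding F_def[abs_def] F'_def[abs_def] by (rule defining_function_deriv[OF xy(1,2)])
  define D where "D = overlap c t \<times> (- {0::'b})"
  have o: "open D" unfolding D_def by (intro open_Times open_overlap[OF c t]) auto
  have s1: "smooth_on D fst" "smooth_on D snd"
    by (auto intro: smooth_on_bounded_linear bounded_linear_fst bounded_linear_snd)
  have pos: "lm (fst z) (snd z) (snd z) > 0" if "z \<in> D" for z
    using that by (auto simp: D_def intro!: metric_pos[OF c t])
  have "smooth_on D (\<lambda>z. fc (fst z))"
    by (rule smooth_on_compose[OF f s1(1) o open_overlap[OF c t]]) (auto simp: D_def)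
  moreover have "smooth_on D (\<lambda>z. lm (fst z) (snd z) (snd z))"
    by (rule smooth_on_bilinear_family[OF o open_overlap[OF c t] metric_smooth[OF c t] metric_bilinear[OF c t] s1(1,2,2)])
      (auto simp: D_def)
  ultimately have "smooth_on D F"
    unfolding F_def[abs_def] divide_inverse
    by (intro smooth_on_diff smooth_on_mult smooth_on_ln_compose smooth_on_const o pos)
  then have "tangent_vectors (coord_image B c t (spheres f)) (x, y) = {X. F' X = 0}"
  proof (rule tangent_vectors_level_set[OF o _ _ _ _ z F])
    \<comment> \<open>The retraction moves along the vertical radial field only, so the base point
      and \<open>fc\<close> stay fixed while the logarithm of the norm is corrected.\<close>
    show "bounded_linear (\<lambda>z::'a \<times> 'b. (0::'a, snd z))"
      by (intro bounded_linear_Pair bounded_linear_zero bounded_linear_snd)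
    show "coord_image B c t (spheres f) = {z \<in> D. F z = 0}" unfolding im by (auto simp: D_def)
    fix w assume w: "w \<in> D"
    then have x': "fst w \<in> overlap c t" "snd w \<noteq> 0" by (auto simp: D_def)
    have eq: "w + (exp (- F w) - 1) *\<^sub>R (0, snd w) = (fst w, exp (- F w) *\<^sub>R snd w)"
      by (simp add: prod_eq_iff algebra_simps)
    have "ln (exp (- F w) * exp (- F w) * lm (fst w) (snd w) (snd w)) = - 2 * F w + ln (lm (fst w) (snd w) (snd w))"
      using pos[OF w] by (simp add: ln_mult)
    then show "w + (exp (- F w) - 1) *\<^sub>R (0, snd w) \<in> coord_image B c t (spheres f)"
      unfolding im eq using x' by (simp add: F_def[of "(_, _)"] metric_scale[OF c t]) (simp add: F_def)
  qed
  also have "\<dots> = {X. lm x (vertical_part B c t (x, y) X) y = (grad fc x \<bullet> fst X) * lm x y y}"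
    using p by (auto simp: F'_def field_simps)
  finally show ?thesis .
qed

end

end

lemma convex_radial_graphD:
  assumes "convex_radial_graph B Y" "c \<in> charts B" "t \<in> trivs B" "z \<in> coord_image B c t Y"
    and "outward_unit_normal B c t Y z \<nu>" "open W" "z \<in> W" "smooth_on W Z"
    and "\<forall>w\<in>W \<inter> coord_image B c t Y. Z w \<in> tangent_vectors (coord_image B c t Y) w"
  shows "- sasaki_metric B c t z (sasaki_connection B c t z (Z z) Z) \<nu> \<ge> 0"
  using assms(1)[unfolded convex_radial_graph_def, THEN conjunct2, rule_format, OF assms(2-4)] assms(5-9)
  by simp

text \<open>Used to pass from the coordinate gradient to the Riemannian one. Positivity makes the
  linear map representing \<beta> injective, hence surjective in finite dimension.\<close>

lemma riesz_bilinear: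
  fixes \<beta> :: "'a::euclidean_space \<Rightarrow> 'a \<Rightarrow> real"
  assumes bil: "bilinear \<beta>" and pos: "\<And>y. y \<noteq> 0 \<Longrightarrow> \<beta> y y > 0"
  obtains n where "\<And>h. \<beta> n h = q \<bullet> h"
proof -
  have l: "linear (\<beta> y)" "linear (\<lambda>y. \<beta> y z)" for y z using bil by (auto simp: bilinear_def)
  define S where "S n = (\<Sum>b\<in>Basis. \<beta> n b *\<^sub>R b)" for n
  have S: "S n \<bullet> h = \<beta> n h" for n h
    using linear_basis_expansion[OF l(1), of n h] by (simp add: S_def inner_sum_right inner_commute[of _ h] mult.commute)
  have "linear S"
    by (rule linearI)
      (simp_all add: S_def linear_add[OF l(2)] linear_cmul[OF l(2)] scaleR_add_left sum.distrib scaleR_sum_right)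
  moreover have "inj S"
  proof (rule linear_injective_0[OF \<open>linear S\<close>, THEN iffD2], intro allI impI)
    fix n assume "S n = 0"
    then have "\<beta> n n = 0" using S[of n n] by simp
    then show "n = 0" using pos[of n] by fastforce
  qed
  ultimately obtain n where "S n = q" using linear_injective_imp_surjective by (metis surjD)
  then show ?thesis by (intro that[of n]) (simp add: S[symmetric])
qed

context metric_vector_bundle
begin

section \<open>Convexity\<close>

lemma base_metric_props:
  assumes "c \<in> charts B" "x \<in> snd c ` fst c"
  shows "bilinear (base_metric B c x)" "base_metric B c x v w = base_metric B c x w v"
    "v \<noteq> 0 \<Longrightarrow> base_metric B c x v v > 0"
  using bundleD(2) assms unfolding riemannian_metric_def by blast+

lemma base_conn_smooth:
  "c \<in> charts B \<Longrightarrow> smooth_on (snd c ` fst c) (\<lambda>x. base_conn B c x v w)"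
  using bundleD(3) unfolding levi_civita_connection_def by blast

lemma overlap_subset: "overlap c t \<subseteq> snd c ` fst c"
  by (auto simp: overlap_def)

context
  fixes c :: "('p, 'a) chart" and t :: "('p, 'e, 'b) triv"
  assumes c: "c \<in> charts B" and t: "t \<in> trivs B"
begin

lemma vertical_part_vertical [simp]:
  "x \<in> overlap c t \<Longrightarrow> vertical_part B c t (x, y) (0, v) = v"
  using bilinear_lzero[OF conn_bilinear[OF c t]] by (simp add: vertical_part_def)

lemma vertical_part_frame [simp]: "vertical_part B c t z (frame_vector B c t z h v) = v"
  by (simp add: vertical_part_def frame_vector_def)

lemma vertical_part_field_deriv:
  assumes "x \<in> overlap c t" "open W" "(x, y) \<in> W" "smooth_on W Z"
  obtains V' where "((\<lambda>w. vertical_part B c t w (Z w)) has_derivative V') (at (x, y))"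
proof -
  have Z: "(Z has_derivative frechet_derivative Z (at (x, y))) (at (x, y))"
    using smooth_onD(2)[OF assms(4,3)] .
  have "((\<lambda>w. fibre_conn B c t (fst w) (fst (Z w)) (snd w)) has_derivative
     (\<lambda>h. frechet_derivative (\<lambda>x'. fibre_conn B c t x' (fst (Z (x, y))) (snd (x, y))) (at (fst (x, y))) (fst h) +
       fibre_conn B c t (fst (x, y)) (fst (frechet_derivative Z (at (x, y)) h)) (snd (x, y)) +
       fibre_conn B c t (fst (x, y)) (fst (Z (x, y))) (snd h))) (at (x, y))"
    by (rule has_derivative_bilinear_family[OF open_overlap[OF c t] _ conn_smooth[OF c t] conn_bilinear[OF c t]])
      (use assms(1) Z in \<open>auto intro!: derivative_intros\<close>)
  from has_derivative_add[OF has_derivative_snd[OF Z] this]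
  show ?thesis by (rule that[unfolded vertical_part_def])
qed

text \<open>Differentiating \<open>G(Z, y\<^sup>\<alpha> e\<^sub>\<alpha>) = 0\<close> along \<open>Z\<close>: the covariant derivative of the radial vector in the
  direction \<open>X\<close> is the vertical part of \<open>X\<close>.\<close>

lemma second_form_constant_spheres:
  fixes r :: real
  defines "Y \<equiv> coord_image B c t (spheres (\<lambda>_. r))"
  assumes z: "z \<in> Y" and \<nu>: "outward_unit_normal B c t (spheres (\<lambda>_. r)) z \<nu>"
    and W: "open W" "z \<in> W" "smooth_on W Z"
    and tan: "\<And>w. w \<in> W \<inter> Y \<Longrightarrow> Z w \<in> tangent_vectors Y w"
  shows "- sasaki_metric B c t z (sasaki_connection B c t z (Z z) Z) \<nu> \<ge> 0"
proof -
  obtain x y where xy: "z = (x, y)" by (cases z)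
  have im: "Y = {z. fst z \<in> overlap c t \<and> snd z \<noteq> 0 \<and>
     ln (local_fibre_metric B c t (fst z) (snd z) (snd z)) / 2 - r = 0}"
    unfolding Y_def using coord_image_spheres[OF c t, of "\<lambda>_. r"] by simp
  have x: "x \<in> overlap c t" "y \<noteq> 0" using z unfolding im xy by auto
  define g where "g = local_fibre_metric B c t"
  note bil = metric_bilinear[OF c t x(1), folded g_def]
  note sym = metric_sym[OF c t x(1), folded g_def]
  have gy: "g x y y > 0" unfolding g_def by (rule metric_pos[OF c t x])
  have g0: "grad (\<lambda>_. r) x' = 0" for x' :: 'a by (simp add: grad_def frechet_derivative_const)
  have T: "tangent_vectors Y (x', y') = {X. g x' (vertical_part B c t (x', y') X) y' = 0}"
    if "(x', y') \<in> Y" for x' y'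
    using tangent_vectors_spheres[OF c t smooth_on_const that[unfolded Y_def]]
    by (simp add: Y_def g_def g0)
  define nh nv where "nh = fst \<nu>" and "nv = vertical_part B c t z \<nu>"
  note base = base_metric_props[OF c subsetD[OF overlap_subset x(1)]]
  have orth: "base_metric B c x (fst X) nh + g x (vertical_part B c t z X) nv = 0"
    if "g x (vertical_part B c t z X) y = 0" for X
  proof -
    have "X \<in> tangent_vectors Y z" using T[of x y] that z by (simp add: xy)
    then have "sasaki_metric B c t z X \<nu> = 0"
      using \<nu> unfolding outward_unit_normal_def Y_def by blast
    then show ?thesis by (simp add: sasaki_metric_def nh_def nv_def g_def xy)
  qed
  \<comment> \<open>The normal is known only through orthogonality relations. For constant radius
    horizontal vectors are tangent, and testing with the horizontal part of \<nu> itself shows that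
    this part vanishes.\<close>
  have "base_metric B c x nh nh = 0"
    using orth[of "frame_vector B c t z nh 0"] by (simp add: bilinear_lzero[OF bil]) (simp add: frame_vector_def)
  then have nh: "nh = 0" using base(3) by fastforce
  \<comment> \<open>The part \<open>v\<close> of the vertical component orthogonal to
    \<open>y\<close> is tangent, hence orthogonal to itself and zero. So \<nu> is \<open>l\<close>
    times the radial vector, and outwardness gives \<open>l > 0\<close>.\<close>
  define l where "l = g x nv y / g x y y"
  define v where "v = nv - l *\<^sub>R y"
  have vy: "g x v y = 0"
    using gy by (simp add: v_def l_def bilinear_lsub[OF bil] bilinear_lmul[OF bil])
  have "g x v nv = 0"
    using orth[of "(0, v)"] x vy by (simp add: xy bilinear_lzero[OF base(1)])
  then have "g x v v = 0"
    using vy by (subst (2) v_def) (simp add: bilinear_rsub[OF bil] bilinear_rmul[OF bil])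
  then have "v = 0" using metric_pos[OF c t x(1), of v] by (fastforce simp: g_def)
  then have nv: "nv = l *\<^sub>R y" by (simp add: v_def)
  have "sasaki_metric B c t z (0, y) \<nu> > 0"
    using \<nu> by (simp add: outward_unit_normal_def xy)
  then have "l * g x y y > 0"
    using x by (simp add: sasaki_metric_def xy bilinear_lzero[OF base(1)] nv[unfolded nv_def xy] g_def[symmetric]
        bilinear_rmul[OF bil])
  then have l: "l > 0" using gy by (simp add: zero_less_mult_iff)
  define V where "V w = vertical_part B c t w (Z w)" for w
  obtain V' where V': "(V has_derivative V') (at (x, y))"
    using vertical_part_field_deriv[OF x(1) W(1) W(2)[unfolded xy] W(3)] unfolding V_def by blast
  define X where "X = Z z"
  have d: "((\<lambda>w. g (fst w) (V w) (snd w)) has_derivative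
     (\<lambda>h. frechet_derivative (\<lambda>x'. g x' (V (x, y)) (snd (x, y))) (at (fst (x, y))) (fst h) +
       g (fst (x, y)) (V' h) (snd (x, y)) + g (fst (x, y)) (V (x, y)) (snd h))) (at (x, y))"
    unfolding g_def
    by (rule has_derivative_bilinear_family[OF open_overlap[OF c t] _ metric_smooth[OF c t] metric_bilinear[OF c t]])
      (use x V' in \<open>auto intro!: derivative_intros\<close>)
  have "X \<in> tangent_vectors Y (x, y)" using tan[of z] W z by (simp add: X_def xy)
  \<comment> \<open>Tangency of \<open>Z\<close> is known only on \<open>Y\<close>, so the
    orthogonality to the radial vector is differentiated along a curve in \<open>Y\<close> with
    velocity \<open>Z z\<close>.\<close>
  then obtain \<gamma> \<epsilon> where g: "\<epsilon> > 0" "\<gamma> 0 = (x, y)" "\<And>s. s \<in> {-\<epsilon><..<\<epsilon>} \<Longrightarrow> \<gamma> s \<in> Y"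
      "(\<gamma> has_vector_derivative X) (at (0::real))"
    unfolding tangent_vectors_def by blast
  have "\<forall>\<^sub>F s in nhds 0. \<gamma> s \<in> W"
    using has_vector_derivative_continuous[OF g(4)] W(1,2) g(2) xy
    by (metis isCont_def tendsto_at_iff_tendsto_nhds topological_tendstoD)
  moreover have "\<forall>\<^sub>F s in nhds 0. \<gamma> s \<in> Y" by (rule eventually_nhds_0[OF g(1,3)])
  ultimately have ev: "\<forall>\<^sub>F s in nhds 0. 0 = g (fst (\<gamma> s)) (V (\<gamma> s)) (snd (\<gamma> s))"
  proof eventually_elim
    case (elim s)
    then show ?case using tan[of "\<gamma> s"] T[of "fst (\<gamma> s)" "snd (\<gamma> s)"] by (simp add: V_def)
  qed
  have "((\<lambda>s. g (fst (\<gamma> s)) (V (\<gamma> s)) (snd (\<gamma> s))) has_vector_derivative 0) (at 0)"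
    by (rule has_vector_derivative_eventually_cong[OF has_vector_derivative_const ev])
  moreover have "((\<lambda>s. g (fst (\<gamma> s)) (V (\<gamma> s)) (snd (\<gamma> s))) has_vector_derivative
     (frechet_derivative (\<lambda>x'. g x' (V z) y) (at x) (fst X) + g x (V' X) y + g x (V z) (snd X))) (at 0)"
    using has_derivative_along_curve[OF _ g(4), of "\<lambda>w. g (fst w) (V w) (snd w)"] d by (simp add: g(2) xy)
  ultimately have "frechet_derivative (\<lambda>x'. g x' (V z) y) (at x) (fst X) + g x (V' X) y + g x (V z) (snd X) = 0"
    using vector_derivative_unique_at by blast
  then have "g x (fibre_conn B c t x (fst X) (V z)) y + g x (V z) (fibre_conn B c t x (fst X) y)
     + g x (V' X) y + g x (V z) (snd X) = 0"
    using metric_conn[OF c t x(1), of "V z" y "fst X"] by (simp add: g_def)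
  moreover have "V z = snd X + fibre_conn B c t x (fst X) y"
    by (simp add: V_def X_def vertical_part_def xy)
  then have "g x (V z) (V z) = g x (V z) (snd X) + g x (V z) (fibre_conn B c t x (fst X) y)"
    by (metis bilinear_radd[OF bil])
  ultimately have key: "g x (V' X + fibre_conn B c t x (fst X) (V z)) y = - g x (V z) (V z)"
    by (simp add: bilinear_ladd[OF bil])
  have fd: "frechet_derivative V (at z) = V'" using frechet_derivative_at[OF V'] xy by simp
  have "sasaki_metric B c t z (sasaki_connection B c t z X Z) \<nu> =
      l * g x (V' X + fibre_conn B c t x (fst X) (V z)) y"
    unfolding sasaki_connection_def sasaki_metric_def vertical_part_frame nh_def[symmetric] nv_def[symmetric]
      fd[unfolded V_def[abs_def]]
    by (simp add: nh nv xy bilinear_rzero[OF base(1)] g_def[symmetric] bilinear_rmul[OF bil] V_def)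
  also have "\<dots> = - (l * g x (V z) (V z))" by (simp add: key)
  also have "g x (V z) (V z) \<ge> 0"
    using metric_pos[OF c t x(1), of "V z"] bilinear_lzero[OF bil] by (cases "V z = 0") (auto simp: g_def)
  then have "- (l * g x (V z) (V z)) \<le> 0" using l by simp
  finally show ?thesis by (simp add: X_def)
qed

text \<open>The horizontal fields tangent to \<open>spheres f\<close> have second fundamental form
  \<open>- (\<nabla>\<^sup>2 f + df \<otimes> df)\<close> up to a positive factor.\<close>

lemma convex_imp_hessian_nonpos:
  assumes f: "smooth_on (overlap c t) (\<lambda>x. f (point c x))"
    and conv: "convex_radial_graph B (spheres f)"
    and x: "x \<in> overlap c t"
  defines "fb \<equiv> \<lambda>x. f (point c x)"
  shows "frechet_derivative (grad fb) (at x) a \<bullet> a \<le> grad fb x \<bullet> base_conn B c x a a"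
proof -
  define g where "g = local_fibre_metric B c t"
  note bil = metric_bilinear[OF c t x, folded g_def]
  note base = base_metric_props[OF c subsetD[OF overlap_subset x]]
  note fs = f[folded fb_def]
  have o: "open (overlap c t)" by (rule open_overlap[OF c t])
  define q where "q = grad fb x"
  define H where "H = frechet_derivative (grad fb) (at x)"
  have H: "(grad fb has_derivative H) (at x)"
    unfolding H_def using smooth_onD(2)[OF smooth_on_grad[OF fs o] x] .
  obtain b :: 'b where b: "b \<in> Basis" using nonempty_Basis by blast
  have gb: "g x b b > 0" unfolding g_def by (rule metric_pos[OF c t x nonzero_Basis[OF b]])
  \<comment> \<open>One vector of length \<open>exp (fb x)\<close> over \<open>x\<close> is enough:
    the resulting inequality involves the base only.\<close>
  define y where "y = (exp (fb x) / sqrt (g x b b)) *\<^sub>R b"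
  have y0: "y \<noteq> 0" using gb b by (auto simp: y_def)
  have gy: "g x y y = exp (fb x) * exp (fb x)"
    using gb by (simp add: y_def g_def metric_scale[OF c t x])
  then have gyp: "g x y y > 0" by simp
  define z where "z = (x, y)"
  define Y where "Y = coord_image B c t (spheres f)"
  note im = coord_image_spheres[OF c t f, folded fb_def g_def Y_def]
  have zY: "z \<in> Y" unfolding im z_def using x y0 gy by (simp add: ln_mult fb_def)
  have T: "tangent_vectors Y (x', y') = {X. g x' (vertical_part B c t (x', y') X) y' = (grad fb x' \<bullet> fst X) * g x' y' y'}"
    if "(x', y') \<in> Y" for x' y'
    using tangent_vectors_spheres[OF c t f that[unfolded Y_def]] by (simp add: Y_def g_def fb_def)
  define W where "W = overlap c t \<times> (UNIV :: 'b set)"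
  \<comment> \<open>The horizontal lift of the constant field \<open>a\<close>, plus the multiple of
    the radial vector that the varying radius demands for tangency to \<open>Y\<close>.\<close>
  define Z where "Z w = (a, (grad fb (fst w) \<bullet> a) *\<^sub>R snd w - fibre_conn B c t (fst w) a (snd w))" for w
  have oW: "open W" unfolding W_def by (intro open_Times o open_UNIV)
  have s1: "smooth_on W (fst :: 'a \<times> 'b \<Rightarrow> 'a)" "smooth_on W (snd :: 'a \<times> 'b \<Rightarrow> 'b)"
    by (auto intro: smooth_on_bounded_linear bounded_linear_fst bounded_linear_snd)
  have s2: "smooth_on W (\<lambda>w. grad fb (fst w))"
    by (rule smooth_on_compose[OF smooth_on_grad[OF fs o] s1(1) oW o]) (auto simp: W_def)
  have s3: "smooth_on W (\<lambda>w. fibre_conn B c t (fst w) a (snd w))"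
    by (rule smooth_on_bilinear_family[OF oW o conn_smooth[OF c t] conn_bilinear[OF c t] s1(1) smooth_on_const s1(2)])
      (auto simp: W_def)
  have sZ: "smooth_on W Z"
    unfolding Z_def
    by (intro smooth_on_Pair smooth_on_diff smooth_on_scaleR smooth_on_inner smooth_on_const s1(2) s2 s3 oW)
  have vZ: "vertical_part B c t w (Z w) = (grad fb (fst w) \<bullet> a) *\<^sub>R snd w" for w
    by (simp add: vertical_part_def Z_def)
  have tanZ: "Z w \<in> tangent_vectors Y w" if "w \<in> W \<inter> Y" for w
  proof -
    obtain x' y' where w: "w = (x', y')" by (cases w)
    have x': "x' \<in> overlap c t" using that w by (simp add: W_def)
    have "g x' ((grad fb x' \<bullet> a) *\<^sub>R y') y' = (grad fb x' \<bullet> a) * g x' y' y'"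
      using bilinear_lmul[OF metric_bilinear[OF c t x']] by (simp add: g_def)
    then have "g x' (vertical_part B c t (x', y') (Z (x', y'))) y' = (grad fb x' \<bullet> fst (Z (x', y'))) * g x' y' y'"
      unfolding vZ by (simp add: Z_def)
    then show ?thesis using T[of x' y'] that unfolding w by blast
  qed
  \<comment> \<open>The Riemannian gradient of \<open>fb\<close> at \<open>x\<close>.\<close>
  obtain n where n: "\<And>h. base_metric B c x n h = q \<bullet> h"
    using riesz_bilinear[OF base(1) base(3)] by blast
  \<comment> \<open>The vector with horizontal part \<open>- n\<close> and vertical part
    \<open>y / g x y y\<close> is normal to \<open>Y\<close> and points outward; \<open>m\<close> is
    its squared length and \<mu> normalizes it.\<close>
  define m where "m = base_metric B c x n n + 1 / g x y y"
  have "base_metric B c x n n \<ge> 0"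
    using base(3)[of n] bilinear_lzero[OF base(1)] by (cases "n = 0") auto
  then have m: "m > 0" using gyp by (simp add: m_def add_nonneg_pos)
  define \<mu> where "\<mu> = 1 / sqrt m"
  have \<mu>: "\<mu> > 0" "\<mu> * \<mu> * m = 1" using m by (auto simp: \<mu>_def field_simps)
  define \<nu> where "\<nu> = frame_vector B c t z (- \<mu> *\<^sub>R n) ((\<mu> / g x y y) *\<^sub>R y)"
  have fst\<nu>: "fst \<nu> = - \<mu> *\<^sub>R n" by (simp add: \<nu>_def frame_vector_def)
  have G\<nu>: "sasaki_metric B c t z X \<nu> = - \<mu> * (q \<bullet> fst X) + (\<mu> / g x y y) * g x (vertical_part B c t z X) y" for X
  proof -
    have "base_metric B c x (fst X) (- \<mu> *\<^sub>R n) = - \<mu> * (q \<bullet> fst X)"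
      using n[of "fst X"] base(2)[of "fst X" n] bilinear_rmul[OF base(1), of "fst X" "- \<mu>" n] by simp
    then show ?thesis
      unfolding sasaki_metric_def fst\<nu>
      by (simp add: \<nu>_def z_def bilinear_rmul[OF bil] g_def[symmetric])
  qed
  have "outward_unit_normal B c t (spheres f) z \<nu>"
    unfolding outward_unit_normal_def Y_def[symmetric]
  proof (intro conjI ballI)
    have "sasaki_metric B c t z \<nu> \<nu> = \<mu> * \<mu> * (q \<bullet> n) + (\<mu> / g x y y) * ((\<mu> / g x y y) * g x y y)"
      unfolding G\<nu> fst\<nu> by (simp add: \<nu>_def bilinear_lmul[OF bil])
    also have "\<dots> = \<mu> * \<mu> * m" using gyp by (simp add: m_def n distrib_left)
    finally show "sasaki_metric B c t z \<nu> \<nu> = 1" using \<mu> by simp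
    show "sasaki_metric B c t z X \<nu> = 0" if "X \<in> tangent_vectors Y z" for X
    proof -
      have "g x (vertical_part B c t z X) y = (q \<bullet> fst X) * g x y y"
        using that T[of x y] zY by (simp add: z_def q_def)
      then show ?thesis using gyp by (simp add: G\<nu>)
    qed
    have "vertical_part B c t z (0, snd z) = y" using x by (simp add: z_def)
    then show "0 < sasaki_metric B c t z (0, snd z) \<nu>"
      unfolding G\<nu> using gyp \<mu>(1) by simp
  qed
  then have "- sasaki_metric B c t z (sasaki_connection B c t z (Z z) Z) \<nu> \<ge> 0"
    by (intro convex_radial_graphD[OF conv c t zY[unfolded Y_def] _ oW _ sZ])
      (use tanZ x in \<open>auto simp: Y_def z_def W_def\<close>)
  \<comment> \<open>Differentiating the vertical part of \<open>Z\<close> along \<open>Z\<close>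
    produces a \<open>fibre_conn\<close> term that the connection term of
    \<open>sasaki_connection\<close> cancels. What is left is a multiple of the radial vector and
    the horizontal vector \<open>base_conn B c x a a\<close>.\<close>
  moreover have "sasaki_metric B c t z (sasaki_connection B c t z (Z z) Z) \<nu> =
     \<mu> * (H a \<bullet> a + (q \<bullet> a)\<^sup>2 - q \<bullet> base_conn B c x a a)"
  proof -
    have "(fst has_derivative fst) (at z)" "(snd has_derivative snd) (at z)"
      by (auto intro!: derivative_eq_intros)
    then have d1: "((\<lambda>w. grad fb (fst w)) has_derivative (\<lambda>X. H (fst X))) (at z)"
      using has_derivative_compose[of fst fst z UNIV "grad fb" H] H by (simp add: z_def)
    have "((\<lambda>w. (grad fb (fst w) \<bullet> a) *\<^sub>R snd w) has_derivative
       (\<lambda>X. (grad fb (fst z) \<bullet> a) *\<^sub>R snd X + (H (fst X) \<bullet> a) *\<^sub>R snd z)) (at z)"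
      by (intro has_derivative_scaleR has_derivative_inner_left d1 \<open>(snd has_derivative snd) (at z)\<close>)
    from frechet_derivative_at[OF this]
    have fd: "frechet_derivative (\<lambda>w. (grad fb (fst w) \<bullet> a) *\<^sub>R snd w) (at z) (Z z) =
       (q \<bullet> a) *\<^sub>R ((q \<bullet> a) *\<^sub>R y - fibre_conn B c t x a y) + (H a \<bullet> a) *\<^sub>R y"
      by (simp add: z_def q_def Z_def fun_eq_iff)
    have fd0: "frechet_derivative (\<lambda>w. fst (Z w)) (at z) (Z z) = 0"
      by (simp add: Z_def frechet_derivative_const)
    have "fibre_conn B c t x a ((q \<bullet> a) *\<^sub>R y) = (q \<bullet> a) *\<^sub>R fibre_conn B c t x a y"
      by (rule bilinear_rmul[OF conn_bilinear[OF c t x]])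
    then have sc: "sasaki_connection B c t z (Z z) Z =
       frame_vector B c t z (base_conn B c x a a) ((H a \<bullet> a + (q \<bullet> a)\<^sup>2) *\<^sub>R y)"
      unfolding sasaki_connection_def vZ fd fd0
      by (simp add: z_def q_def[symmetric] Z_def algebra_simps power2_eq_square)
    have "g x ((H a \<bullet> a + (q \<bullet> a)\<^sup>2) *\<^sub>R y) y = (H a \<bullet> a + (q \<bullet> a)\<^sup>2) * g x y y"
      using bilinear_lmul[OF bil] by simp
    moreover have "fst (frame_vector B c t z h k) = h" for h k by (simp add: frame_vector_def)
    ultimately show ?thesis
      unfolding G\<nu> sc vertical_part_frame using gyp by (simp add: algebra_simps)
  qed
  ultimately have "H a \<bullet> a + (q \<bullet> a)\<^sup>2 - q \<bullet> base_conn B c x a a \<le> 0"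
    using \<mu>(1) by (simp add: mult_le_0_iff)
  \<comment> \<open>The square \<open>(q \<bullet> a)\<^sup>2\<close>, the contribution of
    \<open>df \<otimes> df\<close>, is nonnegative and may be dropped.\<close>
  then show ?thesis
    using zero_le_power2[of "q \<bullet> a"] unfolding q_def[symmetric] H_def[symmetric] by linarith
qed

end

lemma convex_constant_spheres:
  assumes "radial_graph B (spheres (\<lambda>_. r))"
  shows "convex_radial_graph B (spheres (\<lambda>_. r))"
  unfolding convex_radial_graph_def
  using assms second_form_constant_spheres by blast

text \<open>The Hessian inequality holds in every direction, so it may be summed over the coordinate
  basis, which is elliptic with constant 1 whatever the base metric is. The Christoffel terms are
  bounded by the gradient. The set where \<open>f\<close> attains its minimum on the compact base is
  therefore open as well as closed, and the base is connected.\<close>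

theorem convex_spheres_imp_constant:
  assumes f: "\<And>c t. c \<in> charts B \<Longrightarrow> t \<in> trivs B \<Longrightarrow> smooth_on (overlap c t) (\<lambda>x. f (point c x))"
    and conv: "convex_radial_graph B (spheres f)"
  shows "f p = f q"
proof -
  have cont: "isCont f p" for p
  proof -
    obtain c t where ct: "c \<in> charts B" "t \<in> trivs B" "p \<in> fst c" "p \<in> fst t"
      by (rule bundle_point_cases)
    have o: "open (fst c \<inter> fst t)" using open_chart[OF ct(1)] open_triv[OF ct(2)] by auto
    have "continuous_on (fst c \<inter> fst t) (\<lambda>p. f (point c (snd c p)))"
      by (rule continuous_on_compose2[OF smooth_onD(3)[OF f[OF ct(1,2)]] continuous_on_subset[OF continuous_on_chart[OF ct(1)]]])
        (auto simp: overlap_def)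
    then have "continuous_on (fst c \<inter> fst t) f"
      by (rule continuous_on_eq) (simp add: point(3)[OF ct(1)])
    then show ?thesis using o ct by (simp add: continuous_on_eq_continuous_at)
  qed
  then have cf: "continuous_on UNIV f" by (simp add: continuous_at_imp_continuous_on)
  obtain p0 where p0: "\<And>p. f p0 \<le> f p"
    using continuous_attains_inf[OF bundleD(8) _ cf] by auto
  define A where "A = {p. f p = f p0}"
  have "closed A" unfolding A_def
    by (rule closed_Collect_eq[OF cf continuous_on_const])
  moreover have "open A"
  proof (subst openin_subopen[where U = euclidean, unfolded open_openin[symmetric]], intro ballI)
    fix p1 assume p1: "p1 \<in> A"
    obtain c t where ct: "c \<in> charts B" "t \<in> trivs B" "p1 \<in> fst c" "p1 \<in> fst t"
      by (rule bundle_point_cases)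
    define fb where "fb x = f (point c x)" for x
    note o = open_overlap[OF ct(1,2)]
    note fs = f[OF ct(1,2), folded fb_def]
    define x0 where "x0 = snd c p1"
    have x0: "x0 \<in> overlap c t" unfolding x0_def by (rule overlapI[OF ct])
    then obtain r where r: "r > 0" "cball x0 r \<subseteq> overlap c t" using o open_contains_cball by blast
    have rb: "x \<in> overlap c t" if "x \<in> ball x0 r" for x using that r by (meson ball_subset_cball subsetD)
    \<comment> \<open>By the Cauchy-Schwarz inequality \<open>N x\<close> bounds the sum of the
      Christoffel terms relative to the gradient; it is bounded on the closed ball by
      compactness.\<close>
    define N where "N x = (\<Sum>b\<in>Basis. norm (base_conn B c x b b))" for x
    have "continuous_on (cball x0 r) N"
      unfolding N_def
      by (intro continuous_on_sum continuous_on_norm continuous_on_subset[OF smooth_onD(3)[OF base_conn_smooth[OF ct(1)]]])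
        (use r overlap_subset in blast)
    then have "bounded (N ` cball x0 r)" by (intro compact_imp_bounded compact_continuous_image compact_cball)
    then obtain M where M: "\<And>x. x \<in> cball x0 r \<Longrightarrow> norm (N x) \<le> M"
      unfolding bounded_iff by blast
    have const: "fb q = fb x0" if "q \<in> ball x0 (r / 2)" for q
    proof (rule strong_minimum_principle_local[where g = "grad fb" and g' = "\<lambda>x. frechet_derivative (grad fb) (at x)"
          and r = r and l = 1 and C = "\<bar>M\<bar> + DIM('a)"])
      fix x assume x: "x \<in> ball x0 r"
      show "(fb has_derivative (\<lambda>w. grad fb x \<bullet> w)) (at x)"
        by (rule has_derivative_grad[OF smooth_onD(1)[OF fs rb[OF x]]])
      show "(grad fb has_derivative frechet_derivative (grad fb) (at x)) (at x)"
        by (rule smooth_onD(2)[OF smooth_on_grad[OF fs o] rb[OF x]])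
      show "fb x0 \<le> fb x"
        using p1 p0 by (simp add: fb_def x0_def point(3)[OF ct(1,3)] A_def)
      have "(\<Sum>b\<in>Basis. frechet_derivative (grad fb) (at x) b \<bullet> b) \<le> (\<Sum>b\<in>Basis. grad fb x \<bullet> base_conn B c x b b)"
        using convex_imp_hessian_nonpos[OF ct(1,2) f[OF ct(1,2)] conv rb[OF x]]
        by (intro sum_mono) (simp add: fb_def[abs_def])
      also have "\<dots> \<le> (\<Sum>b\<in>Basis. norm (grad fb x) * norm (base_conn B c x b b))"
        by (intro sum_mono norm_cauchy_schwarz)
      also have "\<dots> = norm (grad fb x) * N x" by (simp add: N_def sum_distrib_left)
      also have "\<dots> \<le> norm (grad fb x) * (\<bar>M\<bar> + DIM('a))"
        using M[of x] x by (intro mult_left_mono) (auto simp: less_imp_le)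
      finally have "(\<Sum>b\<in>Basis. frechet_derivative (grad fb) (at x) b \<bullet> b) \<le> (\<bar>M\<bar> + DIM('a)) * norm (grad fb x)"
        by (simp add: mult.commute)
      moreover have "(norm w)\<^sup>2 = (\<Sum>b\<in>Basis. (b \<bullet> w)\<^sup>2)" for w :: 'a
        unfolding power2_norm_eq_inner by (subst euclidean_inner) (simp add: power2_eq_square inner_commute)
      ultimately show "\<exists>P. finite P \<and> (\<Sum>p\<in>P. frechet_derivative (grad fb) (at x) p \<bullet> p) \<le> (\<bar>M\<bar> + DIM('a)) * norm (grad fb x) \<and>
        (\<Sum>p\<in>P. (norm p)\<^sup>2) \<le> \<bar>M\<bar> + DIM('a) \<and> (\<forall>w. 1 * (norm w)\<^sup>2 \<le> (\<Sum>p\<in>P. (p \<bullet> w)\<^sup>2))"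
        by (intro exI[of _ Basis]) simp
    qed (use that in auto)
    define U where "U = {p \<in> fst c. snd c p \<in> ball x0 (r / 2)}"
    have "f p = f p0" if p: "p \<in> U" for p
    proof -
      have "fb (snd c p) = fb x0" using const p by (simp add: U_def)
      moreover have "fb (snd c p) = f p" "fb x0 = f p1"
        using p point(3)[OF ct(1)] ct(3) by (auto simp: fb_def x0_def U_def)
      ultimately show ?thesis using p1 by (simp add: A_def)
    qed
    then have "U \<subseteq> A" by (auto simp: A_def)
    moreover have "open U"
      using continuous_open_preimage[OF continuous_on_chart[OF ct(1)] open_chart[OF ct(1)] open_ball, of x0 "r / 2"]
      by (simp add: U_def vimage_def Int_def)
    moreover have "p1 \<in> U" using r ct by (simp add: U_def x0_def)
    ultimately show "\<exists>T. open T \<and> p1 \<in> T \<and> T \<subseteq> A" by blast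
  qed
  moreover have "p0 \<in> A" by (simp add: A_def)
  ultimately have "A = UNIV"
    using bundleD(9) connected_clopen[of "UNIV :: 'p set"] by auto
  then have "p \<in> A" "q \<in> A" by auto
  then show ?thesis by (simp add: A_def)
qed

end

section \<open>Invariance under linear isometries\<close>

lemma tangent_vectors_linear_image:
  fixes R :: "'b::euclidean_space \<Rightarrow> 'b"
  assumes "linear R" "v \<in> tangent_vectors S z"
  shows "R v \<in> tangent_vectors (R ` S) (R z)"
proof -
  have bl: "bounded_linear R" using assms(1) by (simp add: linear_conv_bounded_linear)
  obtain \<gamma> \<epsilon> where g: "\<epsilon> > 0" "smooth_on {-\<epsilon><..<\<epsilon>} \<gamma>" "\<gamma> 0 = z" "\<And>s. s \<in> {-\<epsilon><..<\<epsilon>} \<Longrightarrow> \<gamma> s \<in> S"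
      "(\<gamma> has_vector_derivative v) (at (0::real))"
    using assms(2) unfolding tangent_vectors_def by blast
  have "smooth_on {-\<epsilon><..<\<epsilon>} (\<lambda>s. R (\<gamma> s))" by (rule smooth_on_linear_compose[OF bl g(2)]) simp
  moreover have "((\<lambda>s. R (\<gamma> s)) has_vector_derivative R v) (at 0)"
    by (rule bounded_linear.has_vector_derivative[OF bl g(5)])
  moreover have "R (\<gamma> 0) = R z" by (simp add: g(3))
  moreover have "\<forall>s\<in>{-\<epsilon><..<\<epsilon>}. R (\<gamma> s) \<in> R ` S" using g(4) by blast
  ultimately show ?thesis unfolding tangent_vectors_def using g(1) by blast
qed

text \<open>All data are transported: the normal field becomes its conjugate by \<open>R\<close>,
  the principal directions their images, with the same principal curvatures.\<close>

lemma has_gauss_curvature_orthogonal_image: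
  fixes R :: "'b::euclidean_space \<Rightarrow> 'b"
  assumes R: "orthogonal_transformation R" and curv: "has_gauss_curvature S z k"
  shows "has_gauss_curvature (R ` S) (R z) k"
proof -
  define Q where "Q = inv R"
  have "bij R" by (rule orthogonal_transformation_bij[OF R])
  then have QR [simp]: "Q (R x) = x" and RQ [simp]: "R (Q x) = x" for x
    by (auto simp: Q_def bij_is_inj bij_is_surj surj_f_inv_f)
  have Q: "orthogonal_transformation Q" unfolding Q_def by (rule orthogonal_transformation_inv[OF R])
  have lin: "linear R" "linear Q" and blin: "bounded_linear R" "bounded_linear Q"
    using R Q by (auto simp: orthogonal_transformation_def linear_conv_bounded_linear)
  have RR: "R x \<bullet> R y = x \<bullet> y" for x y using R by (simp add: orthogonal_transformation_def)
  have normR: "norm (R x) = norm x" for x by (rule orthogonal_transformation_norm[OF R])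
  have T: "tangent_vectors (R ` S) (R y) = R ` tangent_vectors S y" for y
  proof (intro equalityI subsetI)
    fix v assume "v \<in> tangent_vectors (R ` S) (R y)"
    then have "Q v \<in> tangent_vectors (Q ` R ` S) (Q (R y))" by (rule tangent_vectors_linear_image[OF lin(2)])
    then have "Q v \<in> tangent_vectors S y" by (simp add: image_image)
    then show "v \<in> R ` tangent_vectors S y" by (intro image_eqI[of _ _ "Q v"]) simp_all
  qed (auto intro: tangent_vectors_linear_image[OF lin(1)])
  from curv obtain W N N' P \<kappa> where z: "z \<in> S" "z \<in> W" and N: "outward_normal_field S W N"
    and N': "(N has_derivative N') (at z)"
    and P: "pairwise orthogonal P" "\<And>p. p \<in> P \<Longrightarrow> norm p = 1" "span P = tangent_vectors S z"
    and \<kappa>: "\<And>p. p \<in> P \<Longrightarrow> N' p = \<kappa> p *\<^sub>R p" "k = (\<Prod>p\<in>P. \<kappa> p)"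
    unfolding has_gauss_curvature_def by blast
  have oW: "open W" and sN: "smooth_on W N" using N by (auto simp: outward_normal_field_def)
  have RW: "R ` W = Q -` W" by (auto intro: image_eqI[of _ R "Q _"])
  have cQ: "continuous_on UNIV Q" using blin(2) linear_continuous_on by blast
  have oRW: "open (R ` W)"
    unfolding RW using continuous_open_preimage[OF cQ open_UNIV oW] by simp
  have "outward_normal_field (R ` S) (R ` W) (\<lambda>y. R (N (Q y)))"
    unfolding outward_normal_field_def
  proof (intro conjI ballI oRW)
    show "smooth_on (R ` W) (\<lambda>y. R (N (Q y)))"
      by (intro smooth_on_linear_compose[OF blin(1)] oRW
          smooth_on_compose[OF sN smooth_on_bounded_linear[OF blin(2)] oRW oW]) auto
    fix y assume "y \<in> R ` S \<inter> R ` W"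
    then obtain s where s: "y = R s" "s \<in> S" "s \<in> W"
      by auto (metis QR)
    show "norm (R (N (Q y))) = 1" "R (N (Q y)) \<bullet> y > 0"
      using N s by (auto simp: outward_normal_field_def normR RR)
    fix v assume "v \<in> tangent_vectors (R ` S) y"
    then obtain w where "w \<in> tangent_vectors S s" "v = R w" using T[of s] s(1) by blast
    then show "R (N (Q y)) \<bullet> v = 0" using N s by (simp add: outward_normal_field_def RR)
  qed
  moreover have "((\<lambda>y. R (N (Q y))) has_derivative (\<lambda>w. R (N' (Q w)))) (at (R z))"
    by (rule bounded_linear.has_derivative[OF blin(1)],
        rule has_derivative_compose[OF bounded_linear_imp_has_derivative[OF blin(2)]]) (simp add: N')
  moreover have "pairwise orthogonal (R ` P)"
    using P(1) by (auto simp: pairwise_def orthogonal_def RR)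
  moreover have "\<forall>p\<in>R ` P. norm p = 1" using P(2) by (simp add: normR)
  moreover have "span (R ` P) = tangent_vectors (R ` S) (R z)"
    unfolding T P(3)[symmetric] by (rule linear_span_image[OF lin(1)])
  moreover have "\<forall>p\<in>R ` P. R (N' (Q p)) = \<kappa> (Q p) *\<^sub>R p"
    using \<kappa>(1) linear_cmul[OF lin(1)] by auto
  moreover have "k = (\<Prod>p\<in>R ` P. \<kappa> (Q p))"
    unfolding \<kappa>(2) using \<open>bij R\<close> by (subst prod.reindex) (auto intro: inj_on_subset[OF bij_is_inj])
  moreover have "R z \<in> R ` S" "R z \<in> R ` W" using z by auto
  ultimately show ?thesis
    unfolding has_gauss_curvature_def
    by (intro conjI exI[of _ "R ` W"] exI[of _ "\<lambda>y. R (N (Q y))"] exI[of _ "\<lambda>w. R (N' (Q w))"]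
        exI[of _ "R ` P"] exI[of _ "\<lambda>p. \<kappa> (Q p)"])
qed

lemma power_int_one_minus: "m > 0 \<Longrightarrow> r powi (1 - int m) = (1 / r) ^ (m - 1)" for r :: real
  by (cases "m = 1") (auto simp: power_int_def nat_diff_distrib inverse_eq_divide of_nat_diff)

section \<open>Curvature of fibres, smoothness over the base and homothety\<close>

context metric_vector_bundle
begin

text \<open>The vertical curvature condition supplies an isometry \<open>M\<close> that may differ
  from point to point, whereas a fibre has to be studied as one hypersurface. Two isometries of a
  fibre differ by an orthogonal map, which preserves the curvature.\<close>

lemma fibre_curvature:
  assumes u: "smooth_on_sphere_bundle B u"
    and K: "vertical_gauss_curvature_given_by B (radial u) K"
    and L: "fibre_isometry B p L" and z: "z \<in> star_graph.graph (fibre_height p L u)"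
  shows "has_gauss_curvature (star_graph.graph (fibre_height p L u)) z (K (lift p L z))"
proof -
  note im = image_radial[OF L u]
  define \<xi> where "\<xi> = lift p L z"
  have "\<xi> \<in> radial u" 
  proof -
    obtain \<eta> where "\<eta> \<in> radial u" "proj B \<eta> = p" "z = L \<eta>" using z im by (auto simp: fibre_def)
    then show ?thesis using lift_L[OF L] by (simp add: \<xi>_def)
  qed
  moreover have p: "proj B \<xi> = p" by (simp add: \<xi>_def proj_lift[OF L])
  ultimately obtain M where M: "fibre_isometry B p M"
    and curv: "has_gauss_curvature (M ` (radial u \<inter> fibre B p)) (M \<xi>) (K \<xi>)"
    using K unfolding vertical_gauss_curvature_given_by_def by metis
  define R where "R x = L (lift p M x)" for x
  have "orthogonal_transformation R"
    unfolding orthogonal_transformation_def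
  proof (intro conjI allI)
    show "linear R"
      by (rule linearI)
        (simp_all add: R_def lift_add[OF M] lift_scale[OF M] L_add[OF L] L_scale[OF L] proj_lift[OF M])
    fix x y
    have "L \<xi> \<bullet> L \<eta> = M \<xi> \<bullet> M \<eta>" if "proj B \<xi> = p" "proj B \<eta> = p" for \<xi> \<eta>
      using L M that by (simp add: fibre_isometry_def fibre_def)
    then show "R x \<bullet> R y = x \<bullet> y" by (simp add: R_def proj_lift[OF M] L_lift[OF M])
  qed
  from has_gauss_curvature_orthogonal_image[OF this curv]
  have "has_gauss_curvature (R ` M ` (radial u \<inter> fibre B p)) (R (M \<xi>)) (K \<xi>)" .
  moreover have "R (M \<eta>) = L \<eta>" if "proj B \<eta> = p" for \<eta>
    using that by (simp add: R_def lift_L[OF M])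
  then have "R ` M ` (radial u \<inter> fibre B p) = L ` (radial u \<inter> fibre B p)" "R (M \<xi>) = L \<xi>"
    using p by (auto simp: image_image fibre_def intro!: image_cong)
  ultimately show ?thesis by (simp add: im \<xi>_def L_lift[OF L])
qed

lemma smooth_on_sphere_bundle_base:
  assumes "\<And>c. c \<in> charts B \<Longrightarrow> smooth_on (snd c ` fst c) (\<lambda>x. f (point c x))"
  shows "smooth_on_sphere_bundle B (\<lambda>\<xi>. f (proj B \<xi>))"
proof -
  have "smooth_function_on B UNIV (\<lambda>\<xi>. f (proj B \<xi>))"
    unfolding smooth_function_on_def
  proof (intro ballI)
    fix c t assume ct: "c \<in> charts B" "t \<in> trivs B"
    have o: "open (overlap c t \<times> (UNIV :: 'b set))" by (intro open_Times open_overlap[OF ct] open_UNIV)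
    have "smooth_on (overlap c t \<times> (UNIV :: 'b set)) (\<lambda>z. f (point c (fst z)))"
      by (rule smooth_on_compose[OF assms[OF ct(1)] smooth_on_bounded_linear[OF bounded_linear_fst] o open_chart_image[OF ct(1)]])
        (auto intro: subsetD[OF overlap_subset])
    then have "smooth_on (overlap c t \<times> UNIV) (\<lambda>z. f (proj B (from_coords B c t z)))"
      by (rule smooth_on_cong[OF _ o]) (auto simp: from_coords[OF ct])
    then show "smooth_on (coords B c t ` (UNIV \<inter> proj B -` (fst c \<inter> fst t))) (\<lambda>z. f (proj B (from_coords B c t z)))"
      unfolding coords_image[OF ct] by simp
  qed
  then show ?thesis unfolding smooth_on_sphere_bundle_def by blast
qed

lemma radial_graph_spheres:
  assumes "\<And>c. c \<in> charts B \<Longrightarrow> smooth_on (snd c ` fst c) (\<lambda>x. f (point c x))"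
  shows "radial_graph B (spheres f)"
  using smooth_on_sphere_bundle_base[OF assms] radial_eq_spheres[of "\<lambda>\<xi>. f (proj B \<xi>)" f]
  unfolding radial_graph_iff by blast

text \<open>Normalizing a constant coordinate vector \<open>b\<close> gives a smooth unit section
  over the overlap, and \<open>f\<close> is the composite of \<open>u\<close> with that
  section.\<close>

lemma base_function_smooth:
  assumes u: "smooth_on_sphere_bundle B u"
    and f: "\<And>\<xi>. \<xi> \<in> unit_sphere_bundle B \<Longrightarrow> u \<xi> = f (proj B \<xi>)"
    and ct: "c \<in> charts B" "t \<in> trivs B"
  shows "smooth_on (overlap c t) (\<lambda>x. f (point c x))"
proof -
  obtain b :: 'b where b: "b \<in> Basis" using nonempty_Basis by blast
  define n where "n x = sqrt (local_fibre_metric B c t x b b)" for x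
  define h where "h x = (x, inverse (n x) *\<^sub>R b)" for x
  note o = open_overlap[OF ct]
  have pos: "local_fibre_metric B c t x b b > 0" if "x \<in> overlap c t" for x
    by (rule metric_pos[OF ct that nonzero_Basis[OF b]])
  then have n0: "n x > 0" if "x \<in> overlap c t" for x using that by (simp add: n_def)
  have sn: "smooth_on (overlap c t) n"
    unfolding n_def by (intro smooth_on_sqrt_compose metric_smooth[OF ct] o pos)
  have sh: "smooth_on (overlap c t) h"
    unfolding h_def
    by (intro smooth_on_Pair smooth_on_scaleR smooth_on_inverse_compose smooth_on_ident smooth_on_const o sn)
      (drule n0, simp)
  have unit: "from_coords B c t (h x) \<in> unit_sphere_bundle B" if x: "x \<in> overlap c t" for x
  proof -
    have "local_fibre_metric B c t x (inverse (n x) *\<^sub>R b) (inverse (n x) *\<^sub>R b) = 1"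
      using n0[OF x] pos[OF x] by (simp add: metric_scale[OF ct x] n_def field_simps)
    then show ?thesis
      by (simp add: unit_sphere_bundle_def h_def fibre_norm_from_coords[OF ct x])
  qed
  have "smooth_on (overlap c t) (\<lambda>x. u (from_coords B c t (h x)))"
    by (rule smooth_sphere_function_compose[OF ct u o sh]) (auto simp: h_def unit[unfolded h_def])
  then show ?thesis
    by (rule smooth_on_cong[OF _ o]) (simp add: f[OF unit], simp add: h_def from_coords[OF ct])
qed

text \<open>A rotationally symmetric bump in one chart is extended by 0 to the whole base.\<close>

lemma nonconstant_smooth_function:
  obtains f p q where "f p \<noteq> f q"
    "\<And>c. c \<in> charts B \<Longrightarrow> smooth_on (snd c ` fst c) (\<lambda>x. f (point c x) :: real)"
proof -
  fix p0 :: 'p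
  obtain c0 where c0: "c0 \<in> charts B" "p0 \<in> fst c0" by (rule chart_exists)
  define x0 where "x0 = snd c0 p0"
  have "x0 \<in> snd c0 ` fst c0" using c0(2) by (simp add: x0_def)
  then obtain r where r: "r > 0" "cball x0 r \<subseteq> snd c0 ` fst c0"
    using open_chart_image[OF c0(1)] open_contains_cball by blast
  define b where "b x = bump (r\<^sup>2 - (x - x0) \<bullet> (x - x0))" for x
  define f where "f p = (if p \<in> fst c0 then b (snd c0 p) else 0)" for p
  have sb: "smooth_on UNIV b"
    unfolding b_def
    by (rule smooth_on_compose[OF smooth_on_bump _ open_UNIV open_UNIV])
      (intro smooth_on_diff smooth_on_inner smooth_on_const smooth_on_ident open_UNIV UNIV_I)+
  have supp: "norm (x - x0) < r" if "b x \<noteq> 0" for x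
  proof -
    have "(norm (x - x0))\<^sup>2 < r\<^sup>2"
      using that by (simp add: b_def bump_def power2_norm_eq_inner split: if_splits)
    then show ?thesis using r(1) by (simp add: power2_less_imp_less)
  qed
  \<comment> \<open>The support lies in this compact set, which is closed since the base is
    Hausdorff. So every point outside the chart domain has a neighbourhood on which the extension
    vanishes.\<close>
  define C where "C = point c0 ` cball x0 r"
  have "compact C" unfolding C_def
    by (rule compact_continuous_image[OF continuous_on_subset[OF continuous_on_point[OF c0(1)] r(2)] compact_cball])
  then have clC: "closed C" by (rule compact_imp_closed)
  have fC: "f p = 0" if "p \<notin> C" for p
  proof (rule ccontr)
    assume "f p \<noteq> 0"
    then have "p \<in> fst c0" "b (snd c0 p) \<noteq> 0" by (auto simp: f_def split: if_splits)
    then have "snd c0 p \<in> cball x0 r" "p = point c0 (snd c0 p)"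
      using supp[of "snd c0 p"] point(3)[OF c0(1)] by (auto simp: dist_norm norm_minus_commute)
    then show False using that unfolding C_def by blast
  qed
  have "smooth_on (snd c ` fst c) (\<lambda>x. f (point c x))" if c: "c \<in> charts B" for c
  proof (rule smooth_on_local)
    fix x assume x: "x \<in> snd c ` fst c"
    define p where "p = point c x"
    have p: "p \<in> fst c" "x = snd c p" using point[OF c] x by (auto simp: p_def)
    show "\<exists>T. open T \<and> x \<in> T \<and> smooth_on T (\<lambda>x. f (point c x))"
    proof (cases "p \<in> fst c0")
      case True
      define T where "T = snd c ` (fst c \<inter> fst c0)"
      have oT: "open T" unfolding T_def
        by (rule open_chart_image_subset[OF c]) (use open_chart[OF c] open_chart[OF c0(1)] in auto)
      have "smooth_on T (transition c c0)"
        using bundleD(1) c c0(1) unfolding smooth_manifold_def T_def by blast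
      then have "smooth_on T (\<lambda>x. b (transition c c0 x))"
        by (rule smooth_on_compose[OF sb _ oT open_UNIV UNIV_I])
      then have "smooth_on T (\<lambda>x. f (point c x))"
      proof (rule smooth_on_cong[OF _ oT])
        fix y assume "y \<in> T"
        then have "point c y \<in> fst c0" using point(3)[OF c] by (auto simp: T_def)
        then show "b (transition c c0 y) = f (point c y)" by (simp add: f_def transition_def point_def)
      qed
      moreover have "x \<in> T" using p True by (auto simp: T_def)
      ultimately show ?thesis using oT by blast
    next
      case False
      have pC: "p \<notin> C"
      proof
        assume "p \<in> C"
        then obtain y where "y \<in> cball x0 r" "p = point c0 y" by (auto simp: C_def)
        then have "p \<in> fst c0" using point(1)[OF c0(1)] r(2) by blast
        then show False using False by simp
      qed
      define T where "T = snd c ` (fst c - C)"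
      have oT: "open T" unfolding T_def
        by (rule open_chart_image_subset[OF c]) (use open_chart[OF c] clC in auto)
      have "smooth_on T (\<lambda>x. f (point c x))"
      proof (rule smooth_on_cong[OF smooth_on_const[of T 0] oT])
        fix y assume "y \<in> T"
        then have "point c y \<notin> C" using point(3)[OF c] by (auto simp: T_def)
        then show "0 = f (point c y)" using fC by simp
      qed
      moreover have "x \<in> T" using p pC by (auto simp: T_def)
      ultimately show ?thesis using oT by blast
    qed
  qed
  moreover obtain e :: 'a where e: "e \<in> Basis" using nonempty_Basis by blast
  \<comment> \<open>A point at distance \<open>r\<close> from \<open>x0\<close>, still in the chart
    image, where the bump is 0; at \<open>x0\<close> it is positive.\<close>
  define x1 where "x1 = x0 + r *\<^sub>R e"
  have x1: "x1 \<in> snd c0 ` fst c0"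
    using r e by (intro subsetD[OF r(2)]) (simp add: x1_def dist_norm)
  have "f p0 = bump (r\<^sup>2)" using c0(2) by (simp add: f_def b_def x0_def)
  moreover have "f (point c0 x1) = bump 0"
    using point(1,2)[OF c0(1) x1] e by (simp add: f_def b_def x1_def power2_eq_square)
  moreover have "bump (r\<^sup>2) \<noteq> bump 0" using r(1) by (simp add: bump_def)
  ultimately show ?thesis using that[of f p0 "point c0 x1"] by simp
qed

lemma fibre_scale_spheres:
  assumes "r > 0"
  shows "fibre_scale B r ` spheres f = spheres (\<lambda>p. ln r + f p)"
proof (intro equalityI subsetI)
  fix \<xi> assume "\<xi> \<in> fibre_scale B r ` spheres f"
  then show "\<xi> \<in> spheres (\<lambda>p. ln r + f p)"
    using assms by (auto simp: spheres_def fibre_norm_scale exp_add)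
next
  fix \<xi> assume "\<xi> \<in> spheres (\<lambda>p. ln r + f p)"
  then have "fibre_scale B (1 / r) \<xi> \<in> spheres f"
    using assms by (simp add: spheres_def fibre_norm_scale exp_add)
  moreover have "\<xi> = fibre_scale B r (fibre_scale B (1 / r) \<xi>)"
    using assms by (simp add: fibre_scale_scale)
  ultimately show "\<xi> \<in> fibre_scale B r ` spheres f" by (rule image_eqI[rotated])
qed

lemma spheres_inject:
  assumes "spheres f = spheres g" shows "f p = g p"
proof -
  obtain \<xi> where \<xi>: "\<xi> \<in> unit_sphere_bundle B" "proj B \<xi> = p" by (rule unit_vector_exists)
  then have "fibre_scale B (exp (f p)) \<xi> \<in> spheres f"
    by (simp add: spheres_def fibre_norm_scale unit_sphere_bundle_def)
  then have "exp (f p) = exp (g p)"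
    using \<xi> unfolding assms by (simp add: spheres_def fibre_norm_scale unit_sphere_bundle_def)
  then show ?thesis by simp
qed

lemma continuous_on_ray:
  assumes K: "smooth_function_on B (nonzero_vectors B) K" and \<xi>: "\<xi> \<in> unit_sphere_bundle B"
  shows "continuous_on {0<..} (\<lambda>s. K (fibre_scale B s \<xi>))"
proof -
  obtain c t where ct: "c \<in> charts B" "t \<in> trivs B" "proj B \<xi> \<in> fst c" "proj B \<xi> \<in> fst t"
    by (rule bundle_point_cases)
  define D where "D = coords B c t ` (nonzero_vectors B \<inter> proj B -` (fst c \<inter> fst t))"
  have "smooth_on D (\<lambda>z. K (from_coords B c t z))"
    using K ct unfolding smooth_function_on_def D_def by blast
  then have "continuous_on D (\<lambda>z. K (from_coords B c t z))" by (rule smooth_onD(3))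
  moreover have h: "continuous_on {0<..} (\<lambda>s. (snd c (proj B \<xi>), s *\<^sub>R snd t \<xi>))"
    by (intro continuous_intros)
  moreover have fc: "from_coords B c t (snd c (proj B \<xi>), s *\<^sub>R snd t \<xi>) = fibre_scale B s \<xi>" for s
    using from_coords_coords[OF ct(1,2), of "fibre_scale B s \<xi>"] ct by (simp add: triv_scale)
  have "(snd c (proj B \<xi>), s *\<^sub>R snd t \<xi>) \<in> D" if "s > 0" for s
  proof -
    have "fibre_scale B s \<xi> \<in> nonzero_vectors B"
      using that \<xi> by (simp add: nonzero_iff_norm fibre_norm_scale unit_sphere_bundle_def)
    then show ?thesis
      unfolding D_def using ct by (intro image_eqI[of _ _ "fibre_scale B s \<xi>"]) (auto simp: coords_def triv_scale)
  qed
  ultimately have "continuous_on {0<..} (\<lambda>s. K (from_coords B c t (snd c (proj B \<xi>), s *\<^sub>R snd t \<xi>)))"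
    by (intro continuous_on_compose2[OF _ h]) auto
  then show ?thesis by (simp add: fc)
qed

text \<open>The extremal points of one fibre bound the curvature by that of the spheres through
  them, from below at the farthest and from above at the nearest.\<close>

lemma curvature_radius_exists:
  assumes dim: "DIM('b) \<ge> 2"
    and K: "smooth_function_on B (nonzero_vectors B) K" "\<And>\<xi>. \<xi> \<in> nonzero_vectors B \<Longrightarrow> K \<xi> > 0"
    and rot: "\<And>\<xi> \<eta>. \<xi> \<in> nonzero_vectors B \<Longrightarrow> \<eta> \<in> nonzero_vectors B \<Longrightarrow>
       fibre_norm B \<xi> = fibre_norm B \<eta> \<Longrightarrow> K \<xi> = K \<eta>"
    and Y: "radial_graph B Y" "vertical_gauss_curvature_given_by B Y K"
  obtains r where "r > 0" "\<And>\<xi>. \<xi> \<in> unit_sphere_bundle B \<Longrightarrow> K (fibre_scale B r \<xi>) = (1 / r) ^ (DIM('b) - 1)"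
proof -
  obtain u where u: "smooth_on_sphere_bundle B u" "Y = radial u" using Y(1) radial_graph_iff by blast
  \<comment> \<open>Any single fibre will do, because \<open>K\<close> depends on the norm
    only.\<close>
  fix p :: 'p
  obtain L where L: "fibre_isometry B p L" using fibre_isometry_exists by blast
  interpret star_graph "fibre_height p L u" by (rule star_graph_fibre_height[OF L u(1)])
  obtain \<xi>0 where \<xi>0: "\<xi>0 \<in> unit_sphere_bundle B" by (rule unit_vector_exists)
  define k where "k s = K (fibre_scale B s \<xi>0)" for s
  have nz: "lift p L z \<in> nonzero_vectors B" "norm z > 0" if "z \<in> graph" for z
    using that by (auto simp: nonzero_iff_norm fibre_norm_lift[OF L] graph_def)
  have sc: "fibre_scale B s \<xi> \<in> nonzero_vectors B" "fibre_norm B (fibre_scale B s \<xi>) = s"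
    if "s > 0" "\<xi> \<in> unit_sphere_bundle B" for s \<xi>
    using that by (simp_all add: nonzero_iff_norm fibre_norm_scale unit_sphere_bundle_def)
  have Kk: "K (lift p L z) = k (norm z)" if "z \<in> graph" for z
    unfolding k_def using nz[OF that] sc[OF _ \<xi>0] by (intro rot) (simp_all add: fibre_norm_lift[OF L])
  have curv: "has_gauss_curvature graph z (k (norm z))" if "z \<in> graph" for z
    using fibre_curvature[OF u(1) Y(2)[unfolded u(2)] L that] Kk[OF that] by simp
  have pos: "k (norm z) > 0" if "z \<in> graph" for z using K(2)[OF nz(1)[OF that]] Kk[OF that] by simp
  obtain z1 where z1: "z1 \<in> graph" "\<And>y. y \<noteq> 0 \<Longrightarrow> fibre_height p L u y \<le> fibre_height p L u z1"
    using farthest_point by blast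
  obtain z2 where z2: "z2 \<in> graph" "\<And>y. y \<noteq> 0 \<Longrightarrow> fibre_height p L u z2 \<le> fibre_height p L u y"
    using nearest_point by blast
  have k1: "(1 / norm z1) ^ (DIM('b) - 1) \<le> k (norm z1)"
    by (rule curvature_at_farthest[OF z1 curv[OF z1(1)]])
  have k2: "k (norm z2) \<le> (1 / norm z2) ^ (DIM('b) - 1)"
    by (rule curvature_at_nearest[OF z2 curv[OF z2(1)] positive_at_graph[OF dim curv pos z2(1)]])
  have "fibre_height p L u z2 \<le> fibre_height p L u z1"
    by (rule z2(2)) (use z1(1) in \<open>simp add: graph_def\<close>)
  then have le: "norm z2 \<le> norm z1" unfolding norm_graph[OF z1(1)] norm_graph[OF z2(1)] by simp
  \<comment> \<open>The ratio of the prescribed curvature at norm \<open>s\<close> to the curvature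
    of the sphere of radius \<open>s\<close>. It is at most 1 at the nearest and at least 1 at the
    farthest point, and a radius with ratio 1 is wanted.\<close>
  define \<phi> where "\<phi> s = k s * s ^ (DIM('b) - 1)" for s
  have sub: "{norm z2..norm z1} \<subseteq> {0<..}"
    using nz(2)[OF z2(1)] by (auto simp: less_le_trans simp del: zero_less_norm_iff)
  have "continuous_on {norm z2..norm z1} \<phi>"
    unfolding \<phi>_def k_def
    by (intro continuous_intros continuous_on_subset[OF continuous_on_ray[OF K(1) \<xi>0] sub])
  moreover have "\<phi> (norm z2) \<le> 1" "1 \<le> \<phi> (norm z1)"
    using k1 k2 nz(2)[OF z1(1)] nz(2)[OF z2(1)] by (auto simp: \<phi>_def power_one_over field_simps)
  ultimately obtain r where r: "norm z2 \<le> r" "\<phi> r = 1" using IVT'[of \<phi> "norm z2" 1 "norm z1"] le by blast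
  have r0: "r > 0" using r(1) nz(2)[OF z2(1)] by linarith
  have kr: "k r = (1 / r) ^ (DIM('b) - 1)" using r(2) r0 by (simp add: \<phi>_def power_one_over field_simps)
  show ?thesis
  proof (rule that[OF r0])
    fix \<xi> assume "\<xi> \<in> unit_sphere_bundle B"
    then have "K (fibre_scale B r \<xi>) = k r"
      unfolding k_def using sc[OF r0] \<xi>0 by (intro rot) simp_all
    then show "K (fibre_scale B r \<xi>) = (1 / r) ^ (DIM('b) - 1)" using kr by simp
  qed
qed

text \<open>Rigidity in each fibre makes \<open>u\<close> a function of the base point; its
  smoothness comes from evaluating \<open>u\<close> on local unit sections.\<close>

lemma homogeneous_curvature_imp_spheres:
  assumes dim: "DIM('b) \<ge> 2"
    and K: "\<And>\<xi>. \<xi> \<in> nonzero_vectors B \<Longrightarrow> K \<xi> = (1 / fibre_norm B \<xi>) ^ (DIM('b) - 1)"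
    and Y: "radial_graph B Y" "vertical_gauss_curvature_given_by B Y K"
  obtains f where "Y = spheres f"
    "\<And>c t. c \<in> charts B \<Longrightarrow> t \<in> trivs B \<Longrightarrow> smooth_on (overlap c t) (\<lambda>x. f (point c x))"
proof -
  obtain u where u: "smooth_on_sphere_bundle B u" "Y = radial u" using Y(1) radial_graph_iff by blast
  have const: "u \<xi> = u \<eta>" if "\<xi> \<in> unit_sphere_bundle B" "\<eta> \<in> unit_sphere_bundle B" "proj B \<xi> = proj B \<eta>" for \<xi> \<eta>
  proof -
    obtain L where L: "fibre_isometry B (proj B \<eta>) L" using fibre_isometry_exists by blast
    interpret star_graph "fibre_height (proj B \<eta>) L u" by (rule star_graph_fibre_height[OF L u(1)])
    have "has_gauss_curvature graph z ((1 / norm z) ^ (DIM('b) - 1))" if "z \<in> graph" for z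
    proof -
      have "lift (proj B \<eta>) L z \<in> nonzero_vectors B"
        using that by (simp add: nonzero_iff_norm fibre_norm_lift[OF L] graph_def)
      then show ?thesis
        using fibre_curvature[OF u(1) Y(2)[unfolded u(2)] L that] K by (simp add: fibre_norm_lift[OF L])
    qed
    moreover have n: "norm (L \<xi>) = 1" "norm (L \<eta>) = 1"
      using that norm_L[OF L, of \<xi>] norm_L[OF L, of \<eta>] by (simp_all add: unit_sphere_bundle_def)
    ultimately have "fibre_height (proj B \<eta>) L u (L \<xi>) = fibre_height (proj B \<eta>) L u (L \<eta>)"
      using constant_if_curvature_homogeneous[OF dim] by (metis norm_zero zero_neq_one)
    then show ?thesis
      using n lift_L[OF L, of \<xi>] lift_L[OF L, of \<eta>] that(3) by (simp add: fibre_height_def[OF L])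
  qed
  define f where "f p = u (SOME \<xi>. \<xi> \<in> unit_sphere_bundle B \<and> proj B \<xi> = p)" for p
  have f: "u \<xi> = f (proj B \<xi>)" if "\<xi> \<in> unit_sphere_bundle B" for \<xi>
  proof -
    have "(SOME \<eta>. \<eta> \<in> unit_sphere_bundle B \<and> proj B \<eta> = proj B \<xi>) \<in> unit_sphere_bundle B \<and>
       proj B (SOME \<eta>. \<eta> \<in> unit_sphere_bundle B \<and> proj B \<eta> = proj B \<xi>) = proj B \<xi>"
      by (rule someI[of _ \<xi>]) (use that in simp)
    then show ?thesis unfolding f_def by (intro const that) auto
  qed
  show ?thesis
    by (rule that[of f]) (use radial_eq_spheres[of u f, OF f] u base_function_smooth[of u f, OF u(1) f] in auto)
qed

end

section \<open>Existence, necessity of the radius, and uniqueness of the convex solution\<close>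

theorem theorem2:
  fixes B :: "('p::t2_space, 'e::topological_space, 'a::euclidean_space, 'b::euclidean_space) metric_bundle"
    and K :: "'e \<Rightarrow> real"
  assumes "riemannian_bundle B"
    and "DIM('b) \<ge> 2"
    and "smooth_function_on B (nonzero_vectors B) K"
    and "\<forall>\<xi>\<in>nonzero_vectors B. K \<xi> > 0"
    and "\<forall>\<xi>\<in>nonzero_vectors B. \<forall>\<eta>\<in>nonzero_vectors B.
           fibre_norm B \<xi> = fibre_norm B \<eta> \<longrightarrow> K \<xi> = K \<eta>"
  shows "((\<exists>r>0. \<forall>\<xi>\<in>unit_sphere_bundle B. K (fibre_scale B r \<xi>) = r powi (1 - int DIM('b))) \<longrightarrow>
            (\<exists>Y. radial_graph B Y \<and> vertical_gauss_curvature_given_by B Y K \<and>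
               convex_radial_graph B Y))
       \<and> ((\<exists>Y. radial_graph B Y \<and> vertical_gauss_curvature_given_by B Y K) \<longrightarrow>
            (\<exists>r>0. \<forall>\<xi>\<in>unit_sphere_bundle B. K (fibre_scale B r \<xi>) = r powi (1 - int DIM('b))))
       \<and> ((\<forall>r>0. \<forall>\<xi>\<in>unit_sphere_bundle B. K (fibre_scale B r \<xi>) = r powi (1 - int DIM('b))) \<longrightarrow>
            (\<exists>\<Y>. infinite \<Y> \<and>
               (\<forall>Y\<in>\<Y>. radial_graph B Y \<and> vertical_gauss_curvature_given_by B Y K) \<and>
               (\<forall>Y\<in>\<Y>. \<forall>Y'\<in>\<Y>. Y \<noteq> Y' \<longrightarrow> \<not> homothetic B Y Y'))
          \<and> (\<exists>Y. convex_radial_graph B Y \<and> vertical_gauss_curvature_given_by B Y K \<and>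
               (\<forall>Y'. convex_radial_graph B Y' \<and> vertical_gauss_curvature_given_by B Y' K \<longrightarrow>
                  homothetic B Y Y')))"
proof -
  interpret metric_vector_bundle B by unfold_locales (rule assms(1))
  have powi: "r powi (1 - int DIM('b)) = (1 / r) ^ (DIM('b) - 1)" for r :: real
    by (rule power_int_one_minus) simp
  have K_on: "K \<xi> = (1 / fibre_norm B \<xi>) ^ (DIM('b) - 1)"
    if "\<xi> \<in> nonzero_vectors B"
      "\<And>\<eta>. \<eta> \<in> unit_sphere_bundle B \<Longrightarrow> K (fibre_scale B (fibre_norm B \<xi>) \<eta>) = fibre_norm B \<xi> powi (1 - int DIM('b))"
    for \<xi>
    using that(2)[OF unit_normalization(1)[OF that(1)]] unfolding unit_normalization(2)[OF that(1)] powi .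
  have rg: "radial_graph B (spheres (\<lambda>_. r))" for r by (intro radial_graph_spheres smooth_on_const)
  have 1: "\<exists>Y. radial_graph B Y \<and> vertical_gauss_curvature_given_by B Y K \<and> convex_radial_graph B Y"
    if r: "r > 0" "\<forall>\<xi>\<in>unit_sphere_bundle B. K (fibre_scale B r \<xi>) = r powi (1 - int DIM('b))" for r
  proof (intro exI conjI)
    show "radial_graph B (spheres (\<lambda>_. ln r))" "convex_radial_graph B (spheres (\<lambda>_. ln r))"
      using rg convex_constant_spheres by blast+
    show "vertical_gauss_curvature_given_by B (spheres (\<lambda>_. ln r)) K"
    proof (rule vertical_curvature_spheres)
      fix \<xi> assume "\<xi> \<in> spheres (\<lambda>_. ln r)"
      then have "fibre_norm B \<xi> = r" using r(1) by (simp add: spheres_def)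
      then show "K \<xi> = (1 / fibre_norm B \<xi>) ^ (DIM('b) - 1)"
        using r by (intro K_on) (auto simp: nonzero_iff_norm)
    qed
  qed
  have 2: "\<exists>r>0. \<forall>\<xi>\<in>unit_sphere_bundle B. K (fibre_scale B r \<xi>) = r powi (1 - int DIM('b))"
    if "radial_graph B Y" "vertical_gauss_curvature_given_by B Y K" for Y
    using curvature_radius_exists[OF assms(2,3) _ _ that] assms(4,5) powi by metis
  have 3: "(\<exists>\<Y>. infinite \<Y> \<and>
               (\<forall>Y\<in>\<Y>. radial_graph B Y \<and> vertical_gauss_curvature_given_by B Y K) \<and>
               (\<forall>Y\<in>\<Y>. \<forall>Y'\<in>\<Y>. Y \<noteq> Y' \<longrightarrow> \<not> homothetic B Y Y'))
          \<and> (\<exists>Y. convex_radial_graph B Y \<and> vertical_gauss_curvature_given_by B Y K \<and>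
               (\<forall>Y'. convex_radial_graph B Y' \<and> vertical_gauss_curvature_given_by B Y' K \<longrightarrow>
                  homothetic B Y Y'))"
    if "\<forall>r>0. \<forall>\<xi>\<in>unit_sphere_bundle B. K (fibre_scale B r \<xi>) = r powi (1 - int DIM('b))"
  proof
    have K: "K \<xi> = (1 / fibre_norm B \<xi>) ^ (DIM('b) - 1)" if "\<xi> \<in> nonzero_vectors B" for \<xi>
      using that \<open>\<forall>r>0. \<forall>\<xi>\<in>_. _\<close> by (intro K_on) (auto simp: nonzero_iff_norm)
    have vert: "vertical_gauss_curvature_given_by B (spheres f) K" for f
      by (rule vertical_curvature_spheres, rule K) (simp add: nonzero_iff_norm spheres_def)
    obtain f :: "'p \<Rightarrow> real" and p q where f: "f p \<noteq> f q"
      "\<And>c. c \<in> charts B \<Longrightarrow> smooth_on (snd c ` fst c) (\<lambda>x. f (point c x))"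
      using nonconstant_smooth_function by blast
    \<comment> \<open>A homothety adds a constant to the logarithm of the radius. Distinct multiples
      of the nonconstant \<open>f\<close> never differ by a constant, as comparing the values at
      \<open>p\<close> and \<open>q\<close> shows.\<close>
    define Y where "Y j = spheres (\<lambda>p. real j * f p)" for j :: nat
    have inj: "i = j" if hom: "homothetic B (Y i) (Y j)" for i j
    proof -
      obtain r where r0: "r > 0" "Y j = fibre_scale B r ` Y i"
        using hom unfolding homothetic_def by blast
      have r: "spheres (\<lambda>p. real j * f p) = spheres (\<lambda>p. ln r + real i * f p)"
        using r0(2) unfolding Y_def fibre_scale_spheres[OF r0(1)] .
      have "real j * f x = ln r + real i * f x" for x
        using spheres_inject[of "\<lambda>p. real j * f p" "\<lambda>p. ln r + real i * f p" x] r by blast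
      from this[of p] this[of q] have "(real j - real i) * (f p - f q) = 0" by (simp add: algebra_simps)
      then show ?thesis using f(1) by simp
    qed
    have refl: "homothetic B Z Z" for Z
      unfolding homothetic_def by (intro exI[of _ 1]) simp
    have "inj Y" by (rule injI) (metis inj refl)
    then have "infinite (range Y)" by (rule range_inj_infinite)
    moreover have "radial_graph B (Y j)" for j
      unfolding Y_def
      by (intro radial_graph_spheres smooth_on_mult smooth_on_const f(2) open_chart_image)
    moreover have "vertical_gauss_curvature_given_by B (Y j) K" for j unfolding Y_def by (rule vert)
    moreover have "\<not> homothetic B (Y i) (Y j)" if "Y i \<noteq> Y j" for i j using inj that by blast
    ultimately show "\<exists>\<Y>. infinite \<Y> \<and>
               (\<forall>Y\<in>\<Y>. radial_graph B Y \<and> vertical_gauss_curvature_given_by B Y K) \<and>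
               (\<forall>Y\<in>\<Y>. \<forall>Y'\<in>\<Y>. Y \<noteq> Y' \<longrightarrow> \<not> homothetic B Y Y')"
      by (intro exI[of _ "range Y"]) auto
    \<comment> \<open>The unit sphere bundle represents the convex solutions: each of them is a
      sphere bundle of constant radius \<open>exp (g p)\<close>.\<close>
    have "homothetic B (spheres (\<lambda>_. 0)) Y'"
      if Y': "convex_radial_graph B Y'" "vertical_gauss_curvature_given_by B Y' K" for Y'
    proof -
      have "radial_graph B Y'" using Y'(1) by (simp add: convex_radial_graph_def)
      then obtain g where g: "Y' = spheres g"
        "\<And>c t. c \<in> charts B \<Longrightarrow> t \<in> trivs B \<Longrightarrow> smooth_on (overlap c t) (\<lambda>x. g (point c x))"
        using homogeneous_curvature_imp_spheres[OF assms(2) K _ Y'(2)] by blast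
      have "g = (\<lambda>_. g p)"
        using convex_spheres_imp_constant[OF g(2) Y'(1)[unfolded g(1)]] by blast
      then have "Y' = spheres (\<lambda>_. g p)" using g(1) by simp
      also have "\<dots> = fibre_scale B (exp (g p)) ` spheres (\<lambda>_. 0)"
        by (subst fibre_scale_spheres) auto
      finally show ?thesis unfolding homothetic_def by (intro exI[of _ "exp (g p)"]) simp
    qed
    then show "\<exists>Y. convex_radial_graph B Y \<and> vertical_gauss_curvature_given_by B Y K \<and>
               (\<forall>Y'. convex_radial_graph B Y' \<and> vertical_gauss_curvature_given_by B Y' K \<longrightarrow>
                  homothetic B Y Y')"
      using convex_constant_spheres[OF rg] vert by blast
  qed
  show ?thesis
    by (rule conjI, use 1 in blast, rule conjI, use 2 in blast, rule impI, rule 3)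
qed

end
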